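(* Let $n$ be an even positive integer and let $A$ be an architecture on $n$ qubits with $R$ gates which is the sequential concatenation of $T=R/L$ causal slices, each consisting of $L$ gates. Let $U\in\mathrm{SU}(2^n)$ be the unitary implemented by a random quantum circuit with architecture $A$ (each gate drawn independently Haar-randomly from $\mathrm{SU}(4)$). If $T=R/L<4^n-1$, then with probability $1$, $$\mathcal{C}_{\mathrm{u}}(U)\geq \frac{R}{9L}-\frac{n}{3}.$$ Moreover, if $T=R/L<2^{n+1}-1$, then with probability $1$, $$\mathcal{C}_{\mathrm{state}}(U|0^n\rangle)\geq \frac{R}{9L}-\frac{n}{3}.$$
   Context: Qubits are labeled $1,\dots,n$, and $|0^n\rangle=|0\rangle^{\otimes n}$. An architecture is a directed acyclic graph with $R\in\mathbb{Z}_{>0}$ vertices (gates), where two edges (qubit wires) enter and two edges exit each vertex; it specifies an arrangement of $R$ two-qubit gates (not necessarily on neighboring qubits) in an $n$-qubit circuit. A random quantum circuit with architecture $A$ is obtained by placing at each vertex an independent Haar-random element of $\mathrm{SU}(4)$ and contracting along the edges, yielding an element of $\mathrm{SU}(2^n)$. A slice of an architecture is the set of gates lying between two cuts of the circuit (so the architecture is a sequential composition of consecutive slices); a slice is causal if there is a qubit $t$ such that every other qubit $t'$ is connected to $t$ by a directed path (possibly depending on $t'$) passing only through gates of the slice. The exact circuit complexity $\mathcal{C}_{\mathrm{u}}(U)$ of $U\in\mathrm{SU}(2^n)$ is the least number of two-qubit gates in any circuit (any architecture) that implements $U$ exactly. The exact state complexity $\mathcal{C}_{\mathrm{state}}(|\psi\rangle)$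 is the least number $r$ of two-qubit gates $U_1,\dots,U_r$, arranged in any architecture, such that $U_1U_2\cdots U_r|0^n\rangle=|\psi\rangle$. *)

theory Defs
  imports "HOL-Analysis.Analysis" "HOL-Probability.Probability" "Jordan_Normal_Form.Matrix"
begin

text \<open>Two-qubit gates are 4x4 complex matrices in the HOL-Analysis representation
  (type complex^4^4, a Euclidean space, so that Borel sets and measures are available).\<close>

definition cadj4 :: "complex^4^4 \<Rightarrow> complex^4^4" where
  "cadj4 G = (\<chi> i j. cnj (G $ j $ i))"

definition SU4 :: "(complex^4^4) set" where
  "SU4 = {G. cadj4 G ** G = Finite_Cartesian_Product.mat 1 \<and> Determinants.det G = 1}"

definition haar_SU4 :: "(complex^4^4) measure" where
  "haar_SU4 = (SOME M. sets M = sets borel \<and> prob_space M \<and> emeasure M (- SU4) = 0 \<and>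
       (\<forall>g\<in>SU4. distr M M (\<lambda>x. g ** x) = M))"

text \<open>Qubits are labelled 1..n; qubit k corresponds to bit (k-1) of a basis index in {0..<2^n}.
  A gate placed on the ordered pair (a,b) of distinct qubits acts with qubit a as the first
  (more significant) tensor factor of C^2 \<otimes> C^2.\<close>

definition idx4 :: "nat \<Rightarrow> nat \<Rightarrow> nat \<Rightarrow> 4" where
  "idx4 a b x = of_nat (2 * (if bit x (a - 1) then 1 else 0) + (if bit x (b - 1) then 1 else 0))"

definition embed_gate :: "nat \<Rightarrow> nat \<times> nat \<Rightarrow> complex^4^4 \<Rightarrow> complex Matrix.mat" where
  "embed_gate n ab G = (case ab of (a, b) \<Rightarrow>
     Matrix.mat (2^n) (2^n) (\<lambda>(x, y).
       if (\<forall>k\<in>{1..n} - {a, b}. bit x (k - 1) = bit y (k - 1))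
       then G $ idx4 a b x $ idx4 a b y else 0))"

text \<open>An architecture on n qubits with R gates, listed in a topological (time) order:
  the i-th gate acts on the ordered pair of distinct qubits arch ! i.\<close>

definition wf_arch :: "nat \<Rightarrow> (nat \<times> nat) list \<Rightarrow> bool" where
  "wf_arch n arch = (\<forall>(a, b)\<in>set arch. a \<in> {1..n} \<and> b \<in> {1..n} \<and> a \<noteq> b)"

definition circuit_unitary :: "nat \<Rightarrow> (nat \<times> nat) list \<Rightarrow> (nat \<Rightarrow> complex^4^4) \<Rightarrow> complex Matrix.mat" where
  "circuit_unitary n arch gs =
     fold (\<lambda>i M. embed_gate n (arch ! i) (gs i) * M) [0..<length arch] (1\<^sub>m (2^n))"

text \<open>Propagation of influence through a gate: if a gate touches a qubit already reached by a
  directed path, both of its output wires are reached.\<close>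

definition spread :: "nat set \<Rightarrow> nat \<times> nat \<Rightarrow> nat set" where
  "spread S ab = (case ab of (a, b) \<Rightarrow> if a \<in> S \<or> b \<in> S then S \<union> {a, b} else S)"

definition connected_in :: "(nat \<times> nat) list \<Rightarrow> nat \<Rightarrow> nat \<Rightarrow> bool" where
  "connected_in sl t' t = (t \<in> foldl spread {t'} sl)"

definition causal_slice :: "nat \<Rightarrow> (nat \<times> nat) list \<Rightarrow> bool" where
  "causal_slice n sl = (\<exists>t\<in>{1..n}. \<forall>t'\<in>{1..n}. t' \<noteq> t \<longrightarrow> connected_in sl t' t)"

definition causal_slices :: "nat \<Rightarrow> nat \<Rightarrow> nat \<Rightarrow> (nat \<times> nat) list \<Rightarrow> bool" where
  "causal_slices n T L arch = (length arch = T * L \<and>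
     (\<forall>j<T. causal_slice n (take L (drop (j * L) arch))))"

definition circuit_complexity :: "nat \<Rightarrow> complex Matrix.mat \<Rightarrow> nat" where
  "circuit_complexity n U = (LEAST r. \<exists>arch gs. length arch = r \<and> wf_arch n arch \<and>
      (\<forall>i<r. gs i \<in> SU4) \<and> circuit_unitary n arch gs = U)"

definition zero_state :: "nat \<Rightarrow> complex Matrix.vec" where
  "zero_state n = unit_vec (2^n) 0"

definition state_complexity :: "nat \<Rightarrow> complex Matrix.vec \<Rightarrow> nat" where
  "state_complexity n \<psi> = (LEAST r. \<exists>arch gs. length arch = r \<and> wf_arch n arch \<and>
      (\<forall>i<r. gs i \<in> SU4) \<and> circuit_unitary n arch gs *\<^sub>v zero_state n = \<psi>)"

end

theory Submission
  imports Defs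
begin

text \<open>Dimension counting, with transcendence degree in place of ranks and Haar-null sets detected
  along angle parametrizations. Pushing one-qubit gates to the end of a circuit, r gates on n qubits are
  covered by trigonometric polynomials in 9 r + 3 n angles. Conversely, let X be the set of matrices
  produced by the first j slices. If some polynomial vanishes on X but not after the next slice, the
  transcendence degree grows by one. Otherwise the ideal of X is invariant under every gate of the
  slice; causality makes the slice connected, so by products of anticommuting Pauli strings it is
  invariant under all Pauli rotations, and then the degree is already maximal. Hence, when
  9 r + 3 n < T, some polynomial vanishes on all r-gate circuits but not identically on the
  architecture, and therefore almost nowhere on it.\<close>

no_notation Matrix.vec_index (infixl \<open>$\<close> 100)

section \<open>Trigonometric polynomials\<close>

inductive trig_poly :: "nat \<Rightarrow> nat \<Rightarrow> ((nat \<Rightarrow> real) \<Rightarrow> complex) \<Rightarrow> bool" for m where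
  basis: "(\<And>i. i < m \<Longrightarrow> \<bar>k i\<bar> \<le> int d) \<Longrightarrow> trig_poly m d (\<lambda>\<theta>. cis (\<Sum>i<m. of_int (k i) * \<theta> i))"
| scale: "trig_poly m d f \<Longrightarrow> trig_poly m d (\<lambda>\<theta>. c * f \<theta>)"
| add: "trig_poly m d f \<Longrightarrow> trig_poly m d g \<Longrightarrow> trig_poly m d (\<lambda>\<theta>. f \<theta> + g \<theta>)"

lemma trig_poly_mono: "trig_poly m d f \<Longrightarrow> d \<le> d' \<Longrightarrow> trig_poly m d' f"
proof (induction rule: trig_poly.induct)
  case (basis k d)
  then show ?case by (intro trig_poly.basis) (meson order_trans of_nat_le_iff)
qed (auto intro: trig_poly.intros)

lemma trig_poly_const: "trig_poly m d (\<lambda>_. c)"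
  using trig_poly.scale[OF trig_poly.basis[of m "\<lambda>_. 0" d], of c] by simp

lemma trig_poly_sum: "finite I \<Longrightarrow> (\<And>i. i \<in> I \<Longrightarrow> trig_poly m d (f i)) \<Longrightarrow> trig_poly m d (\<lambda>\<theta>. \<Sum>i\<in>I. f i \<theta>)"
  by (induction I rule: finite_induct) (auto intro: trig_poly_const trig_poly.add)

lemma trig_poly_cis_mult:
  assumes "\<And>i. i < m \<Longrightarrow> \<bar>k i\<bar> \<le> int d" "trig_poly m d' g"
  shows "trig_poly m (d + d') (\<lambda>\<theta>. cis (\<Sum>i<m. of_int (k i) * \<theta> i) * g \<theta>)"
  using assms(2)
proof (induction rule: trig_poly.induct)
  case (basis k' d')
  have "trig_poly m (d + d') (\<lambda>\<theta>. cis (\<Sum>i<m. of_int ((\<lambda>i. k i + k' i) i) * \<theta> i))"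
    using basis assms(1) by (intro trig_poly.basis) (smt (verit) of_nat_add)
  then show ?case by (simp add: cis_mult sum.distrib algebra_simps)
next
  case (scale d' f c)
  then show ?case using trig_poly.scale[OF scale.IH, of c] by (simp add: algebra_simps)
next
  case (add d' f g)
  then show ?case using trig_poly.add[OF add.IH] by (simp add: algebra_simps)
qed

lemma trig_poly_mult:
  assumes "trig_poly m d f" "trig_poly m d' g"
  shows "trig_poly m (d + d') (\<lambda>\<theta>. f \<theta> * g \<theta>)"
  using assms
proof (induction rule: trig_poly.induct)
  case (basis k d)
  then show ?case by (intro trig_poly_cis_mult)
next
  case (scale d f c)
  then show ?case using trig_poly.scale[of m "d + d'" "\<lambda>\<theta>. f \<theta> * g \<theta>" c] by (simp add: algebra_simps)
next
  case (add d f h)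
  then show ?case using trig_poly.add[of m "d + d'" "\<lambda>\<theta>. f \<theta> * g \<theta>" "\<lambda>\<theta>. h \<theta> * g \<theta>"] by (simp add: algebra_simps)
qed

lemma trig_poly_cnj: "trig_poly m d f \<Longrightarrow> trig_poly m d (\<lambda>\<theta>. cnj (f \<theta>))"
proof (induction rule: trig_poly.induct)
  case (basis k d)
  have "trig_poly m d (\<lambda>\<theta>. cis (\<Sum>i<m. of_int ((\<lambda>i. - k i) i) * \<theta> i))"
    using basis by (intro trig_poly.basis) simp
  then show ?case by (simp add: cis_cnj sum_negf)
qed (auto intro: trig_poly.intros)

lemma trig_poly_cis: assumes "i < m" shows "trig_poly m 1 (\<lambda>\<theta>. cis (\<theta> i))"
proof -
  have "trig_poly m 1 (\<lambda>\<theta>. cis (\<Sum>j<m. of_int (if j = i then 1 else 0) * \<theta> j))"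
    by (intro trig_poly.basis) auto
  moreover have "(\<Sum>j<m. of_int (if j = i then 1 else 0) * \<theta> j) = \<theta> i" for \<theta> :: "nat \<Rightarrow> real"
    using assms by (subst sum.mono_neutral_right[of "{..<m}" "{i}"]) auto
  ultimately show ?thesis by simp
qed

lemma trig_poly_cos: assumes "i < m" shows "trig_poly m 1 (\<lambda>\<theta>. complex_of_real (cos (\<theta> i)))"
proof -
  have eq: "complex_of_real (cos x) = 1/2 * (cis x + cnj (cis x))" for x by (simp add: complex_eq_iff)
  show ?thesis unfolding eq
    by (rule trig_poly.scale[OF trig_poly.add[OF trig_poly_cis trig_poly_cnj[OF trig_poly_cis]], OF assms assms])
qed

lemma trig_poly_sin: assumes "i < m" shows "trig_poly m 1 (\<lambda>\<theta>. complex_of_real (sin (\<theta> i)))"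
proof -
  have eq: "complex_of_real (sin x) = (-\<i>/2) * cis x + (\<i>/2) * cnj (cis x)" for x by (simp add: complex_eq_iff)
  show ?thesis unfolding eq
    by (rule trig_poly.add[OF trig_poly.scale[OF trig_poly_cis] trig_poly.scale[OF trig_poly_cnj[OF trig_poly_cis]], OF assms assms])
qed

lemma trig_poly_prod:
  "finite I \<Longrightarrow> (\<And>i. i \<in> I \<Longrightarrow> trig_poly m d (f i)) \<Longrightarrow> trig_poly m (card I * d) (\<lambda>\<theta>. \<Prod>i\<in>I. f i \<theta>)"
  by (induction I rule: finite_induct) (auto intro: trig_poly_const trig_poly_mult)

definition freqs :: "nat \<Rightarrow> nat \<Rightarrow> (nat \<Rightarrow> int) set" where
  "freqs m d = PiE {..<m} (\<lambda>_. {- int d..int d})"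

lemma finite_freqs: "finite (freqs m d)" and card_freqs: "card (freqs m d) = (2 * d + 1) ^ m"
  by (auto simp: freqs_def card_PiE intro!: finite_PiE) (simp add: nat_add_distrib nat_mult_distrib)

lemma trig_poly_expansion:
  assumes "trig_poly m d f"
  shows "\<exists>c. \<forall>\<theta>. f \<theta> = (\<Sum>k\<in>freqs m d. c k * cis (\<Sum>i<m. of_int (k i) * \<theta> i))"
  using assms
proof (induction rule: trig_poly.induct)
  case (basis k d)
  let ?k = "restrict k {..<m}"
  have k: "?k \<in> freqs m d" using basis by (auto simp: freqs_def abs_le_iff) (smt (verit))
  have "(\<Sum>k\<in>freqs m d. (if k = ?k then 1 else 0) * cis (\<Sum>i<m. of_int (k i) * \<theta> i)) = cis (\<Sum>i<m. of_int (k i) * \<theta> i)" for \<theta>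
    by (subst sum.mono_neutral_right[of _ "{?k}"]) (use k in \<open>auto simp: finite_freqs\<close>)
  then show ?case by (intro exI[of _ "\<lambda>k. if k = ?k then 1 else 0"]) simp
next
  case (scale d f c)
  then obtain c' where "\<forall>\<theta>. f \<theta> = (\<Sum>k\<in>freqs m d. c' k * cis (\<Sum>i<m. of_int (k i) * \<theta> i))" by blast
  then show ?case by (intro exI[of _ "\<lambda>k. c * c' k"]) (simp add: sum_distrib_left mult.assoc)
next
  case (add d f g)
  then obtain c c' where "\<forall>\<theta>. f \<theta> = (\<Sum>k\<in>freqs m d. c k * cis (\<Sum>i<m. of_int (k i) * \<theta> i))"
   "\<forall>\<theta>. g \<theta> = (\<Sum>k\<in>freqs m d. c' k * cis (\<Sum>i<m. of_int (k i) * \<theta> i))" by blast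
  then show ?case by (intro exI[of _ "\<lambda>k. c k + c' k"]) (simp add: sum.distrib distrib_right)
qed

lemma trig_poly_slice:
  assumes "trig_poly m d f" "j < m"
  shows "\<exists>q. \<forall>t. f (\<theta>(j := t)) * cis (real d * t) = poly q (cis t)"
  using assms(1)
proof (induction rule: trig_poly.induct)
  case (basis k d)
  have *: "(\<Sum>i<m. of_int (k i) * (\<theta>(j := t)) i) = of_int (k j) * t + (\<Sum>i\<in>{..<m}-{j}. of_int (k i) * \<theta> i)" for t
    using assms(2) by (subst sum.remove[of _ j]) auto
  have kj: "0 \<le> k j + int d" using basis[OF assms(2)] by linarith
  then have "of_int (k j) * t + real d * t = real (nat (k j + int d)) * t" for t :: real
    by (simp add: algebra_simps)
  then have **: "cis (of_int (k j) * t) * cis (real d * t) = cis t ^ nat (k j + int d)" for t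
    by (simp add: cis_mult Complex.DeMoivre)
  show ?case unfolding *
    apply (rule exI[of _ "Polynomial.monom (cis (\<Sum>i\<in>{..<m}-{j}. of_int (k i) * \<theta> i)) (nat (k j + int d))"])
    using ** by (simp add: poly_monom cis_mult[symmetric] algebra_simps)
next
  case (scale d f c)
  then obtain q where "\<forall>t. f (\<theta>(j := t)) * cis (real d * t) = poly q (cis t)" by blast
  then show ?case by (intro exI[of _ "Polynomial.smult c q"]) (simp add: mult.assoc del: fun_upd_apply)
next
  case (add d f g)
  then obtain q q' where "\<forall>t. f (\<theta>(j := t)) * cis (real d * t) = poly q (cis t)"
    "\<forall>t. g (\<theta>(j := t)) * cis (real d * t) = poly q' (cis t)" by blast
  then show ?case by (intro exI[of _ "q + q'"]) (simp add: distrib_right del: fun_upd_apply)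
qed

lemma countable_cis_preimage: "countable {t. cis t = z}"
proof (cases "\<exists>t0. cis t0 = z")
  case True
  then obtain t0 where t0: "cis t0 = z" by blast
  have "{t. cis t = z} \<subseteq> range (\<lambda>k::int. t0 + 2 * pi * of_int k)"
  proof safe
    fix t assume "z = cis t"
    then have "cos (t - t0) = 1" using t0 by (simp add: cos_diff complex_eq_iff)
    then obtain k where "t - t0 = of_int k * 2 * pi" using cos_one_2pi_int by auto
    then show "t \<in> range (\<lambda>k::int. t0 + 2 * pi * of_int k)" by (auto simp: algebra_simps image_iff intro!: exI[of _ k])
  qed
  then show ?thesis by (rule countable_subset) auto
qed auto

definition unif01 :: "real measure" where "unif01 = uniform_measure lborel {0..1}"

lemma prob_unif01: "prob_space unif01" and sets_unif01: "sets unif01 = sets borel" and space_unif01: "space unif01 = UNIV"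
proof -
  show "prob_space unif01" unfolding unif01_def by (rule prob_space_uniform_measure) auto
qed (auto simp: unif01_def uniform_measure_def)

lemma AE_unif01_countable: assumes "countable C" shows "AE t in unif01. t \<notin> C"
proof -
  have "C \<in> null_sets lborel" using assms by (rule countable_imp_null_set_lborel)
  then have "AE t in lborel. t \<notin> C" by (rule AE_not_in)
  then show ?thesis unfolding unif01_def by (intro AE_uniform_measureI) auto
qed

lemma trig_poly_slice_null:
  assumes "trig_poly m d f" "j < m"
  shows "(\<forall>t. f (\<theta>(j := t)) = 0) \<or> (AE t in unif01. f (\<theta>(j := t)) \<noteq> 0)"
proof -
  obtain q where q: "\<And>t. f (\<theta>(j := t)) * cis (real d * t) = poly q (cis t)"
    using trig_poly_slice[OF assms] by blast
  have iff: "f (\<theta>(j := t)) = 0 \<longleftrightarrow> poly q (cis t) = 0" for t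
    using q[of t] by (metis cis_neq_zero mult_eq_0_iff)
  show ?thesis
  proof (cases "q = 0")
    case False
    have "{t. f (\<theta>(j := t)) = 0} = (\<Union>z\<in>{z. poly q z = 0}. {t. cis t = z})" using iff by auto
    moreover have "countable (\<Union>z\<in>{z. poly q z = 0}. {t. cis t = z})"
      using poly_roots_finite[OF False] countable_cis_preimage by (intro countable_UN) (auto intro: countable_finite)
    ultimately have "AE t in unif01. t \<notin> {t. f (\<theta>(j := t)) = 0}" by (intro AE_unif01_countable) simp
    then show ?thesis by simp
  qed (use iff in auto)
qed

lemma AE_PiM_nonzero:
  fixes f :: "(nat \<Rightarrow> 'a) \<Rightarrow> complex"
  assumes M: "prob_space M"
    and "f \<in> borel_measurable (PiM {..<R} (\<lambda>_. M))"
    and "\<And>x i. i < R \<Longrightarrow> (\<forall>g\<in>A. f (x(i := g)) = 0) \<or> (AE g in M. f (x(i := g)) \<noteq> 0)"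
    and "A \<subseteq> space M"
    and "\<And>i. i < R \<Longrightarrow> z i \<in> A" "f (restrict z {..<R}) \<noteq> 0"
  shows "AE x in PiM {..<R} (\<lambda>_. M). f x \<noteq> 0"
  using assms(2-)
proof (induction R arbitrary: f z)
  case 0
  then have "f (\<lambda>_. undefined) \<noteq> 0" by (simp add: restrict_def)
  then show ?case by (intro AE_I2) (simp add: space_PiM)
next
  case (Suc R)
  interpret prob_space M by fact
  let ?P = "PiM {..<R} (\<lambda>_. M)"
  interpret P: prob_space ?P by (intro prob_space_PiM M)
  interpret pair_sigma_finite M ?P ..
  define a where "a = z R"
  have a: "a \<in> A" using Suc.prems unfolding a_def by auto
  have ins: "insert R {..<R} = {..<Suc R}" by auto
  have meas: "(\<lambda>(g, x). x(R := g)) \<in> measurable (M \<Otimes>\<^sub>M ?P) (PiM {..<Suc R} (\<lambda>_. M))"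
    unfolding ins[symmetric] by measurable
  note fm = Suc.prems(1)
  have fm2: "(\<lambda>(g, x). f (x(R := g))) \<in> borel_measurable (M \<Otimes>\<^sub>M ?P)"
    using measurable_compose[OF meas fm] by (simp only: case_prod_unfold)
  have r: "(restrict z {..<R})(R := a) = restrict z {..<Suc R}" unfolding a_def by (auto simp: restrict_def)
  have "AE x in ?P. f (x(R := a)) \<noteq> 0"
  proof (rule Suc.IH[where z=z])
    show "f ((restrict z {..<R})(R := a)) \<noteq> 0" unfolding r by (rule Suc.prems)
    have "(\<lambda>x. (a, x)) \<in> measurable ?P (M \<Otimes>\<^sub>M ?P)" using a Suc.prems by auto
    from measurable_compose[OF this fm2] show "(\<lambda>x. f (x(R := a))) \<in> borel_measurable ?P" by simp
    fix x i assume i: "i < R"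
    then have sw: "x(i := g, R := a) = x(R := a, i := g)" for g by (simp add: fun_upd_twist)
    show "(\<forall>g\<in>A. f (x(i := g, R := a)) = 0) \<or> (AE g in M. f (x(i := g, R := a)) \<noteq> 0)"
      unfolding sw using Suc.prems(2)[of i] i by (simp del: fun_upd_apply)
  qed (use Suc.prems in auto)
  then have "AE x in ?P. AE g in M. f (x(R := g)) \<noteq> 0"
  proof eventually_elim
    case (elim x)
    with a Suc.prems(2)[of R x] show ?case by (auto simp del: fun_upd_apply)
  qed
  then have "AE g in M. AE x in ?P. f (x(R := g)) \<noteq> 0"
    by (subst AE_commute[where P="\<lambda>g x. f (x(R := g)) \<noteq> 0"])
       (use fm2 in \<open>auto simp: case_prod_unfold\<close>)
  then have "AE z in M \<Otimes>\<^sub>M ?P. (case z of (g, x) \<Rightarrow> f (x(R := g))) \<noteq> 0"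
    by (intro AE_pair_measure) (use fm2 in \<open>auto simp: case_prod_unfold\<close>)
  then have "AE x in distr (M \<Otimes>\<^sub>M ?P) (PiM {..<Suc R} (\<lambda>_. M)) (\<lambda>(g, x). x(R := g)). f x \<noteq> 0"
    by (subst AE_distr_iff) (use meas fm in \<open>auto simp: case_prod_unfold\<close>)
  moreover have "distr (M \<Otimes>\<^sub>M ?P) (PiM {..<Suc R} (\<lambda>_. M)) (\<lambda>(g, x). x(R := g)) = PiM {..<Suc R} (\<lambda>_. M)"
    using distr_pair_PiM_eq_PiM[of "{..<R}" "\<lambda>_. M" R] M unfolding ins by simp
  ultimately show ?case by (simp only:)
qed

lemma trig_poly_measurable:
  "trig_poly m d f \<Longrightarrow> f \<in> borel_measurable (PiM {..<m} (\<lambda>_. unif01))"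
proof (induction rule: trig_poly.induct)
  case (basis k d)
  have "cis \<in> borel_measurable borel" by (intro borel_measurable_continuous_onI continuous_intros)
  moreover have "(\<lambda>\<theta>. \<Sum>i<m. of_int (k i) * \<theta> i) \<in> borel_measurable (PiM {..<m} (\<lambda>_. unif01))"
  proof (intro borel_measurable_sum borel_measurable_times borel_measurable_const)
    fix i assume "i \<in> {..<m}"
    then have "(\<lambda>\<theta>. \<theta> i) \<in> measurable (PiM {..<m} (\<lambda>_. unif01)) unif01" by (rule measurable_component_singleton)
    then show "(\<lambda>\<theta>. \<theta> i) \<in> borel_measurable (PiM {..<m} (\<lambda>_. unif01))"
      using measurable_cong_sets[OF refl sets_unif01] by blast
  qed
  ultimately show ?case by (rule measurable_compose[rotated])
qed auto

lemma trig_poly_restrict: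
  "trig_poly m d f \<Longrightarrow> f (restrict \<theta> {..<m}) = f \<theta>"
  by (induction rule: trig_poly.induct) auto

lemma trig_poly_AE_nonzero:
  assumes "trig_poly m d f" "f \<theta>0 \<noteq> 0"
  shows "AE \<theta> in PiM {..<m} (\<lambda>_. unif01). f \<theta> \<noteq> 0"
  using trig_poly_slice_null[OF assms(1)] assms trig_poly_restrict[OF assms(1)]
  by (intro AE_PiM_nonzero[where A=UNIV and z=\<theta>0] prob_unif01 trig_poly_measurable[OF assms(1)])
     (auto simp: space_unif01)

lemma linear_system_nontrivial:
  fixes a :: "'i \<Rightarrow> 'j \<Rightarrow> 'b::field"
  assumes "finite J" "finite I" "card J < card I"
  shows "\<exists>c. (\<exists>i\<in>I. c i \<noteq> 0) \<and> (\<forall>j\<in>J. (\<Sum>i\<in>I. c i * a i j) = 0)"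
  using assms
proof (induction J arbitrary: I a rule: finite_induct)
  case empty
  then obtain i where "i \<in> I" by (metis all_not_in_conv card.empty less_irrefl)
  then show ?case by (intro exI[of _ "\<lambda>_. 1"]) auto
next
  case (insert j J)
  show ?case
  proof (cases "\<forall>i\<in>I. a i j = 0")
    case True
    have "card J < card I" using insert by simp
    from insert.IH[OF insert.prems(1) this, of a] show ?thesis using True by (auto; force)
  next
    case False
    then obtain p where p: "p \<in> I" "a p j \<noteq> 0" by blast
    define b where "b i l = a i l - a i j / a p j * a p l" for i l
    have "card J < card (I - {p})" using insert p by simp
    from insert.IH[OF _ this, of b] insert.prems(1)
    obtain c where c: "\<exists>i\<in>I-{p}. c i \<noteq> 0" "\<And>l. l \<in> J \<Longrightarrow> (\<Sum>i\<in>I-{p}. c i * b i l) = 0" by auto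
    define c' where "c' = c(p := - (\<Sum>i\<in>I-{p}. c i * a i j) / a p j)"
    have s: "(\<Sum>i\<in>I. c' i * a i l) = (\<Sum>i\<in>I-{p}. c i * a i l) - (\<Sum>i\<in>I-{p}. c i * a i j) / a p j * a p l" for l
      by (subst sum.remove[OF insert.prems(1) p(1)]) (auto simp: c'_def intro!: sum.cong)
    have "(\<Sum>i\<in>I. c' i * a i l) = (\<Sum>i\<in>I-{p}. c i * b i l)" for l
      unfolding s b_def by (simp add: sum_subtractf right_diff_distrib sum_divide_distrib sum_distrib_right mult.assoc)
    moreover have "(\<Sum>i\<in>I. c' i * a i j) = 0" unfolding s using p(2) by simp
    moreover have "\<exists>i\<in>I. c' i \<noteq> 0" using c(1) by (auto simp: c'_def)
    ultimately show ?thesis using c(2) by (intro exI[of _ c']) auto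
  qed
qed

section \<open>Parametrizing SU(4)\<close>

lemma exhaust4: "(x::4) = 0 \<or> x = 1 \<or> x = 2 \<or> x = 3"
proof -
  have "(4::4) = 0" by simp
  then show ?thesis using exhaust_4[of x] by metis
qed

lemma sum4: "sum f (UNIV::4 set) = f 0 + f 1 + f 2 + f 3"
proof -
  have "(4::4) = 0" by simp
  then show ?thesis unfolding sum_4 by (simp only: add_ac)
qed

lemma all4: "(\<forall>x::4. P x) \<longleftrightarrow> P 0 \<and> P 1 \<and> P 2 \<and> P 3"
  by (metis exhaust4)

lemma det_4:
  "Determinants.det (A::'a::comm_ring_1^4^4) =
    A$0$0 * (A$1$1 * (A$2$2 * A$3$3 - A$2$3 * A$3$2) - A$1$2 * (A$2$1 * A$3$3 - A$2$3 * A$3$1) + A$1$3 * (A$2$1 * A$3$2 - A$2$2 * A$3$1))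
  - A$0$1 * (A$1$0 * (A$2$2 * A$3$3 - A$2$3 * A$3$2) - A$1$2 * (A$2$0 * A$3$3 - A$2$3 * A$3$0) + A$1$3 * (A$2$0 * A$3$2 - A$2$2 * A$3$0))
  + A$0$2 * (A$1$0 * (A$2$1 * A$3$3 - A$2$3 * A$3$1) - A$1$1 * (A$2$0 * A$3$3 - A$2$3 * A$3$0) + A$1$3 * (A$2$0 * A$3$1 - A$2$1 * A$3$0))
  - A$0$3 * (A$1$0 * (A$2$1 * A$3$2 - A$2$2 * A$3$1) - A$1$1 * (A$2$0 * A$3$2 - A$2$2 * A$3$0) + A$1$2 * (A$2$0 * A$3$1 - A$2$1 * A$3$0))"
proof -
  have U: "(UNIV::4 set) = {0, 1, 2, 3}" using exhaust4 by auto
  have f: "finite {1::4, 2, 3}" "0 \<notin> {1::4, 2, 3}" "finite {2::4, 3}" "1 \<notin> {2::4, 3}" "finite {3::4}" "2 \<notin> {3::4}"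
    by auto
  show ?thesis
    unfolding Determinants.det_def U
    unfolding sum_over_permutations_insert[OF f(1,2)]
    unfolding sum_over_permutations_insert[OF f(3,4)]
    unfolding sum_over_permutations_insert[OF f(5,6)]
    unfolding permutes_sing
    by (simp add: sign_swap_id permutation_swap_id sign_compose sign_id swap_id_eq permutation_compose algebra_simps)
qed

lemma mat_mult_4: "(A ** B) $ i $ j = A$i$0 * B$0$j + A$i$1 * B$1$j + A$i$2 * B$2$j + A$i$3 * B$3$j"
  for A B :: "'a::semiring_1^4^4"
  by (simp add: matrix_matrix_mult_def sum4)

lemma cadj4_mult: "cadj4 (A ** B) = cadj4 B ** cadj4 A"
  by (simp add: Finite_Cartesian_Product.vec_eq_iff cadj4_def matrix_matrix_mult_def mult.commute)

lemma cadj4_cadj4 [simp]: "cadj4 (cadj4 A) = A"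
  by (simp add: Finite_Cartesian_Product.vec_eq_iff cadj4_def)

lemma det_cadj4: "Determinants.det (cadj4 A) = cnj (Determinants.det A)"
  by (simp add: det_4 cadj4_def algebra_simps)

lemma SU4_mult: "A \<in> SU4 \<Longrightarrow> B \<in> SU4 \<Longrightarrow> A ** B \<in> SU4"
  unfolding SU4_def mem_Collect_eq cadj4_mult det_mul
  by (metis matrix_mul_assoc matrix_mul_lid mult_1)

lemma SU4_cadj4_left: "A \<in> SU4 \<Longrightarrow> cadj4 A ** A = Finite_Cartesian_Product.mat 1"
  and SU4_cadj4_right: "A \<in> SU4 \<Longrightarrow> A ** cadj4 A = Finite_Cartesian_Product.mat 1"
  and SU4_det: "A \<in> SU4 \<Longrightarrow> Determinants.det A = 1"
  by (auto simp: SU4_def matrix_left_right_inverse)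

lemma SU4_cadj4: "A \<in> SU4 \<Longrightarrow> cadj4 A \<in> SU4"
  by (auto simp: SU4_def det_cadj4 matrix_left_right_inverse)

lemma SU4_one: "Finite_Cartesian_Product.mat 1 \<in> SU4"
proof -
  have "cadj4 (Finite_Cartesian_Product.mat 1) = Finite_Cartesian_Product.mat 1"
    by (auto simp: Finite_Cartesian_Product.vec_eq_iff cadj4_def Finite_Cartesian_Product.mat_def)
  then show ?thesis by (simp add: SU4_def)
qed

lemma SU4_cancel: "A \<in> SU4 \<Longrightarrow> A ** (cadj4 A ** B) = B" "A \<in> SU4 \<Longrightarrow> cadj4 A ** (A ** B) = B"
  by (simp_all add: matrix_mul_assoc SU4_cadj4_left SU4_cadj4_right)

lemma SU4_row_norm: assumes "A \<in> SU4" shows "(cmod (A$i$0))\<^sup>2 + (cmod (A$i$1))\<^sup>2 + (cmod (A$i$2))\<^sup>2 + (cmod (A$i$3))\<^sup>2 = 1"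
proof -
  have "(A ** cadj4 A) $ i $ i = 1" using SU4_cadj4_right[OF assms] by (simp add: Finite_Cartesian_Product.mat_def)
  then have "complex_of_real ((cmod (A$i$0))\<^sup>2 + (cmod (A$i$1))\<^sup>2 + (cmod (A$i$2))\<^sup>2 + (cmod (A$i$3))\<^sup>2) = 1"
    by (simp add: mat_mult_4 cadj4_def complex_norm_square del: of_real_power)
  then show ?thesis by (metis of_real_eq_1_iff)
qed

lemma SU4_col_norm: "A \<in> SU4 \<Longrightarrow> (cmod (A$0$i))\<^sup>2 + (cmod (A$1$i))\<^sup>2 + (cmod (A$2$i))\<^sup>2 + (cmod (A$3$i))\<^sup>2 = 1"
  using SU4_row_norm[OF SU4_cadj4, of A i] by (simp add: cadj4_def)

definition unit2 :: "complex \<Rightarrow> complex \<Rightarrow> bool" where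
  "unit2 a b \<longleftrightarrow> (cmod a)\<^sup>2 + (cmod b)\<^sup>2 = 1"

lemma unit2_iff: "unit2 a b \<longleftrightarrow> a * cnj a + b * cnj b = 1"
proof -
  have "a * cnj a + b * cnj b = complex_of_real ((cmod a)\<^sup>2 + (cmod b)\<^sup>2)"
    by (simp add: complex_norm_square del: of_real_power)
  then show ?thesis unfolding unit2_def by (metis of_real_eq_1_iff)
qed

definition su2 :: "complex \<Rightarrow> complex \<Rightarrow> bool \<Rightarrow> bool \<Rightarrow> complex" where
  "su2 a b i j = (if i then (if j then cnj a else b) else (if j then - cnj b else a))"

definition SU2 :: "(bool \<Rightarrow> bool \<Rightarrow> complex) set" where
  "SU2 = {su2 a b | a b. unit2 a b}"

definition idB :: "bool \<Rightarrow> bool \<Rightarrow> complex" where "idB i j = (if i = j then 1 else 0)"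

lemma idB_eq: "idB = su2 1 0" by (auto simp: fun_eq_iff idB_def su2_def)

lemma idB_SU2: "idB \<in> SU2" unfolding SU2_def idB_eq unit2_def by force

lemma su2_SU2: "unit2 a b \<Longrightarrow> su2 a b \<in> SU2" by (auto simp: SU2_def)

definition hi4 :: "4 \<Rightarrow> bool" where "hi4 i \<longleftrightarrow> i = 2 \<or> i = 3"
definition lo4 :: "4 \<Rightarrow> bool" where "lo4 i \<longleftrightarrow> i = 1 \<or> i = 3"

definition kron2 :: "(bool \<Rightarrow> bool \<Rightarrow> complex) \<Rightarrow> (bool \<Rightarrow> bool \<Rightarrow> complex) \<Rightarrow> complex^4^4" where
  "kron2 k l = (\<chi> i j. k (hi4 i) (hi4 j) * l (lo4 i) (lo4 j))"

lemma hi4_simps [simp]: "\<not> hi4 0" "\<not> hi4 1" "hi4 2" "hi4 3" and lo4_simps [simp]: "\<not> lo4 0" "lo4 1" "\<not> lo4 2" "lo4 3"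
  by (auto simp: hi4_def lo4_def)

definition adj2 :: "(bool \<Rightarrow> bool \<Rightarrow> complex) \<Rightarrow> bool \<Rightarrow> bool \<Rightarrow> complex" where
  "adj2 k i j = cnj (k j i)"

definition mul2 :: "(bool \<Rightarrow> bool \<Rightarrow> complex) \<Rightarrow> (bool \<Rightarrow> bool \<Rightarrow> complex) \<Rightarrow> bool \<Rightarrow> bool \<Rightarrow> complex" where
  "mul2 k l i j = k i False * l False j + k i True * l True j"

lemma kron2_mult: "kron2 k l ** kron2 k' l' = kron2 (mul2 k k') (mul2 l l')"
  by (simp add: Finite_Cartesian_Product.vec_eq_iff mat_mult_4 kron2_def mul2_def algebra_simps)

lemma kron2_adj: "cadj4 (kron2 k l) = kron2 (adj2 k) (adj2 l)"
  by (simp add: Finite_Cartesian_Product.vec_eq_iff cadj4_def kron2_def adj2_def)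

lemma SU2_adj2: "k \<in> SU2 \<Longrightarrow> adj2 k \<in> SU2"
proof -
  assume "k \<in> SU2"
  then obtain a b where "k = su2 a b" "unit2 a b" by (auto simp: SU2_def)
  then have "adj2 k = su2 (cnj a) (- b)" "unit2 (cnj a) (- b)"
    by (auto simp: fun_eq_iff adj2_def su2_def unit2_def)
  then show ?thesis by (auto simp: SU2_def)
qed

lemma SU2_mul2: "k \<in> SU2 \<Longrightarrow> l \<in> SU2 \<Longrightarrow> mul2 k l \<in> SU2"
proof -
  assume "k \<in> SU2" "l \<in> SU2"
  then obtain a b c d where kl: "k = su2 a b" "l = su2 c d" and u: "unit2 a b" "unit2 c d" by (auto simp: SU2_def)
  have "mul2 k l = su2 (a * c - cnj b * d) (b * c + cnj a * d)"
    by (auto simp: kl fun_eq_iff mul2_def su2_def)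
  moreover have "unit2 (a * c - cnj b * d) (b * c + cnj a * d)"
  proof -
    have "(a * c - cnj b * d) * cnj (a * c - cnj b * d) + (b * c + cnj a * d) * cnj (b * c + cnj a * d)
       = (a * cnj a + b * cnj b) * (c * cnj c + d * cnj d)" by (simp add: algebra_simps)
    then show ?thesis using u unfolding unit2_iff by simp
  qed
  ultimately show ?thesis by (auto simp: SU2_def)
qed

lemma kron2_SU4: assumes "k \<in> SU2" "l \<in> SU2" shows "kron2 k l \<in> SU4"
proof -
  obtain a b c d where kl: "k = su2 a b" "l = su2 c d" and u: "unit2 a b" "unit2 c d" using assms by (auto simp: SU2_def)
  have adj: "mul2 (adj2 (su2 a b)) (su2 a b) = idB" if "unit2 a b" for a b
    using that unfolding unit2_iff by (auto simp: fun_eq_iff mul2_def adj2_def su2_def idB_def algebra_simps)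
  have one: "kron2 idB idB = Finite_Cartesian_Product.mat 1"
    unfolding Finite_Cartesian_Product.vec_eq_iff all4 by (simp add: kron2_def idB_def Finite_Cartesian_Product.mat_def)
  have "Determinants.det (kron2 k l) = (a * cnj a + b * cnj b)\<^sup>2 * (c * cnj c + d * cnj d)\<^sup>2"
    unfolding det_4 kl by (simp add: kron2_def su2_def power2_eq_square algebra_simps)
  then show ?thesis using u adj[OF u(1)] adj[OF u(2)]
    by (simp add: SU4_def kron2_adj kron2_mult kl one unit2_iff)
qed

definition tl4 :: "4 \<Rightarrow> 4 \<Rightarrow> complex \<Rightarrow> complex \<Rightarrow> complex^4^4" where
  "tl4 p q a b = (\<chi> i j. if i = p \<and> j = p then a else if i = p \<and> j = q then - cnj b
     else if i = q \<and> j = p then b else if i = q \<and> j = q then cnj a else if i = j then 1 else 0)"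

lemma tl4_SU4:
  assumes "unit2 a b"
  shows "tl4 0 3 a b \<in> SU4" "tl4 1 2 a b \<in> SU4" "tl4 2 3 a b \<in> SU4"
  using assms unfolding SU4_def unit2_iff mem_Collect_eq Finite_Cartesian_Product.vec_eq_iff all4 det_4 mat_mult_4
  by (simp_all add: tl4_def cadj4_def Finite_Cartesian_Product.mat_def algebra_simps)

lemma su2_diagonalize:
  fixes p0 p1 q0 q1 :: complex
  shows "\<exists>a b. unit2 a b \<and> cnj (a * p0 - cnj b * q0) * (b * p0 + cnj a * q0) + cnj (a * p1 - cnj b * q1) * (b * p1 + cnj a * q1) = 0"
proof -
  define w where "w = cnj p0 * q0 + cnj p1 * q1"
  define \<epsilon> where "\<epsilon> = (if w = 0 then 1 else w / cmod w)"
  have we: "w = cmod w * \<epsilon>" and e1: "cmod \<epsilon> = 1" by (auto simp: \<epsilon>_def norm_divide)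
  have ee: "\<epsilon> * cnj \<epsilon> = 1" using e1 by (simp add: complex_norm_square[symmetric])
  define D where "D = (cmod p0)\<^sup>2 + (cmod p1)\<^sup>2 - (cmod q0)\<^sup>2 - (cmod q1)\<^sup>2"
  define f where "f t = cos t * sin t * D + cmod w * ((cos t)\<^sup>2 - (sin t)\<^sup>2)" for t :: real
  have "\<exists>t. 0 \<le> t \<and> t \<le> pi/2 \<and> f t = 0"
    by (rule IVT2) (auto simp: f_def intro!: continuous_intros)
  then obtain t where t: "f t = 0" by blast
  define c s where "c = complex_of_real (cos t)" and "s = complex_of_real (sin t)"
  have cs: "c * c + s * s = 1" unfolding c_def s_def by (metis of_real_1 of_real_add of_real_mult sin_cos_squared_add3)
  have rc: "cnj c = c" "cnj s = s" by (simp_all add: c_def s_def)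
  have f0: "c * s * (p0 * cnj p0 + p1 * cnj p1 - q0 * cnj q0 - q1 * cnj q1) + cmod w * (c * c - s * s) = 0"
  proof -
    have "complex_of_real (f t) = 0" using t by simp
    then show ?thesis by (simp add: f_def D_def c_def s_def complex_norm_square power2_eq_square[of "complex_of_real _"] del: of_real_power)
      (simp add: power2_eq_square)
  qed
  have w2: "cnj w = cmod w * cnj \<epsilon>" using we by (metis complex_cnj_complex_of_real complex_cnj_mult)
  have "cnj (c * p0 - cnj (s * \<epsilon>) * q0) * (s * \<epsilon> * p0 + cnj c * q0) + cnj (c * p1 - cnj (s * \<epsilon>) * q1) * (s * \<epsilon> * p1 + cnj c * q1)
     = c * s * \<epsilon> * (p0 * cnj p0 + p1 * cnj p1 - q0 * cnj q0 - q1 * cnj q1) + c * c * w - s * s * \<epsilon> * \<epsilon> * cnj w"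
    by (simp add: rc w_def algebra_simps)
  also have "\<dots> = \<epsilon> * (c * s * (p0 * cnj p0 + p1 * cnj p1 - q0 * cnj q0 - q1 * cnj q1) + cmod w * (c * c - s * s * (\<epsilon> * cnj \<epsilon>)))"
    unfolding w2 by (subst we) (simp add: algebra_simps)
  also have "\<dots> = 0" using f0 ee by simp
  finally have "cnj (c * p0 - cnj (s * \<epsilon>) * q0) * (s * \<epsilon> * p0 + cnj c * q0) + cnj (c * p1 - cnj (s * \<epsilon>) * q1) * (s * \<epsilon> * p1 + cnj c * q1) = 0" .
  moreover have "unit2 c (s * \<epsilon>)"
    using cs ee unfolding unit2_iff by (simp add: rc algebra_simps) (metis (no_types, opaque_lifting) mult.assoc mult.commute mult.right_neutral)
  ultimately show ?thesis by blast
qed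

lemma unit2_normalize:
  assumes "(x, y) \<noteq> (0, 0)"
  shows "\<exists>\<rho>>0. unit2 (x / complex_of_real \<rho>) (y / complex_of_real \<rho>) \<and> (x * cnj x + y * cnj y = complex_of_real (\<rho>\<^sup>2))"
proof (intro exI conjI)
  let ?r = "sqrt ((cmod x)\<^sup>2 + (cmod y)\<^sup>2)"
  have pos: "(cmod x)\<^sup>2 + (cmod y)\<^sup>2 > 0" using assms by (auto simp: sum_power2_gt_zero_iff)
  then show "?r > 0" by simp
  then show "unit2 (x / complex_of_real ?r) (y / complex_of_real ?r)"
    using pos by (auto simp: unit2_def norm_divide power_divide add_divide_distrib[symmetric])
  show "x * cnj x + y * cnj y = complex_of_real (?r\<^sup>2)"
    using pos by (simp add: complex_norm_square del: of_real_power)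
qed

lemma su2_triangularize:
  assumes "cnj p0 * q0 + cnj p1 * q1 = 0"
  shows "\<exists>a b. unit2 a b \<and> b * p0 + cnj a * p1 = 0 \<and> a * q0 - cnj b * q1 = 0 \<and> Im (a * p0 - cnj b * p1) = 0"
proof (cases "(p0, p1) = (0, 0)")
  case False
  from unit2_normalize[OF this] obtain \<rho> where r: "\<rho> > 0" "unit2 (p0 / complex_of_real \<rho>) (p1 / complex_of_real \<rho>)" "p0 * cnj p0 + p1 * cnj p1 = complex_of_real (\<rho>\<^sup>2)" by blast
  let ?a = "cnj p0 / complex_of_real \<rho>" and ?b = "- p1 / complex_of_real \<rho>"
  have "unit2 ?a ?b" using r(2) by (simp add: unit2_def norm_divide)
  moreover have "?b * p0 + cnj ?a * p1 = 0" by (simp add: algebra_simps)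
  moreover have "?a * q0 - cnj ?b * q1 = (cnj p0 * q0 + cnj p1 * q1) / complex_of_real \<rho>" by (simp add: add_divide_distrib)
  moreover have "?a * p0 - cnj ?b * p1 = (p0 * cnj p0 + p1 * cnj p1) / complex_of_real \<rho>" by (simp add: add_divide_distrib algebra_simps)
  then have "Im (?a * p0 - cnj ?b * p1) = 0" unfolding r(3) by simp
  ultimately show ?thesis using assms by (intro exI[of _ ?a] exI[of _ ?b]) simp
next
  case p: True
  show ?thesis
  proof (cases "(q0, q1) = (0, 0)")
    case True
    then show ?thesis using p by (intro exI[of _ 1] exI[of _ 0]) (simp add: unit2_def)
  next
    case False
    from unit2_normalize[OF this] obtain \<rho> where r: "\<rho> > 0" "unit2 (q0 / complex_of_real \<rho>) (q1 / complex_of_real \<rho>)" by blast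
    then show ?thesis using p
      by (intro exI[of _ "q1 / complex_of_real \<rho>"] exI[of _ "cnj q0 / complex_of_real \<rho>"])
         (auto simp: unit2_def norm_divide add.commute)
  qed
qed

lemma unit2_polar:
  assumes "unit2 a b"
  shows "\<exists>t u v. a = complex_of_real (cos t) * cis u \<and> b = complex_of_real (sin t) * cis v"
proof -
  have "(cmod a)\<^sup>2 + (cmod b)\<^sup>2 = 1" using assms by (simp add: unit2_def)
  then obtain t where "cmod a = cos t" "cmod b = sin t" using sincos_total_2pi by metis
  moreover have "a = complex_of_real (cmod a) * cis (Arg a)" "b = complex_of_real (cmod b) * cis (Arg b)"
    by (simp_all add: rcis_def[symmetric] rcis_cmod_Arg)
  ultimately show ?thesis by metis
qed

lemma unit2_polar_real:
  assumes "unit2 a b" "Im a = 0"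
  shows "\<exists>t v. a = complex_of_real (cos t) \<and> b = complex_of_real (sin t) * cis v"
proof -
  have "(Re a)\<^sup>2 + (cmod b)\<^sup>2 = 1" using assms by (simp add: unit2_def cmod_def)
  then obtain t where "Re a = cos t" "cmod b = sin t" using sincos_total_2pi by metis
  moreover have "a = complex_of_real (Re a)" using assms by (simp add: complex_eq_iff)
  moreover have "b = complex_of_real (cmod b) * cis (Arg b)" by (simp add: rcis_def[symmetric] rcis_cmod_Arg)
  ultimately show ?thesis by metis
qed


definition su2_angles :: "(nat \<Rightarrow> real) \<Rightarrow> bool \<Rightarrow> bool \<Rightarrow> complex" where
  "su2_angles t = su2 (complex_of_real (cos (t 0)) * cis (t 1)) (complex_of_real (sin (t 0)) * cis (t 2))"

definition coset_angles :: "(nat \<Rightarrow> real) \<Rightarrow> complex^4^4" where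
  "coset_angles t = tl4 0 3 (complex_of_real (cos (t 0))) (complex_of_real (sin (t 0)) * cis (t 1)) **
     (tl4 2 3 (complex_of_real (cos (t 4))) (complex_of_real (sin (t 4)) * cis (t 5)) **
     (tl4 1 2 (complex_of_real (cos (t 2))) (complex_of_real (sin (t 2)) * cis (t 3)) **
      tl4 2 3 (complex_of_real (cos (t 6)) * cis (t 7)) (complex_of_real (sin (t 6)) * cis (t 8))))"

lemma unit2_angles: "unit2 (complex_of_real (cos t) * cis u) (complex_of_real (sin t) * cis v)"
  by (simp add: unit2_def norm_mult)

lemma unit2_angles_real: "unit2 (complex_of_real (cos t)) (complex_of_real (sin t) * cis v)"
  using unit2_angles[of t 0 v] by simp

lemma coset_angles_SU4: "coset_angles t \<in> SU4"
  unfolding coset_angles_def by (intro SU4_mult tl4_SU4 unit2_angles unit2_angles_real)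

lemma su2_angles_SU2: "su2_angles t \<in> SU2"
  unfolding su2_angles_def by (intro su2_SU2 unit2_angles)

lemma SU2_angles: assumes "k \<in> SU2" obtains t where "k = su2_angles t"
proof -
  obtain a b where "k = su2 a b" "unit2 a b" using assms by (auto simp: SU2_def)
  with unit2_polar[of a b] obtain t u v where
    "k = su2 (complex_of_real (cos t) * cis u) (complex_of_real (sin t) * cis v)" by blast
  then show ?thesis by (intro that[of "(\<lambda>_. 0)(0 := t, 1 := u, 2 := v)"]) (simp add: su2_angles_def)
qed

lemma kron2_cancel:
  assumes "k \<in> SU2" "l \<in> SU2"
  shows "G = kron2 (adj2 k) (adj2 l) ** (kron2 k l ** G)"
  using SU4_cancel(2)[OF kron2_SU4[OF assms], of G] unfolding kron2_adj by (rule sym)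

text \<open>Read the first column of G as a 2x2 matrix: l makes its columns orthogonal, k then makes it diagonal
  with a real first entry, and the residual diagonal phase makes the entry (1, 1) real.\<close>

lemma SU4_local_normal_form:
  assumes "G \<in> SU4"
  shows "\<exists>k\<in>SU2. \<exists>l\<in>SU2. \<exists>H\<in>SU4. G = kron2 k l ** H \<and> H$1$0 = 0 \<and> H$2$0 = 0 \<and> Im (H$0$0) = 0 \<and> Im (H$1$1) = 0"
proof -
  obtain a b where ab: "unit2 a b"
    "cnj (a * G$0$0 - cnj b * G$1$0) * (b * G$0$0 + cnj a * G$1$0) + cnj (a * G$2$0 - cnj b * G$3$0) * (b * G$2$0 + cnj a * G$3$0) = 0"
    using su2_diagonalize by metis
  define G1 where "G1 = kron2 idB (su2 a b) ** G"
  have "cnj (G1$0$0) * G1$1$0 + cnj (G1$2$0) * G1$3$0 = 0"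
    using ab(2) by (simp add: G1_def mat_mult_4 kron2_def idB_def su2_def)
  then obtain c d where cd: "unit2 c d" "d * G1$0$0 + cnj c * G1$2$0 = 0" "c * G1$1$0 - cnj d * G1$3$0 = 0"
    "Im (c * G1$0$0 - cnj d * G1$2$0) = 0"
    using su2_triangularize by metis
  define G2 where "G2 = kron2 (su2 c d) idB ** G1"
  have G2: "G2$1$0 = 0" "G2$2$0 = 0" "Im (G2$0$0) = 0"
    using cd(2-4) by (simp_all add: G2_def mat_mult_4 kron2_def idB_def su2_def)
  define u where "u = Arg (G2$1$1) / 2"
  have u: "unit2 (cis (-u)) 0" "unit2 (cis u) 0" by (simp_all add: unit2_def)
  define G3 where "G3 = kron2 (su2 (cis (-u)) 0) (su2 (cis u) 0) ** G2"
  have "cis (-u) * cnj (cis u) * G2$1$1 = cis (- Arg (G2$1$1)) * (cmod (G2$1$1) * cis (Arg (G2$1$1)))"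
    by (simp add: cis_cnj cis_mult u_def rcis_def[symmetric] rcis_cmod_Arg)
  also have "\<dots> = complex_of_real (cmod (G2$1$1))"
    using cis_mult[of "- Arg (G2$1$1)" "Arg (G2$1$1)"] by (simp add: algebra_simps)
  finally have r: "Im (cis (-u) * cnj (cis u) * G2$1$1) = 0" by simp
  have uu: "cis (-u) * cis u = 1" by (simp add: cis_mult)
  have G3: "G3$1$0 = 0" "G3$2$0 = 0" "Im (G3$0$0) = 0" "Im (G3$1$1) = 0"
    using G2 r uu by (simp_all add: G3_def mat_mult_4 kron2_def su2_def del: cis_cnj)
  note in2 = su2_SU2[OF ab(1)] su2_SU2[OF cd(1)] su2_SU2[OF u(1)] su2_SU2[OF u(2)] idB_SU2
  have S: "G3 \<in> SU4" unfolding G3_def G2_def G1_def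
    by (intro SU4_mult kron2_SU4 in2 assms)
  have "G = kron2 (adj2 idB) (adj2 (su2 a b)) ** G1" unfolding G1_def by (rule kron2_cancel) (intro in2)+
  also have "G1 = kron2 (adj2 (su2 c d)) (adj2 idB) ** G2" unfolding G2_def by (rule kron2_cancel) (intro in2)+
  also have "G2 = kron2 (adj2 (su2 (cis (-u)) 0)) (adj2 (su2 (cis u) 0)) ** G3" unfolding G3_def by (rule kron2_cancel) (intro in2)+
  finally have "G = kron2 (mul2 (adj2 idB) (mul2 (adj2 (su2 c d)) (adj2 (su2 (cis (-u)) 0))))
      (mul2 (adj2 (su2 a b)) (mul2 (adj2 idB) (adj2 (su2 (cis u) 0)))) ** G3"
    by (simp add: matrix_mul_assoc[symmetric] kron2_mult[symmetric])
  then show ?thesis using S G3 by (metis SU2_adj2 SU2_mul2 in2)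
qed

lemma SU4_match_column:
  assumes "A \<in> SU4" "\<And>i. A$i$j = G$i$j"
  shows "(cadj4 A ** G) $ i $ j = (if i = j then 1 else 0)"
proof -
  have "(cadj4 A ** G) $ i $ j = (cadj4 A ** A) $ i $ j" using assms(2) by (simp add: mat_mult_4)
  then show ?thesis using SU4_cadj4_left[OF assms(1)] by (simp add: Finite_Cartesian_Product.mat_def)
qed

lemma SU4_unit_row:
  assumes "M \<in> SU4" "M$j$j = 1" "i \<noteq> j"
  shows "M$j$i = 0"
proof -
  have n: "(cmod (M$j$0))\<^sup>2 + (cmod (M$j$1))\<^sup>2 + (cmod (M$j$2))\<^sup>2 + (cmod (M$j$3))\<^sup>2 = 1"
    using SU4_row_norm[OF assms(1)] .
  have "(cmod (M$j$i))\<^sup>2 \<le> 0"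
    using n assms(2,3) exhaust4[of i] exhaust4[of j] zero_le_power2[of "cmod (M$j$0)"] zero_le_power2[of "cmod (M$j$1)"]
      zero_le_power2[of "cmod (M$j$2)"] zero_le_power2[of "cmod (M$j$3)"]
    by (elim disjE) (simp_all add: add_nonneg_eq_0_iff)
  then show ?thesis by simp
qed

lemma unit3_polar:
  assumes "Im v1 = 0" "(cmod v1)\<^sup>2 + (cmod v2)\<^sup>2 + (cmod v3)\<^sup>2 = 1"
  shows "\<exists>t u s w. v1 = complex_of_real (cos t) \<and> v2 = complex_of_real (sin t) * cis u * complex_of_real (cos s)
     \<and> v3 = complex_of_real (sin t) * cis u * (complex_of_real (sin s) * cis w)"
proof -
  define \<rho> where "\<rho> = sqrt ((cmod v2)\<^sup>2 + (cmod v3)\<^sup>2)"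
  have rr: "\<rho>\<^sup>2 = (cmod v2)\<^sup>2 + (cmod v3)\<^sup>2" by (simp add: \<rho>_def)
  have "(Re v1)\<^sup>2 + \<rho>\<^sup>2 = 1" using assms rr by (simp add: cmod_def)
  then obtain t where t: "Re v1 = cos t" "\<rho> = sin t" using sincos_total_2pi by metis
  have v1: "v1 = complex_of_real (cos t)" using assms t by (simp add: complex_eq_iff)
  show ?thesis
  proof (cases "(v2, v3) = (0, 0)")
    case True
    then have "sin t = 0" using t rr by simp
    then show ?thesis using True v1 by auto
  next
    case False
    from unit2_normalize[OF this] obtain r where r: "r > 0" "unit2 (v2 / complex_of_real r) (v3 / complex_of_real r)"
      "v2 * cnj v2 + v3 * cnj v3 = complex_of_real (r\<^sup>2)" by blast
    have "complex_of_real (\<rho>\<^sup>2) = complex_of_real (r\<^sup>2)" using r(3) rr by (simp add: complex_norm_square del: of_real_power)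
    then have "\<rho>\<^sup>2 = r\<^sup>2" by (simp only: of_real_eq_iff)
    then have "\<rho> = r" using r(1) by (simp add: \<rho>_def power2_eq_iff)
    obtain s u v where "v2 / complex_of_real r = complex_of_real (cos s) * cis u" "v3 / complex_of_real r = complex_of_real (sin s) * cis v"
      using unit2_polar[OF r(2)] by blast
    then have e: "v2 = complex_of_real r * (complex_of_real (cos s) * cis u)" "v3 = complex_of_real r * (complex_of_real (sin s) * cis v)"
      using r(1) by (auto simp: field_simps)
    have c: "cis v = cis u * cis (v - u)" by (simp add: cis_mult)
    have e': "v2 = complex_of_real (sin t) * cis u * complex_of_real (cos s)"
       "v3 = complex_of_real (sin t) * cis u * (complex_of_real (sin s) * cis (v - u))"
      unfolding e using t(2) \<open>\<rho> = r\<close> c by (simp_all add: algebra_simps)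
    show ?thesis using v1 e' by blast
  qed
qed

theorem SU4_decomposition:
  assumes "G \<in> SU4"
  obtains k l t where "k \<in> SU2" "l \<in> SU2" "G = kron2 k l ** coset_angles t"
proof -
  obtain k l H where kl: "k \<in> SU2" "l \<in> SU2" and H: "H \<in> SU4" "G = kron2 k l ** H"
    and z: "H$1$0 = 0" "H$2$0 = 0" "Im (H$0$0) = 0" "Im (H$1$1) = 0"
    using SU4_local_normal_form[OF assms] by metis
  have "unit2 (H$0$0) (H$3$0)" using SU4_col_norm[OF H(1), of 0] z by (simp add: unit2_def)
  from unit2_polar_real[OF this z(3)] obtain t0 t1 where
    t01: "H$0$0 = complex_of_real (cos t0)" "H$3$0 = complex_of_real (sin t0) * cis t1" by blast
  define B where "B = tl4 0 3 (complex_of_real (cos t0)) (complex_of_real (sin t0) * cis t1)"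
  have B: "B \<in> SU4" unfolding B_def by (intro tl4_SU4 unit2_angles_real)
  define J where "J = cadj4 B ** H"
  have J: "J \<in> SU4" unfolding J_def by (intro SU4_mult SU4_cadj4 B H)
  have "\<forall>i. B$i$0 = H$i$0" unfolding all4 using z t01 by (simp add: B_def tl4_def)
  then have J0: "J$i$0 = (if i = 0 then 1 else 0)" for i unfolding J_def using SU4_match_column[OF B] by blast
  have J1: "J$1$1 = H$1$1" by (simp add: J_def mat_mult_4 B_def tl4_def cadj4_def)
  have J01: "J$0$1 = 0" using SU4_unit_row[OF J, of 0 1] J0 by simp
  have "(cmod (J$1$1))\<^sup>2 + (cmod (J$2$1))\<^sup>2 + (cmod (J$3$1))\<^sup>2 = 1"
    using SU4_col_norm[OF J, of 1] J01 by simp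
  moreover have "Im (J$1$1) = 0" using J1 z by simp
  ultimately obtain t2 t3 t4 t5 where tt: "J$1$1 = complex_of_real (cos t2)"
    "J$2$1 = complex_of_real (sin t2) * cis t3 * complex_of_real (cos t4)"
    "J$3$1 = complex_of_real (sin t2) * cis t3 * (complex_of_real (sin t4) * cis t5)"
    using unit3_polar by meson
  define C where "C = tl4 2 3 (complex_of_real (cos t4)) (complex_of_real (sin t4) * cis t5) **
    tl4 1 2 (complex_of_real (cos t2)) (complex_of_real (sin t2) * cis t3)"
  have C: "C \<in> SU4" unfolding C_def by (intro SU4_mult tl4_SU4 unit2_angles_real)
  define W where "W = cadj4 C ** J"
  have W: "W \<in> SU4" unfolding W_def by (intro SU4_mult SU4_cadj4 C J)
  have "\<forall>i. C$i$0 = J$i$0" unfolding all4 J0 by (simp add: C_def mat_mult_4 tl4_def)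
  then have W0: "W$i$0 = (if i = 0 then 1 else 0)" for i unfolding W_def using SU4_match_column[OF C] by blast
  have "\<forall>i. C$i$1 = J$i$1" unfolding all4 J01 tt by (simp add: C_def mat_mult_4 tl4_def)
  then have W1: "W$i$1 = (if i = 1 then 1 else 0)" for i unfolding W_def using SU4_match_column[OF C] by blast
  have R0: "W$0$i = 0" if "i \<noteq> 0" for i using SU4_unit_row[OF W, of 0 i] W0 that by simp
  have R1: "W$1$i = 0" if "i \<noteq> 1" for i using SU4_unit_row[OF W, of 1 i] W1 that by simp
  define a b c d where "a = W$2$2" and "b = W$3$2" and "c = W$2$3" and "d = W$3$3"
  note [simp] = a_def[symmetric] b_def[symmetric] c_def[symmetric] d_def[symmetric]
  have dt: "a * d - c * b = 1" using SU4_det[OF W] unfolding det_4 by (simp add: W0 W1 R0 R1)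
  have "(cadj4 W ** W) $ 2 $ 2 = 1" "(cadj4 W ** W) $ 2 $ 3 = 0"
    using SU4_cadj4_left[OF W] by (simp_all add: Finite_Cartesian_Product.mat_def)
  then have u: "cnj a * a + cnj b * b = 1" "cnj a * c + cnj b * d = 0"
    by (simp_all add: mat_mult_4 cadj4_def R0 R1)
  have "cnj a * (a * d - c * b) = (cnj a * a + cnj b * b) * d - b * (cnj a * c + cnj b * d)"
    "- cnj b * (a * d - c * b) = (cnj a * a + cnj b * b) * c - a * (cnj a * c + cnj b * d)"
    by (simp_all add: algebra_simps)
  then have "d = cnj a" "c = - cnj b" unfolding dt u by simp_all
  then have Wt: "W = tl4 2 3 a b"
    unfolding Finite_Cartesian_Product.vec_eq_iff all4 by (simp add: tl4_def W0 W1 R0 R1)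
  have "unit2 a b" using u(1) unfolding unit2_iff by (simp add: mult.commute)
  from unit2_polar[OF this] obtain t6 t7 t8 where
    ab: "a = complex_of_real (cos t6) * cis t7" "b = complex_of_real (sin t6) * cis t8" by blast
  have "H = B ** (C ** W)" unfolding W_def J_def by (simp add: SU4_cancel(1)[OF B] SU4_cancel(1)[OF C])
  also have "\<dots> = coset_angles ((\<lambda>_. 0)(0 := t0, 1 := t1, 2 := t2, 3 := t3, 4 := t4, 5 := t5, 6 := t6, 7 := t7, 8 := t8))"
    unfolding B_def C_def Wt ab coset_angles_def by (simp add: matrix_mul_assoc)
  finally show ?thesis using that kl H(2) by blast
qed

section \<open>Existence of Haar measure on SU(4)\<close>

definition cip :: "complex^4 \<Rightarrow> complex^4 \<Rightarrow> complex" where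
  "cip u v = (\<Sum>i\<in>UNIV. cnj (u$i) * v$i)"

lemma cip_4: "cip u v = cnj (u$0) * v$0 + cnj (u$1) * v$1 + cnj (u$2) * v$2 + cnj (u$3) * v$3"
  by (simp add: cip_def sum4)

lemma cip_linear_right: "cip u (v - w) = cip u v - cip u w" "cip u (c *s v) = c * cip u v"
  by (simp_all add: cip_4 algebra_simps)

lemma cip_scale_left: "cip (c *s u) v = cnj c * cip u v"
  by (simp add: cip_4 algebra_simps)

lemma cip_commute: "cip v u = cnj (cip u v)"
  by (simp add: cip_4 algebra_simps)

lemma cip_self: "cip u u = complex_of_real (Re (cip u u))" "Re (cip u u) \<ge> 0" "cip u u = 0 \<Longrightarrow> u = 0"
proof -
  have *: "cip u u = complex_of_real ((cmod (u$0))\<^sup>2 + (cmod (u$1))\<^sup>2 + (cmod (u$2))\<^sup>2 + (cmod (u$3))\<^sup>2)"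
    by (simp add: cip_4 complex_norm_square mult.commute del: of_real_power)
  show "cip u u = complex_of_real (Re (cip u u))" "Re (cip u u) \<ge> 0" unfolding * by simp_all
  assume "cip u u = 0"
  then have "(cmod (u$0))\<^sup>2 + (cmod (u$1))\<^sup>2 + (cmod (u$2))\<^sup>2 + (cmod (u$3))\<^sup>2 = 0" unfolding * by (simp only: of_real_eq_0_iff)
  then have "\<forall>i. u$i = 0" unfolding all4 by (simp add: add_nonneg_eq_0_iff)
  then show "u = 0" by (simp add: Finite_Cartesian_Product.vec_eq_iff)
qed

lemma matrix_vector_4: "(g *v u) $ i = g$i$0 * u$0 + g$i$1 * u$1 + g$i$2 * u$2 + g$i$3 * u$3"
  for g :: "complex^4^4"
  by (simp add: matrix_vector_mult_def sum4)

lemma cip_SU4: assumes "g \<in> SU4" shows "cip (g *v u) (g *v v) = cip u v"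
proof -
  have "cip (g *v u) (g *v v) = cip u ((cadj4 g ** g) *v v)"
    by (simp add: cip_4 matrix_vector_4 mat_mult_4 cadj4_def algebra_simps)
  then show ?thesis by (simp add: SU4_cadj4_left[OF assms])
qed

definition cproj :: "complex^4 \<Rightarrow> complex^4 \<Rightarrow> complex^4" where
  "cproj u v = (cip u v / cip u u) *s u"

definition gram_schmidt0 where "gram_schmidt0 M = column 0 (M :: complex^4^4)"
definition gram_schmidt1 where "gram_schmidt1 M = column 1 M - cproj (gram_schmidt0 M) (column 1 M)"
definition gram_schmidt2 where "gram_schmidt2 M = column 2 M - cproj (gram_schmidt0 M) (column 2 M) - cproj (gram_schmidt1 M) (column 2 M)"
definition gram_schmidt3 where "gram_schmidt3 M = column 3 M - cproj (gram_schmidt0 M) (column 3 M) - cproj (gram_schmidt1 M) (column 3 M)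
   - cproj (gram_schmidt2 M) (column 3 M)"

lemmas gs_defs = gram_schmidt0_def gram_schmidt1_def gram_schmidt2_def gram_schmidt3_def

definition cols4 :: "complex^4 \<Rightarrow> complex^4 \<Rightarrow> complex^4 \<Rightarrow> complex^4 \<Rightarrow> complex^4^4" where
  "cols4 a b c d = (\<chi> i j. if j = 0 then a$i else if j = 1 then b$i else if j = 2 then c$i else d$i)"

definition cnormalize :: "complex^4 \<Rightarrow> complex^4" where
  "cnormalize u = complex_of_real (1 / sqrt (Re (cip u u))) *s u"

definition gs_unitary :: "complex^4^4 \<Rightarrow> complex^4^4" where
  "gs_unitary M = cols4 (cnormalize (gram_schmidt0 M)) (cnormalize (gram_schmidt1 M)) (cnormalize (gram_schmidt2 M)) (cnormalize (gram_schmidt3 M))"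

definition gs_SU4 :: "complex^4^4 \<Rightarrow> complex^4^4" where
  "gs_SU4 M = gs_unitary M ** cols4 (axis 0 1) (axis 1 1) (axis 2 1) (axis 3 (1 / Determinants.det (gs_unitary M)))"

lemma column_mult: "column j (g ** M) = g *v column j M" for g M :: "complex^4^4"
  by (simp add: Finite_Cartesian_Product.vec_eq_iff column_def mat_mult_4 matrix_vector_4)

lemma cproj_SU4: "g \<in> SU4 \<Longrightarrow> cproj (g *v u) (g *v v) = g *v cproj u v"
  by (simp add: cproj_def cip_SU4 vector_scalar_commute)

lemma gram_schmidt_equivariant:
  assumes "g \<in> SU4"
  shows "gram_schmidt0 (g ** M) = g *v gram_schmidt0 M" "gram_schmidt1 (g ** M) = g *v gram_schmidt1 M"
    "gram_schmidt2 (g ** M) = g *v gram_schmidt2 M" "gram_schmidt3 (g ** M) = g *v gram_schmidt3 M"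
proof -
  show 0: "gram_schmidt0 (g ** M) = g *v gram_schmidt0 M" by (simp add: gs_defs column_mult)
  show 1: "gram_schmidt1 (g ** M) = g *v gram_schmidt1 M"
    unfolding gram_schmidt1_def 0 column_mult cproj_SU4[OF assms] by (simp add: matrix_vector_mult_diff_distrib)
  show 2: "gram_schmidt2 (g ** M) = g *v gram_schmidt2 M"
    unfolding gram_schmidt2_def 0 1 column_mult cproj_SU4[OF assms] by (simp add: matrix_vector_mult_diff_distrib)
  show "gram_schmidt3 (g ** M) = g *v gram_schmidt3 M"
    unfolding gram_schmidt3_def 0 1 2 column_mult cproj_SU4[OF assms] by (simp add: matrix_vector_mult_diff_distrib)
qed

lemma cols4_mult: "cols4 (g *v a) (g *v b) (g *v c) (g *v d) = g ** cols4 a b c d"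
  by (simp add: Finite_Cartesian_Product.vec_eq_iff cols4_def mat_mult_4 matrix_vector_4)

lemma gs_SU4_equivariant: assumes "g \<in> SU4" shows "gs_SU4 (g ** M) = g ** gs_SU4 M"
proof -
  have "cnormalize (g *v u) = g *v cnormalize u" for u
    by (simp add: cnormalize_def cip_SU4[OF assms] vector_scalar_commute)
  then have *: "gs_unitary (g ** M) = g ** gs_unitary M"
    by (simp add: gs_unitary_def gram_schmidt_equivariant[OF assms] cols4_mult)
  show ?thesis unfolding gs_SU4_def * by (simp add: det_mul SU4_det[OF assms] matrix_mul_assoc)
qed

lemma cip_cproj: "cip u (cproj u v) = cip u v" "cip w u = 0 \<Longrightarrow> cip w (cproj u v) = 0"
  unfolding cproj_def cip_linear_right using cip_self(3)[of u] by (auto simp: cip_4)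

lemma gs_SU4_in: assumes "Determinants.det M \<noteq> 0" shows "gs_SU4 M \<in> SU4"
proof -
  let ?u0 = "gram_schmidt0 M" and ?u1 = "gram_schmidt1 M" and ?u2 = "gram_schmidt2 M" and ?u3 = "gram_schmidt3 M"
  have o01: "cip ?u0 ?u1 = 0" by (simp add: gram_schmidt1_def cip_linear_right cip_cproj)
  have o02: "cip ?u0 ?u2 = 0" by (simp add: gram_schmidt2_def cip_linear_right cip_cproj o01)
  have o12: "cip ?u1 ?u2 = 0" using o01 cip_commute[of ?u1 ?u0]
    by (simp add: gram_schmidt2_def cip_linear_right cip_cproj)
  have o03: "cip ?u0 ?u3 = 0" by (simp add: gram_schmidt3_def cip_linear_right cip_cproj o01 o02)
  have o13: "cip ?u1 ?u3 = 0" using o01 cip_commute[of ?u1 ?u0]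
    by (simp add: gram_schmidt3_def cip_linear_right cip_cproj o12)
  have o23: "cip ?u2 ?u3 = 0" using o02 o12 cip_commute[of ?u2 ?u0] cip_commute[of ?u2 ?u1]
    by (simp add: gram_schmidt3_def cip_linear_right cip_cproj)
  define r where "r u v = cip u v / cip u u" for u v
  define U where "U = cols4 ?u0 ?u1 ?u2 ?u3"
  define R where "R = cols4 (axis 0 1) (r ?u0 (column 1 M) *s axis 0 1 + axis 1 1)
    (r ?u0 (column 2 M) *s axis 0 1 + r ?u1 (column 2 M) *s axis 1 1 + axis 2 1)
    (r ?u0 (column 3 M) *s axis 0 1 + r ?u1 (column 3 M) *s axis 1 1 + r ?u2 (column 3 M) *s axis 2 1 + axis 3 1)"
  have c: "?u0 = column 0 M" "r ?u0 (column 1 M) *s ?u0 + ?u1 = column 1 M"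
    "r ?u0 (column 2 M) *s ?u0 + r ?u1 (column 2 M) *s ?u1 + ?u2 = column 2 M"
    "r ?u0 (column 3 M) *s ?u0 + r ?u1 (column 3 M) *s ?u1 + r ?u2 (column 3 M) *s ?u2 + ?u3 = column 3 M"
    by (simp_all add: gram_schmidt0_def gram_schmidt1_def gram_schmidt2_def gram_schmidt3_def cproj_def r_def)
  have M: "M = cols4 (column 0 M) (column 1 M) (column 2 M) (column 3 M)"
    unfolding Finite_Cartesian_Product.vec_eq_iff all4 by (simp add: cols4_def column_def)
  have cm: "U ** cols4 a b c d = cols4 (U *v a) (U *v b) (U *v c) (U *v d)" for a b c d
    by (simp add: cols4_mult)
  have Ua: "U *v axis 0 1 = ?u0" "U *v axis 1 1 = ?u1" "U *v axis 2 1 = ?u2" "U *v axis 3 1 = ?u3"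
    unfolding Finite_Cartesian_Product.vec_eq_iff matrix_vector_4 by (simp_all add: U_def cols4_def axis_def)
  have "U ** R = cols4 (column 0 M) (column 1 M) (column 2 M) (column 3 M)"
    unfolding R_def cm matrix_vector_right_distrib vector_scalar_commute Ua c(2-4) by (simp add: c(1))
  then have "M = U ** R" using M by simp
  moreover have "Determinants.det R = 1" unfolding R_def det_4 by (simp add: cols4_def axis_def)
  ultimately have dU: "Determinants.det U \<noteq> 0" using assms by (simp add: det_mul)
  have nz: "cip ?u0 ?u0 \<noteq> 0" "cip ?u1 ?u1 \<noteq> 0" "cip ?u2 ?u2 \<noteq> 0" "cip ?u3 ?u3 \<noteq> 0"
    using dU cip_self(3) unfolding U_def det_4 by (auto simp: cols4_def dest!: cip_self(3))
  have unit: "cip (cnormalize u) (cnormalize u) = 1" if "cip u u \<noteq> 0" for u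
  proof -
    have p: "Re (cip u u) > 0" using that cip_self(1,2)[of u] by (metis less_eq_real_def of_real_0)
    let ?k = "1 / sqrt (Re (cip u u))"
    have "cip (cnormalize u) (cnormalize u) = complex_of_real ?k * (complex_of_real ?k * cip u u)"
      unfolding cnormalize_def cip_linear_right cip_scale_left by simp
    also have "\<dots> = complex_of_real (?k * (?k * Re (cip u u)))"
      by (subst cip_self(1)) (simp only: of_real_mult)
    also have "?k * (?k * Re (cip u u)) = 1" using p by (simp add: field_simps)
    finally show ?thesis by simp
  qed
  have orth: "cip (cnormalize u) (cnormalize v) = 0" if "cip u v = 0" for u v
    using that by (simp add: cnormalize_def cip_linear_right cip_scale_left)
  let ?Q = "gs_unitary M"
  have cQ: "(cadj4 (cols4 a b c d) ** cols4 a b c d) $ i $ j = cip (column i (cols4 a b c d)) (column j (cols4 a b c d))" for a b c d i j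
    by (simp add: mat_mult_4 cadj4_def cip_4 column_def)
  have colsc: "column 0 (cols4 a b c d) = a" "column 1 (cols4 a b c d) = b" "column 2 (cols4 a b c d) = c" "column 3 (cols4 a b c d) = d" for a b c d
    by (simp_all add: Finite_Cartesian_Product.vec_eq_iff column_def cols4_def)
  have swap: "cip v u = 0" if "cip u v = 0" for u v using that cip_commute[of v u] by simp
  have uQ: "cadj4 ?Q ** ?Q = Finite_Cartesian_Product.mat 1"
    unfolding Finite_Cartesian_Product.vec_eq_iff all4 gs_unitary_def cQ colsc
    by (simp add: unit nz orth o01 o02 o03 o12 o13 o23 swap[OF o01] swap[OF o02] swap[OF o03] swap[OF o12] swap[OF o13] swap[OF o23] Finite_Cartesian_Product.mat_def)
  define \<delta> where "\<delta> = Determinants.det ?Q"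
  have "Determinants.det (cadj4 ?Q ** ?Q) = 1" unfolding uQ by simp
  then have dd: "cnj \<delta> * \<delta> = 1" by (simp add: det_mul det_cadj4 \<delta>_def)
  then have d0: "\<delta> \<noteq> 0" by auto
  define D where "D = cols4 (axis 0 1) (axis 1 1) (axis 2 1) (axis 3 (1 / \<delta>))"
  have dD: "Determinants.det D = 1 / \<delta>" unfolding D_def det_4 by (simp add: cols4_def axis_def)
  have uD: "cadj4 D ** D = Finite_Cartesian_Product.mat 1"
    unfolding D_def Finite_Cartesian_Product.vec_eq_iff all4 cQ colsc using dd d0
    by (simp add: Finite_Cartesian_Product.mat_def cip_4 axis_def field_simps)
  have "gs_SU4 M = ?Q ** D" by (simp add: gs_SU4_def D_def \<delta>_def)
  moreover have "cadj4 (?Q ** D) ** (?Q ** D) = Finite_Cartesian_Product.mat 1"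
    unfolding cadj4_mult using uQ uD by (metis matrix_mul_assoc matrix_mul_lid)
  moreover have "Determinants.det (?Q ** D) = 1" using d0 by (simp add: det_mul dD \<delta>_def[symmetric])
  ultimately show ?thesis by (simp add: SU4_def)
qed

lemma measurable_entries4:
  fixes f :: "'a \<Rightarrow> complex^4^4"
  assumes "\<And>i j. (\<lambda>x. f x $ i $ j) \<in> borel_measurable M"
  shows "f \<in> borel_measurable M"
proof -
  have lin: "linear (\<lambda>z::complex. axis i (axis j z) :: complex^4^4)" for i j
    by (rule linearI) (auto simp: Finite_Cartesian_Product.vec_eq_iff axis_def)
  have m: "(\<lambda>z::complex. axis i (axis j z) :: complex^4^4) \<in> borel_measurable borel" for i j
    by (intro borel_measurable_continuous_onI linear_continuous_on linear_conv_bounded_linear[THEN iffD1] lin)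
  have "f = (\<lambda>x. \<Sum>i\<in>UNIV. \<Sum>j\<in>UNIV. axis i (axis j (f x $ i $ j)))"
    unfolding fun_eq_iff Finite_Cartesian_Product.vec_eq_iff all4 sum4 by (simp add: axis_def)
  moreover have "(\<lambda>x. \<Sum>i\<in>UNIV. \<Sum>j\<in>UNIV. axis i (axis j (f x $ i $ j)) :: complex^4^4) \<in> borel_measurable M"
    by (intro borel_measurable_sum measurable_compose[OF assms m])
  ultimately show ?thesis by simp
qed

lemma entry_measurable [measurable]: "(\<lambda>M::complex^4^4. M $ i $ j) \<in> borel_measurable borel"
  by (intro borel_measurable_continuous_onI continuous_intros)

lemma cnj_measurable [measurable (raw)]: "f \<in> borel_measurable M \<Longrightarrow> (\<lambda>x. cnj (f x)) \<in> borel_measurable M"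
  by (rule measurable_compose[of f M borel cnj]) (auto intro!: borel_measurable_continuous_onI continuous_intros)

lemma gs_SU4_measurable: "gs_SU4 \<in> borel_measurable borel"
proof -
  define vm where "vm f \<longleftrightarrow> (\<forall>i. (\<lambda>M. f M $ i) \<in> borel_measurable borel)" for f :: "complex^4^4 \<Rightarrow> complex^4"
  have col: "vm (column j)" for j unfolding vm_def column_def by simp
  have cip: "(\<lambda>M. cip (u M) (v M)) \<in> borel_measurable borel" if "vm u" "vm v" for u v
    using that unfolding vm_def cip_4 by (intro borel_measurable_add borel_measurable_times cnj_measurable) auto
  have sc: "vm (\<lambda>M. c M *s u M)" if "c \<in> borel_measurable borel" "vm u" for c u
    using that unfolding vm_def by (auto intro!: borel_measurable_times)
  have pr: "vm (\<lambda>M. cproj (u M) (v M))" if "vm u" "vm v" for u v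
    unfolding cproj_def by (intro sc borel_measurable_divide cip that)
  have di: "vm (\<lambda>M. u M - v M)" if "vm u" "vm v" for u v
    using that unfolding vm_def by (auto intro!: borel_measurable_diff)
  have 0: "vm gram_schmidt0" unfolding gram_schmidt0_def by (rule col)
  have 1: "vm gram_schmidt1" unfolding gram_schmidt1_def by (intro di pr 0 col)
  have 2: "vm gram_schmidt2" unfolding gram_schmidt2_def by (intro di pr 0 1 col)
  have 3: "vm gram_schmidt3" unfolding gram_schmidt3_def by (intro di pr 0 1 2 col)
  have no: "vm (\<lambda>M. cnormalize (u M))" if "vm u" for u
  proof -
    have [measurable]: "(\<lambda>M. cip (u M) (u M)) \<in> borel_measurable borel" by (intro cip that)
    show ?thesis unfolding cnormalize_def by (intro sc that) measurable
  qed
  have Q: "(\<lambda>M. gs_unitary M $ i $ j) \<in> borel_measurable borel" for i j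
    using no[OF 0] no[OF 1] no[OF 2] no[OF 3] exhaust4[of j] unfolding vm_def gs_unitary_def cols4_def by auto
  have d: "(\<lambda>M. Determinants.det (gs_unitary M)) \<in> borel_measurable borel" unfolding det_4
    by (intro borel_measurable_add borel_measurable_diff borel_measurable_times Q)
  have D: "(\<lambda>M. cols4 (axis 0 1) (axis 1 1) (axis 2 1) (axis 3 (1 / Determinants.det (gs_unitary M))) $ i $ j) \<in> borel_measurable borel" for i j
    using d exhaust4[of j] exhaust4[of i] unfolding cols4_def axis_def by auto
  show ?thesis
    by (intro measurable_entries4) (unfold gs_SU4_def mat_mult_4, intro borel_measurable_add borel_measurable_times Q D)
qed

definition flat_idx :: "4 \<times> 4 \<times> bool \<Rightarrow> 32" where "flat_idx = (SOME b. bij b)"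

lemma bij_flat_idx: "bij flat_idx"
proof -
  have "card (UNIV :: (4 \<times> 4 \<times> bool) set) = card (UNIV :: 32 set)" by simp
  then have "\<exists>b :: 4 \<times> 4 \<times> bool \<Rightarrow> 32. bij b" by (intro finite_same_card_bij) auto
  then show ?thesis unfolding flat_idx_def by (rule someI_ex)
qed

definition unflatten :: "real^32 \<Rightarrow> complex^4^4" where
  "unflatten v = (\<chi> i j. Complex (v $ flat_idx (i, j, False)) (v $ flat_idx (i, j, True)))"

definition flatten :: "complex^4^4 \<Rightarrow> real^32" where
  "flatten M = (\<chi> k. case inv_into UNIV flat_idx k of (i, j, c) \<Rightarrow> if c then Im (M $ i $ j) else Re (M $ i $ j))"

lemma unflatten_flatten: "unflatten (flatten M) = M"
  using bij_flat_idx by (simp add: Finite_Cartesian_Product.vec_eq_iff unflatten_def flatten_def bij_is_inj complex_eq_iff)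

lemma flatten_unflatten: "flatten (unflatten v) = v"
proof -
  have "flatten (unflatten v) $ flat_idx p = v $ flat_idx p" for p
    using bij_flat_idx by (cases p) (auto simp: unflatten_def flatten_def bij_is_inj)
  then show ?thesis unfolding Finite_Cartesian_Product.vec_eq_iff
    by (metis bij_flat_idx bij_is_surj surj_f_inv_f)
qed

lemma linear_unflatten: "linear unflatten"
  by (rule linearI) (simp_all add: unflatten_def Finite_Cartesian_Product.vec_eq_iff complex_eq_iff)

lemma linear_flatten: "linear flatten"
  by (rule linearI) (auto simp: flatten_def Finite_Cartesian_Product.vec_eq_iff split: prod.splits)

lemma norm_flatten: "(norm (flatten M))\<^sup>2 = (\<Sum>j\<in>UNIV. Re (cip (column j M) (column j M)))"
proof -
  have "(norm (flatten M))\<^sup>2 = (\<Sum>k\<in>UNIV. (flatten M $ k)\<^sup>2)"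
    unfolding norm_vec_def L2_set_def by (simp add: sum_nonneg)
  also have "\<dots> = (\<Sum>p\<in>UNIV. (flatten M $ flat_idx p)\<^sup>2)"
    by (rule sum.reindex_bij_betw[symmetric]) (use bij_flat_idx in simp)
  also have "\<dots> = (\<Sum>(i, j, c)\<in>UNIV \<times> UNIV \<times> UNIV. (if c then Im (M $ i $ j) else Re (M $ i $ j))\<^sup>2)"
    using bij_flat_idx by (intro sum.cong) (auto simp: flatten_def bij_is_inj)
  also have "\<dots> = (\<Sum>i\<in>UNIV. \<Sum>j\<in>UNIV. (Re (M$i$j))\<^sup>2 + (Im (M$i$j))\<^sup>2)"
    by (simp add: sum.cartesian_product[symmetric] UNIV_bool add.commute)
  also have "\<dots> = (\<Sum>j\<in>UNIV. \<Sum>i\<in>UNIV. (Re (M$i$j))\<^sup>2 + (Im (M$i$j))\<^sup>2)"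
    by (rule sum.swap)
  also have "\<dots> = (\<Sum>j\<in>UNIV. Re (cip (column j M) (column j M)))"
    by (simp add: cip_4 column_def sum4 power2_eq_square)
  finally show ?thesis .
qed

definition rot32 :: "complex^4^4 \<Rightarrow> real^32 \<Rightarrow> real^32" where
  "rot32 g v = flatten (g ** unflatten v)"

lemma unflatten_rot32: "unflatten (rot32 g v) = g ** unflatten v"
  by (simp add: rot32_def unflatten_flatten)

lemma orthogonal_rot32: assumes "g \<in> SU4" shows "orthogonal_transformation (rot32 g)"
proof -
  have "linear (\<lambda>M::complex^4^4. g ** M)"
    by (rule linearI) (simp_all add: Finite_Cartesian_Product.vec_eq_iff mat_mult_4 distrib_left scaleR_add_right add_ac)
  then have "linear (flatten \<circ> ((\<lambda>M. g ** M) \<circ> unflatten))"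
    by (intro linear_compose linear_flatten linear_unflatten)
  moreover have "rot32 g = flatten \<circ> ((\<lambda>M. g ** M) \<circ> unflatten)" by (auto simp: fun_eq_iff rot32_def)
  ultimately have "linear (rot32 g)" by simp
  moreover have "norm (rot32 g v) = norm v" for v
  proof -
    have "(norm (rot32 g v))\<^sup>2 = (norm (flatten (unflatten v)))\<^sup>2"
      unfolding rot32_def norm_flatten column_mult cip_SU4[OF assms] ..
    then show ?thesis by (simp add: flatten_unflatten)
  qed
  ultimately show ?thesis by (simp add: orthogonal_transformation)
qed

definition ball_GL :: "(real^32) set" where
  "ball_GL = {v. norm v < 1 \<and> Determinants.det (unflatten v) \<noteq> 0}"

lemma continuous_unflatten: "continuous_on A unflatten"
  by (intro linear_continuous_on linear_conv_bounded_linear[THEN iffD1] linear_unflatten)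

lemma open_ball_GL: "open ball_GL"
proof -
  have c: "continuous_on UNIV (\<lambda>v. Determinants.det (unflatten v))"
    unfolding det_4 by (intro continuous_intros continuous_unflatten)
  have "open (ball 0 1 \<inter> (\<lambda>v. Determinants.det (unflatten v)) -` (- {0}))"
    by (intro open_Int open_ball open_vimage[OF _ c]) auto
  also have "ball 0 1 \<inter> (\<lambda>v. Determinants.det (unflatten v)) -` (- {0}) = ball_GL"
    by (auto simp: ball_GL_def)
  finally show ?thesis .
qed

lemma ball_GL_nonempty: "ball_GL \<noteq> {}"
proof -
  let ?v = "flatten (Finite_Cartesian_Product.mat (1/4))"
  have "(norm ?v)\<^sup>2 = 1/4" unfolding norm_flatten sum4 by (simp add: cip_4 column_def Finite_Cartesian_Product.mat_def)
  then have "(norm ?v)\<^sup>2 < 1\<^sup>2" by simp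
  then have "norm ?v < 1" by (rule power2_less_imp_less) simp
  moreover have "Determinants.det (unflatten ?v) \<noteq> 0"
    unfolding unflatten_flatten det_4 by (simp add: Finite_Cartesian_Product.mat_def)
  ultimately show ?thesis by (auto simp: ball_GL_def)
qed

lemma emeasure_ball_GL: "emeasure lborel ball_GL \<noteq> 0" "emeasure lborel ball_GL \<noteq> \<infinity>"
proof -
  have m: "ball_GL \<in> sets borel" using open_ball_GL by simp
  show "emeasure lborel ball_GL \<noteq> 0"
  proof
    assume "emeasure lborel ball_GL = 0"
    then have "ball_GL \<in> null_sets lborel" using m by (simp add: null_sets_def)
    then have "negligible ball_GL" using null_sets_completionI negligible_iff_null_sets by blast
    then show False using open_not_negligible[OF open_ball_GL ball_GL_nonempty] by simp
  qed
  have "bounded ball_GL" by (rule bounded_subset[of "ball 0 1"]) (auto simp: ball_GL_def)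
  then show "emeasure lborel ball_GL \<noteq> \<infinity>" using emeasure_bounded_finite by (simp add: less_top)
qed

lemma distr_rot32:
  assumes "g \<in> SU4"
  shows "distr (uniform_measure lborel ball_GL) borel (rot32 g) = uniform_measure lborel ball_GL" (is "distr ?P _ _ = _")
proof (rule measure_eqI)
  show "sets (distr ?P borel (rot32 g)) = sets ?P" by simp
  fix A assume "A \<in> sets (distr ?P borel (rot32 g))"
  then have A: "A \<in> sets borel" by simp
  have m: "ball_GL \<in> sets borel" using open_ball_GL by simp
  have o: "orthogonal_transformation (rot32 g)" and o': "orthogonal_transformation (rot32 (cadj4 g))"
    using assms by (auto intro: orthogonal_rot32 SU4_cadj4)
  have meas: "rot32 g \<in> borel_measurable borel"
    using o by (intro borel_measurable_continuous_onI linear_continuous_on linear_conv_bounded_linear[THEN iffD1] orthogonal_transformation_linear)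
  have inv: "rot32 (cadj4 g) (rot32 g v) = v" "rot32 g (rot32 (cadj4 g) v) = v" for v
    by (simp_all add: rot32_def unflatten_flatten SU4_cancel[OF assms] flatten_unflatten)
  have bm: "rot32 g v \<in> ball_GL \<longleftrightarrow> v \<in> ball_GL" for v
    by (simp add: ball_GL_def unflatten_rot32 det_mul SU4_det[OF assms] orthogonal_transformation_norm[OF o])
  let ?B = "ball_GL \<inter> A"
  have eq: "ball_GL \<inter> rot32 g -` A = rot32 (cadj4 g) ` ?B"
  proof (intro equalityI subsetI)
    fix v assume "v \<in> ball_GL \<inter> rot32 g -` A"
    then show "v \<in> rot32 (cadj4 g) ` ?B" using inv(1)[of v] bm[of v] by (intro image_eqI[of _ _ "rot32 g v"]) auto
  next
    fix w assume "w \<in> rot32 (cadj4 g) ` ?B"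
    then obtain v where "w = rot32 (cadj4 g) v" "v \<in> ball_GL" "v \<in> A" by auto
    then show "w \<in> ball_GL \<inter> rot32 g -` A"
      using bm[of "rot32 (cadj4 g) v"] inv(2)[of v] by auto
  qed
  have Bb: "?B \<in> sets borel" using A m by auto
  have bd: "bounded ?B" by (rule bounded_subset[of "ball 0 1"]) (auto simp: ball_GL_def)
  have Bl: "?B \<in> lmeasurable" using Bb bd by (intro bounded_set_imp_lmeasurable) auto
  have Cb: "ball_GL \<inter> rot32 g -` A \<in> sets borel" using measurable_sets[OF meas A] m by auto
  have Cl: "ball_GL \<inter> rot32 g -` A \<in> lmeasurable" unfolding eq by (rule measurable_orthogonal_image[OF o' Bl])
  have "measure lebesgue (ball_GL \<inter> rot32 g -` A) = measure lebesgue ?B"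
    unfolding eq by (rule measure_orthogonal_image[OF o' Bl])
  then have "emeasure lebesgue (ball_GL \<inter> rot32 g -` A) = emeasure lebesgue ?B"
    using Bl Cl by (simp add: emeasure_eq_measure2)
  then have em: "emeasure lborel (ball_GL \<inter> rot32 g -` A) = emeasure lborel ?B"
    using Bb Cb by simp
  have vA: "rot32 g -` A \<in> sets lborel" using measurable_sets[OF meas A] by simp
  have "emeasure (distr ?P borel (rot32 g)) A = emeasure ?P (rot32 g -` A)"
    using A meas by (subst emeasure_distr) (auto simp: uniform_measure_def)
  also have "\<dots> = emeasure lborel (ball_GL \<inter> rot32 g -` A) / emeasure lborel ball_GL"
    using m vA by (intro emeasure_uniform_measure) auto
  also have "\<dots> = emeasure ?P A" unfolding em using m A by (subst emeasure_uniform_measure) auto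
  finally show "emeasure (distr ?P borel (rot32 g)) A = emeasure ?P A" .
qed

lemma SU4_borel: "SU4 \<in> sets borel"
proof -
  have "closed {G::complex^4^4. \<forall>i j. (cadj4 G ** G) $ i $ j = (Finite_Cartesian_Product.mat 1 :: complex^4^4) $ i $ j}"
    unfolding mat_mult_4 cadj4_def by (intro closed_Collect_all closed_Collect_eq continuous_intros)
  moreover have "closed {G::complex^4^4. Determinants.det G = 1}"
    unfolding det_4 by (intro closed_Collect_eq continuous_intros)
  ultimately have "closed ({G. \<forall>i j. (cadj4 G ** G) $ i $ j = (Finite_Cartesian_Product.mat 1 :: complex^4^4) $ i $ j} \<inter> {G. Determinants.det G = 1})"
    by (rule closed_Int)
  also have "\<dots> = SU4" by (auto simp: SU4_def Finite_Cartesian_Product.vec_eq_iff)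
  finally show ?thesis by simp
qed

lemma left_mult_measurable: "(\<lambda>x. (g::complex^4^4) ** (x::complex^4^4)) \<in> borel_measurable borel"
  by (intro measurable_entries4) (simp add: mat_mult_4)

text \<open>Gram-Schmidt commutes with left multiplication by SU(4), so it carries the uniform measure on a
  unitarily invariant set of matrices to an invariant measure.\<close>

theorem haar_SU4_exists:
  "\<exists>M. sets M = sets borel \<and> prob_space M \<and> emeasure M (- SU4) = 0 \<and>
       (\<forall>g\<in>SU4. distr M M (\<lambda>x. g ** x) = M)"
proof (intro exI conjI ballI)
  let ?P = "uniform_measure lborel ball_GL"
  let ?f = "\<lambda>v. gs_SU4 (unflatten v)"
  let ?M = "distr ?P borel ?f"
  interpret P: prob_space ?P using emeasure_ball_GL by (intro prob_space_uniform_measure)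
  have u: "unflatten \<in> borel_measurable borel" by (intro borel_measurable_continuous_onI continuous_unflatten)
  have f: "?f \<in> measurable ?P borel"
    using measurable_compose[OF u gs_SU4_measurable] by (simp add: uniform_measure_def)
  have m: "ball_GL \<in> sets lborel" using open_ball_GL by simp
  have AEb: "AE v in ?P. v \<in> ball_GL"
    using m by (intro AE_uniform_measureI) auto
  show "sets ?M = sets borel" by simp
  show "prob_space ?M" using f by (rule P.prob_space_distr)
  have "AE v in ?P. ?f v \<in> SU4" using AEb by eventually_elim (auto simp: ball_GL_def intro: gs_SU4_in)
  then have "AE x in ?M. x \<in> SU4" using f SU4_borel by (subst AE_distr_iff) auto
  then show "emeasure ?M (- SU4) = 0"
    using SU4_borel by (subst (asm) AE_iff_measurable[of "- SU4"]) auto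
  fix g assume g: "g \<in> SU4"
  have r: "rot32 g \<in> borel_measurable borel"
    using orthogonal_rot32[OF g] by (intro borel_measurable_continuous_onI linear_continuous_on linear_conv_bounded_linear[THEN iffD1] orthogonal_transformation_linear)
  have "distr ?M ?M (\<lambda>x. g ** x) = distr ?M borel (\<lambda>x. g ** x)" by (rule distr_cong) auto
  also have "\<dots> = distr ?P borel ((\<lambda>x. g ** x) \<circ> ?f)" by (rule distr_distr[OF left_mult_measurable f])
  also have "(\<lambda>x. g ** x) \<circ> ?f = ?f \<circ> rot32 g"
    by (simp add: fun_eq_iff unflatten_rot32 gs_SU4_equivariant[OF g])
  also have "distr ?P borel (?f \<circ> rot32 g) = distr (distr ?P borel (rot32 g)) borel ?f"
    using r measurable_compose[OF u gs_SU4_measurable] by (subst distr_distr) (auto simp: uniform_measure_def)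
  also have "\<dots> = ?M" unfolding distr_rot32[OF g] ..
  finally show "distr ?M ?M (\<lambda>x. g ** x) = ?M" .
qed

lemma haar_SU4_properties:
  shows sets_haar_SU4: "sets haar_SU4 = sets borel" and prob_haar_SU4: "prob_space haar_SU4"
    and AE_haar_SU4: "AE g in haar_SU4. g \<in> SU4"
    and haar_SU4_invariant: "g \<in> SU4 \<Longrightarrow> distr haar_SU4 haar_SU4 (\<lambda>x. g ** x) = haar_SU4"
proof -
  have *: "sets haar_SU4 = sets borel \<and> prob_space haar_SU4 \<and> emeasure haar_SU4 (- SU4) = 0 \<and>
       (\<forall>g\<in>SU4. distr haar_SU4 haar_SU4 (\<lambda>x. g ** x) = haar_SU4)"
    unfolding haar_SU4_def by (rule someI_ex[OF haar_SU4_exists])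
  then show "sets haar_SU4 = sets borel" "prob_space haar_SU4"
    "g \<in> SU4 \<Longrightarrow> distr haar_SU4 haar_SU4 (\<lambda>x. g ** x) = haar_SU4" by auto
  show "AE g in haar_SU4. g \<in> SU4"
    using * SU4_borel by (intro AE_I[of _ _ "- SU4"]) auto
qed

section \<open>Polynomials in the gates\<close>

inductive gate_poly :: "nat \<Rightarrow> ((nat \<Rightarrow> complex^4^4) \<Rightarrow> complex) \<Rightarrow> bool" for R where
  const: "gate_poly R (\<lambda>_. c)"
| entry: "i < R \<Longrightarrow> gate_poly R (\<lambda>gs. gs i $ a $ b)"
| cnj_entry: "i < R \<Longrightarrow> gate_poly R (\<lambda>gs. cnj (gs i $ a $ b))"
| add: "gate_poly R f \<Longrightarrow> gate_poly R g \<Longrightarrow> gate_poly R (\<lambda>gs. f gs + g gs)"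
| mult: "gate_poly R f \<Longrightarrow> gate_poly R g \<Longrightarrow> gate_poly R (\<lambda>gs. f gs * g gs)"

lemma gate_poly_sum: "finite I \<Longrightarrow> (\<And>i. i \<in> I \<Longrightarrow> gate_poly R (f i)) \<Longrightarrow> gate_poly R (\<lambda>gs. \<Sum>i\<in>I. f i gs)"
  by (induction I rule: finite_induct) (auto intro: gate_poly.intros)

lemma gate_poly_cnj: "gate_poly R f \<Longrightarrow> gate_poly R (\<lambda>gs. cnj (f gs))"
  by (induction rule: gate_poly.induct) (auto intro: gate_poly.intros)

lemma gate_poly_mono: "gate_poly R f \<Longrightarrow> R \<le> R' \<Longrightarrow> gate_poly R' f"
  by (induction rule: gate_poly.induct) (auto intro: gate_poly.intros)

lemma gate_poly_restrict: "gate_poly R f \<Longrightarrow> f (restrict gs {..<R}) = f gs"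
  by (induction rule: gate_poly.induct) auto

lemma gate_poly_measurable: "gate_poly R f \<Longrightarrow> f \<in> borel_measurable (PiM {..<R} (\<lambda>_. haar_SU4))"
proof (induction rule: gate_poly.induct)
  case (entry i a b)
  have "(\<lambda>gs. gs i) \<in> measurable (PiM {..<R} (\<lambda>_. haar_SU4)) borel"
    using measurable_component_singleton[of i "{..<R}" "\<lambda>_. haar_SU4"] entry
    by (simp add: measurable_cong_sets[OF refl sets_haar_SU4])
  then show ?case by (rule measurable_compose) (rule entry_measurable)
next
  case (cnj_entry i a b)
  have "(\<lambda>gs. gs i) \<in> measurable (PiM {..<R} (\<lambda>_. haar_SU4)) borel"
    using measurable_component_singleton[of i "{..<R}" "\<lambda>_. haar_SU4"] cnj_entry
    by (simp add: measurable_cong_sets[OF refl sets_haar_SU4])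
  then have "(\<lambda>gs. gs i $ a $ b) \<in> borel_measurable (PiM {..<R} (\<lambda>_. haar_SU4))"
    by (rule measurable_compose) (rule entry_measurable)
  then show ?case by (rule cnj_measurable)
qed auto

lemma trig_poly_matrix_mult:
  fixes A B :: "(nat \<Rightarrow> real) \<Rightarrow> complex^4^4"
  assumes "\<And>a b. trig_poly m d (\<lambda>\<theta>. A \<theta> $ a $ b)" "\<And>a b. trig_poly m d' (\<lambda>\<theta>. B \<theta> $ a $ b)"
  shows "trig_poly m (d + d') (\<lambda>\<theta>. (A \<theta> ** B \<theta>) $ a $ b)"
  unfolding mat_mult_4 by (intro trig_poly.add trig_poly_mult assms)

lemma trig_poly_if: "(c \<Longrightarrow> trig_poly m d f) \<Longrightarrow> (\<not> c \<Longrightarrow> trig_poly m d g) \<Longrightarrow> trig_poly m d (\<lambda>\<theta>. if c then f \<theta> else g \<theta>)"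
  by (cases c) auto

lemma trig_poly_uminus: "trig_poly m d f \<Longrightarrow> trig_poly m d (\<lambda>\<theta>. - f \<theta>)"
  using trig_poly.scale[of m d f "-1"] by simp

lemma trig_poly_cos_cis: "i < m \<Longrightarrow> j < m \<Longrightarrow> trig_poly m 2 (\<lambda>\<theta>. complex_of_real (cos (\<theta> i)) * cis (\<theta> j))"
  and trig_poly_sin_cis: "i < m \<Longrightarrow> j < m \<Longrightarrow> trig_poly m 2 (\<lambda>\<theta>. complex_of_real (sin (\<theta> i)) * cis (\<theta> j))"
  and trig_poly_cos2: "i < m \<Longrightarrow> trig_poly m 2 (\<lambda>\<theta>. complex_of_real (cos (\<theta> i)))"
  using trig_poly_mult[OF trig_poly_cos trig_poly_cis] trig_poly_mult[OF trig_poly_sin trig_poly_cis]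
    trig_poly_mono[OF trig_poly_cos, of i m 2] by (simp_all add: numeral_2_eq_2)

lemma trig_poly_tl4:
  "trig_poly m 2 a \<Longrightarrow> trig_poly m 2 b \<Longrightarrow> trig_poly m 2 (\<lambda>\<theta>. tl4 p q (a \<theta>) (b \<theta>) $ i $ j)"
  unfolding tl4_def vec_lambda_beta by (intro trig_poly_if trig_poly_cnj trig_poly_uminus trig_poly_const)

lemma trig_poly_su2:
  "trig_poly m 2 a \<Longrightarrow> trig_poly m 2 b \<Longrightarrow> trig_poly m 2 (\<lambda>\<theta>. su2 (a \<theta>) (b \<theta>) i j)"
  unfolding su2_def by (intro trig_poly_if trig_poly_cnj trig_poly_uminus)

lemma trig_poly_coset_angles:
  assumes "\<And>i. i < 9 \<Longrightarrow> h i < m"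
  shows "trig_poly m 8 (\<lambda>\<theta>. coset_angles (\<lambda>i. \<theta> (h i)) $ a $ b)"
proof -
  have "trig_poly m (2 + (2 + (2 + 2))) (\<lambda>\<theta>. coset_angles (\<lambda>i. \<theta> (h i)) $ a $ b)"
    unfolding coset_angles_def
    by (intro trig_poly_matrix_mult trig_poly_tl4 trig_poly_cos_cis trig_poly_sin_cis trig_poly_cos2 assms) auto
  then show ?thesis by simp
qed

lemma trig_poly_su2_angles:
  assumes "\<And>i. i < 3 \<Longrightarrow> h i < m"
  shows "trig_poly m 2 (\<lambda>\<theta>. su2_angles (\<lambda>i. \<theta> (h i)) a b)"
  unfolding su2_angles_def
  by (intro trig_poly_su2 trig_poly_cos_cis trig_poly_sin_cis assms) auto

definition su4_angles :: "(nat \<Rightarrow> real) \<Rightarrow> complex^4^4" where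
  "su4_angles t = kron2 (su2_angles (\<lambda>i. t (9 + i))) (su2_angles (\<lambda>i. t (12 + i))) ** coset_angles t"

lemma su4_angles_SU4: "su4_angles t \<in> SU4"
  unfolding su4_angles_def by (intro SU4_mult kron2_SU4 su2_angles_SU2 coset_angles_SU4)

lemma SU4_eq_su4_angles: assumes "G \<in> SU4" shows "\<exists>t. G = su4_angles t"
proof -
  obtain k l t where kl: "k \<in> SU2" "l \<in> SU2" "G = kron2 k l ** coset_angles t" using SU4_decomposition[OF assms] .
  obtain u v where uv: "k = su2_angles u" "l = su2_angles v" using SU2_angles kl by metis
  let ?t = "\<lambda>i. if i < 9 then t i else if i < 12 then u (i - 9) else v (i - 12)"
  have "su2_angles (\<lambda>i. ?t (9 + i)) = su2_angles u" "su2_angles (\<lambda>i. ?t (12 + i)) = su2_angles v" "coset_angles ?t = coset_angles t"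
    by (simp_all add: su2_angles_def coset_angles_def)
  then have "su4_angles ?t = G" unfolding su4_angles_def kl uv by simp
  then show ?thesis by blast
qed

lemma trig_poly_su4_angles: "trig_poly 15 12 (\<lambda>\<theta>. su4_angles \<theta> $ a $ b)"
proof -
  have "trig_poly 15 (2 + 2) (\<lambda>\<theta>. kron2 (su2_angles (\<lambda>i. \<theta> (9 + i))) (su2_angles (\<lambda>i. \<theta> (12 + i))) $ a $ b)" for a b
    unfolding kron2_def by simp (intro trig_poly_mult[of 15 2 _ 2, simplified] trig_poly_su2_angles; simp)
  moreover have "trig_poly 15 8 (\<lambda>\<theta>. coset_angles \<theta> $ a $ b)" for a b
    using trig_poly_coset_angles[of "\<lambda>i. i"] by simp
  ultimately show ?thesis
    using trig_poly_matrix_mult[of 15 "2 + 2" _ 8 coset_angles] unfolding su4_angles_def by simp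
qed

lemma gate_poly_trig_poly:
  assumes "gate_poly R f"
  shows "\<exists>d. trig_poly 15 d (\<lambda>\<theta>. f (gs(i := su4_angles \<theta> ** x)))"
  using assms
proof (induction rule: gate_poly.induct)
  case (const c)
  then show ?case by (auto intro: trig_poly_const)
next
  case (entry j a b)
  have "trig_poly 15 12 (\<lambda>\<theta>. (su4_angles \<theta> ** x) $ a $ b)"
    using trig_poly_matrix_mult[OF trig_poly_su4_angles, of 0 "\<lambda>_. x"] trig_poly_const by simp
  then show ?case by (cases "i = j") (auto intro: trig_poly_const)
next
  case (cnj_entry j a b)
  have "trig_poly 15 12 (\<lambda>\<theta>. (su4_angles \<theta> ** x) $ a $ b)"
    using trig_poly_matrix_mult[OF trig_poly_su4_angles, of 0 "\<lambda>_. x"] trig_poly_const by simp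
  then show ?case by (cases "i = j") (auto intro: trig_poly_const trig_poly_cnj)
next
  case (add f g)
  then obtain d d' where d: "trig_poly 15 d (\<lambda>\<theta>. f (gs(i := su4_angles \<theta> ** x)))" "trig_poly 15 d' (\<lambda>\<theta>. g (gs(i := su4_angles \<theta> ** x)))" by blast
  show ?case using trig_poly.add[OF trig_poly_mono[OF d(1) max.cobounded1] trig_poly_mono[OF d(2) max.cobounded2]] by blast
next
  case (mult f g)
  then show ?case using trig_poly_mult by blast
qed

text \<open>Left invariance lets us average over the angles parametrizing SU(4); along the angles the
  function is a trigonometric polynomial, so it vanishes identically or almost nowhere.\<close>

lemma gate_poly_slice_null:
  assumes "gate_poly R f"
  shows "(\<forall>g\<in>SU4. f (gs(i := g)) = 0) \<or> (AE g in haar_SU4. f (gs(i := g)) \<noteq> 0)"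
proof (cases "\<forall>g\<in>SU4. f (gs(i := g)) = 0")
  case False
  then obtain g0 where g0: "g0 \<in> SU4" "f (gs(i := g0)) \<noteq> 0" by blast
  define h where "h = (\<lambda>g. f (gs(i := g)))"
  have hm: "h \<in> borel_measurable borel"
    using assms unfolding h_def
  proof (induction rule: gate_poly.induct)
    case (entry j a b)
    show ?case by (cases "i = j") auto
  next
    case (cnj_entry j a b)
    show ?case by (cases "i = j") auto
  qed auto
  interpret H: prob_space haar_SU4 by (rule prob_haar_SU4)
  let ?A = "PiM {..<15} (\<lambda>_. unif01)"
  interpret A: prob_space ?A by (intro prob_space_PiM prob_unif01)
  interpret pair_sigma_finite haar_SU4 ?A ..
  have "AE x in haar_SU4. AE \<theta> in ?A. h (su4_angles \<theta> ** x) \<noteq> 0"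
    using AE_haar_SU4
  proof eventually_elim
    case (elim x)
    obtain d where d: "trig_poly 15 d (\<lambda>\<theta>. f (gs(i := su4_angles \<theta> ** x)))"
      using gate_poly_trig_poly[OF assms] by blast
    have "g0 ** cadj4 x \<in> SU4" using g0 elim by (intro SU4_mult SU4_cadj4)
    then obtain t where "su4_angles t = g0 ** cadj4 x" using SU4_eq_su4_angles by metis
    then have "su4_angles t ** x = g0" by (simp add: matrix_mul_assoc[symmetric] SU4_cadj4_left[OF elim])
    then have "f (gs(i := su4_angles t ** x)) \<noteq> 0" using g0 by simp
    from trig_poly_AE_nonzero[OF d, of t, OF this] show ?case unfolding h_def .
  qed
  moreover have meas: "(\<lambda>p. h (su4_angles (snd p) ** fst p)) \<in> borel_measurable (haar_SU4 \<Otimes>\<^sub>M ?A)"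
  proof (rule measurable_compose[OF _ hm], rule measurable_entries4)
    fix a b
    have s: "(\<lambda>p. su4_angles (snd p) $ a $ b) \<in> borel_measurable (haar_SU4 \<Otimes>\<^sub>M ?A)" for a b
      by (rule measurable_compose[OF measurable_snd trig_poly_measurable[OF trig_poly_su4_angles]])
    have "fst \<in> measurable (haar_SU4 \<Otimes>\<^sub>M ?A) borel"
      using measurable_fst[of haar_SU4 ?A] by (simp add: measurable_cong_sets[OF refl sets_haar_SU4])
    then have x: "(\<lambda>p. fst p $ a $ b) \<in> borel_measurable (haar_SU4 \<Otimes>\<^sub>M ?A)" for a b
      by (rule measurable_compose) (rule entry_measurable)
    show "(\<lambda>p. (su4_angles (snd p) ** fst p) $ a $ b) \<in> borel_measurable (haar_SU4 \<Otimes>\<^sub>M ?A)"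
      unfolding mat_mult_4 by (intro borel_measurable_add borel_measurable_times s x)
  qed
  ultimately have "AE \<theta> in ?A. AE x in haar_SU4. h (su4_angles \<theta> ** x) \<noteq> 0"
    by (subst AE_commute[symmetric, where P="\<lambda>x \<theta>. h (su4_angles \<theta> ** x) \<noteq> 0"]) auto
  then have "\<exists>\<theta>. AE x in haar_SU4. h (su4_angles \<theta> ** x) \<noteq> 0"
    using A.AE_False eventually_mono by (metis (mono_tags, lifting))
  then obtain \<theta> where t: "AE x in haar_SU4. h (su4_angles \<theta> ** x) \<noteq> 0" by blast
  have lm: "(\<lambda>x. su4_angles \<theta> ** x) \<in> measurable haar_SU4 haar_SU4"
    using left_mult_measurable[of "su4_angles \<theta>"]
    by (simp add: measurable_cong_sets[OF sets_haar_SU4 sets_haar_SU4])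
  have "{x \<in> space haar_SU4. h x \<noteq> 0} \<in> sets haar_SU4"
    using hm by (auto simp: sets_haar_SU4 sets_eq_imp_space_eq[OF sets_haar_SU4])
  then have "AE x in distr haar_SU4 haar_SU4 (\<lambda>x. su4_angles \<theta> ** x). h x \<noteq> 0"
    using t by (subst AE_distr_iff[OF lm]) auto
  then have "AE x in haar_SU4. h x \<noteq> 0"
    unfolding haar_SU4_invariant[OF su4_angles_SU4] .
  then show ?thesis unfolding h_def by blast
qed blast

theorem gate_poly_AE_nonzero:
  assumes "gate_poly R f" "\<And>i. i < R \<Longrightarrow> gs0 i \<in> SU4" "f gs0 \<noteq> 0"
  shows "AE gs in PiM {..<R} (\<lambda>_. haar_SU4). f gs \<noteq> 0"
proof (rule AE_PiM_nonzero[where A=SU4 and z=gs0])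
  show "f (restrict gs0 {..<R}) \<noteq> 0" using gate_poly_restrict[OF assms(1)] assms(3) by simp
  show "SU4 \<subseteq> space haar_SU4" using sets_eq_imp_space_eq[OF sets_haar_SU4] by simp
qed (use assms gate_poly_slice_null prob_haar_SU4 gate_poly_measurable in auto)

lemma gate_poly_mult_zero:
  assumes "gate_poly R f" "gate_poly R g" "\<And>gs. (\<And>i. i < R \<Longrightarrow> gs i \<in> SU4) \<Longrightarrow> f gs * g gs = 0"
    and "\<And>i. i < R \<Longrightarrow> gs0 i \<in> SU4" "f gs0 \<noteq> 0" "\<And>i. i < R \<Longrightarrow> gs i \<in> SU4"
  shows "g gs = 0"
proof (rule ccontr)
  assume "g gs \<noteq> 0"
  let ?P = "PiM {..<R} (\<lambda>_. haar_SU4)"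
  interpret prob_space ?P by (intro prob_space_PiM prob_haar_SU4)
  have "AE gs in ?P. f gs \<noteq> 0" "AE gs in ?P. g gs \<noteq> 0"
    using gate_poly_AE_nonzero assms \<open>g gs \<noteq> 0\<close> by blast+
  moreover have "AE gs in ?P. \<forall>i\<in>{..<R}. gs i \<in> SU4"
  proof (intro AE_finite_allI)
    fix i assume i: "i \<in> {..<R}"
    show "AE gs in ?P. gs i \<in> SU4"
      using AE_haar_SU4 i by (intro AE_PiM_component) (auto intro: prob_haar_SU4)
  qed auto
  ultimately have "AE gs in ?P. False"
    by eventually_elim (use assms(3) in auto)
  then show False by simp
qed

section \<open>Gates embedded in the n-qubit space\<close>

lemma less_two_power_bit: "(x::nat) < 2^n \<longleftrightarrow> (\<forall>j\<ge>n. \<not> bit x j)"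
proof -
  have "take_bit n x = x \<longleftrightarrow> (\<forall>j\<ge>n. \<not> bit x j)"
  proof
    assume *: "take_bit n x = x"
    show "\<forall>j\<ge>n. \<not> bit x j"
    proof (intro allI impI)
      fix j assume "n \<le> j"
      then have "\<not> bit (take_bit n x) j" unfolding bit_take_bit_iff by linarith
      then show "\<not> bit x j" unfolding * .
    qed
  next
    assume "\<forall>j\<ge>n. \<not> bit x j"
    then show "take_bit n x = x" by (intro bit_eqI) (metis bit_take_bit_iff not_le)
  qed
  then show ?thesis unfolding take_bit_nat_eq_self_iff by simp
qed

definition setb :: "bool \<Rightarrow> nat \<Rightarrow> nat \<Rightarrow> nat" where
  "setb c k y = (if c then set_bit k y else unset_bit k y)"

lemma bit_setb: "bit (setb c k y) j = (if j = k then c else bit y j)"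
  by (auto simp: setb_def bit_set_bit_iff bit_unset_bit_iff)

definition put2 :: "nat \<Rightarrow> nat \<Rightarrow> 4 \<Rightarrow> nat \<Rightarrow> nat" where
  "put2 a b v y = setb (hi4 v) (a - 1) (setb (lo4 v) (b - 1) y)"

lemma bit_put2: "bit (put2 a b v y) j = (if j = a - 1 then hi4 v else if j = b - 1 then lo4 v else bit y j)"
  by (simp add: put2_def bit_setb)

lemma idx4_alt: "idx4 a b x = (if bit x (a - 1) then if bit x (b - 1) then 3 else 2 else if bit x (b - 1) then 1 else 0)"
  by (simp add: idx4_def)

lemma hi4_idx4 [simp]: "hi4 (idx4 a b x) = bit x (a - 1)" and lo4_idx4 [simp]: "lo4 (idx4 a b x) = bit x (b - 1)"
  by (simp_all add: idx4_alt)

lemma four_eq_iff: "v = w \<longleftrightarrow> hi4 v = hi4 w \<and> lo4 v = lo4 w"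
  using exhaust4[of v] exhaust4[of w] by auto

definition pair_ok :: "nat \<Rightarrow> nat \<times> nat \<Rightarrow> bool" where
  "pair_ok n p = (case p of (a, b) \<Rightarrow> a \<in> {1..n} \<and> b \<in> {1..n} \<and> a \<noteq> b)"

lemma wf_arch_alt: "wf_arch n arch \<longleftrightarrow> (\<forall>p\<in>set arch. pair_ok n p)"
  by (auto simp: wf_arch_def pair_ok_def)

definition agree_off :: "nat \<Rightarrow> nat \<Rightarrow> nat \<Rightarrow> nat \<Rightarrow> nat \<Rightarrow> bool" where
  "agree_off n a b x y \<longleftrightarrow> (\<forall>k\<in>{1..n} - {a, b}. bit x (k - 1) = bit y (k - 1))"

lemma idx4_put2: "pair_ok n (a, b) \<Longrightarrow> idx4 a b (put2 a b v y) = v"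
  by (auto simp: pair_ok_def four_eq_iff bit_put2)

lemma put2_less: "pair_ok n (a, b) \<Longrightarrow> y < 2^n \<Longrightarrow> put2 a b v y < 2^n"
  unfolding less_two_power_bit
proof (intro allI impI)
  fix j assume ok: "pair_ok n (a, b)" and y: "\<forall>j\<ge>n. \<not> bit y j" and j: "n \<le> j"
  have "j \<noteq> a - 1" "j \<noteq> b - 1" using ok j unfolding pair_ok_def by auto
  then show "\<not> bit (put2 a b v y) j" using y j by (simp add: bit_put2)
qed

lemma agree_off_put2: "pair_ok n (a, b) \<Longrightarrow> agree_off n a b (put2 a b v y) y"
  by (auto simp: pair_ok_def agree_off_def bit_put2)

lemma agree_off_eqI:
  assumes "x < 2^n" "y < 2^n" "agree_off n a b x y" "idx4 a b x = idx4 a b y"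
  shows "x = y"
proof (rule bit_eqI)
  fix j
  have i: "bit x (a - 1) = bit y (a - 1)" "bit x (b - 1) = bit y (b - 1)"
    using assms(4) by (auto simp: four_eq_iff)
  show "bit x j = bit y j"
  proof (cases "j < n")
    case True
    show ?thesis
    proof (cases "Suc j \<in> {a, b}")
      case False
      then have "Suc j \<in> {1..n} - {a, b}" using True by auto
      then have "bit x (Suc j - 1) = bit y (Suc j - 1)" using assms(3) unfolding agree_off_def by blast
      then show ?thesis by simp
    qed (use i in auto)
  next
    case False
    then show ?thesis using assms(1,2) less_two_power_bit by (meson not_le)
  qed
qed

lemma sum_agree_off:
  assumes "pair_ok n (a, b)" "y < 2^n"
  shows "(\<Sum>z<2^n. if agree_off n a b z y then g z else (0::complex)) = (\<Sum>v\<in>UNIV. g (put2 a b v y))"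
proof -
  have "(\<Sum>v\<in>UNIV. g (put2 a b v y)) = (\<Sum>z\<in>{z. z < 2^n \<and> agree_off n a b z y}. g z)"
  proof (rule sum.reindex_bij_betw)
    have "inj (\<lambda>v. put2 a b v y)" by (rule inj_on_inverseI[where g="idx4 a b"]) (simp add: idx4_put2[OF assms(1)])
    moreover have "z \<in> range (\<lambda>v. put2 a b v y)" if z: "z < 2^n" "agree_off n a b z y" for z
    proof
      show "z = put2 a b (idx4 a b z) y"
      proof (rule agree_off_eqI[of _ n _ a b])
        show "agree_off n a b z (put2 a b (idx4 a b z) y)"
          using z(2) agree_off_put2[OF assms(1), of "idx4 a b z" y] by (auto simp: agree_off_def)
      qed (use z put2_less[OF assms] idx4_put2[OF assms(1)] in auto)
    qed simp
    ultimately show "bij_betw (\<lambda>v. put2 a b v y) UNIV {z. z < 2^n \<and> agree_off n a b z y}"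
      using put2_less[OF assms] agree_off_put2[OF assms(1)] by (auto simp: bij_betw_def)
  qed
  also have "\<dots> = (\<Sum>z<2^n. if agree_off n a b z y then g z else 0)"
    by (simp add: sum.inter_filter[symmetric])
  finally show ?thesis ..
qed

lemma agree_off_commute: "agree_off n a b x y = agree_off n a b y x"
  by (auto simp: agree_off_def)

lemma mat_mult_entry:
  assumes "A \<in> carrier_mat N N" "B \<in> carrier_mat N M" "x < N" "y < M"
  shows "(A * B) $$ (x, y) = (\<Sum>z<N. A $$ (x, z) * B $$ (z, y) :: complex)"
  using assms by (auto simp: scalar_prod_def atLeast0LessThan intro!: sum.cong)

text \<open>The common shape of a two-qubit gate multiplied, on either side, by a product of one-qubit
  gates: k i on every qubit i other than a and b, and H on the pair (a, b).\<close>

definition tensor_op :: "nat \<Rightarrow> (nat \<Rightarrow> bool \<Rightarrow> bool \<Rightarrow> complex) \<Rightarrow> nat \<times> nat \<Rightarrow> complex^4^4 \<Rightarrow> complex Matrix.mat" where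
  "tensor_op n k p H = (case p of (a, b) \<Rightarrow> Matrix.mat (2^n) (2^n) (\<lambda>(x, y).
     (\<Prod>i\<in>{1..n} - {a, b}. k i (bit x (i - 1)) (bit y (i - 1))) * H $ idx4 a b x $ idx4 a b y))"

definition local_op :: "nat \<Rightarrow> (nat \<Rightarrow> bool \<Rightarrow> bool \<Rightarrow> complex) \<Rightarrow> complex Matrix.mat" where
  "local_op n k = Matrix.mat (2^n) (2^n) (\<lambda>(x, y). \<Prod>i\<in>{1..n}. k i (bit x (i - 1)) (bit y (i - 1)))"

lemma tensor_op_carrier [simp]: "tensor_op n k p H \<in> carrier_mat (2^n) (2^n)"
  and local_op_carrier [simp]: "local_op n k \<in> carrier_mat (2^n) (2^n)"
  and embed_gate_carrier [simp]: "embed_gate n p G \<in> carrier_mat (2^n) (2^n)"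
  by (auto simp: tensor_op_def local_op_def embed_gate_def split: prod.splits)

lemma tensor_op_entry: "x < 2^n \<Longrightarrow> y < 2^n \<Longrightarrow> tensor_op n k (a, b) H $$ (x, y) =
    (\<Prod>i\<in>{1..n} - {a, b}. k i (bit x (i - 1)) (bit y (i - 1))) * H $ idx4 a b x $ idx4 a b y"
  by (simp add: tensor_op_def)

lemma embed_gate_entry: "x < 2^n \<Longrightarrow> y < 2^n \<Longrightarrow> embed_gate n (a, b) G $$ (x, y) =
    (if agree_off n a b x y then G $ idx4 a b x $ idx4 a b y else 0)"
  by (simp add: embed_gate_def agree_off_def)

lemma embed_gate_tensor_op: "embed_gate n p G = tensor_op n (\<lambda>_. idB) p G"
proof -
  obtain a b where p: "p = (a, b)" by (cases p)
  have "(\<Prod>i\<in>{1..n} - {a, b}. idB (bit x (i - 1)) (bit y (i - 1))) = (if agree_off n a b x y then 1 else 0)" for x y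
    by (auto simp: agree_off_def idB_def prod_zero_iff)
  then show ?thesis unfolding p
    by (intro eq_matI) (auto simp: tensor_op_entry embed_gate_entry tensor_op_def embed_gate_def agree_off_def)
qed

lemma embed_mult_tensor_op:
  assumes "pair_ok n p"
  shows "embed_gate n p G * tensor_op n k p H = tensor_op n k p (G ** H)"
proof -
  obtain a b where p: "p = (a, b)" by (cases p)
  note ok = assms[unfolded p]
  show ?thesis unfolding p
  proof (intro eq_matI)
    fix x y assume "x < dim_row (tensor_op n k (a, b) (G ** H))" "y < dim_col (tensor_op n k (a, b) (G ** H))"
    then have xy: "x < 2^n" "y < 2^n" by (auto simp: tensor_op_def)
    have pr: "(\<Prod>i\<in>{1..n} - {a, b}. k i (bit z (i - 1)) (bit y (i - 1))) = (\<Prod>i\<in>{1..n} - {a, b}. k i (bit x (i - 1)) (bit y (i - 1)))"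
      if "agree_off n a b z x" for z
      using that unfolding agree_off_def by (intro prod.cong) auto
    have "(embed_gate n (a, b) G * tensor_op n k (a, b) H) $$ (x, y) = (\<Sum>z<2^n. if agree_off n a b z x then
       G $ idx4 a b x $ idx4 a b z * ((\<Prod>i\<in>{1..n} - {a, b}. k i (bit z (i - 1)) (bit y (i - 1))) * H $ idx4 a b z $ idx4 a b y) else 0)"
      by (subst mat_mult_entry[where N="2^n" and M="2^n"]) (use xy in \<open>auto simp: embed_gate_entry tensor_op_entry agree_off_commute[of n a b x] intro!: sum.cong\<close>)
    also have "\<dots> = tensor_op n k (a, b) (G ** H) $$ (x, y)"
      unfolding sum_agree_off[OF ok xy(1)] idx4_put2[OF ok] pr[OF agree_off_put2[OF ok]] tensor_op_entry[OF xy]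
      by (simp add: matrix_matrix_mult_def sum_distrib_left sum_distrib_right mult_ac)
    finally show "(embed_gate n (a, b) G * tensor_op n k (a, b) H) $$ (x, y) = tensor_op n k (a, b) (G ** H) $$ (x, y)" .
  qed (auto simp: tensor_op_def embed_gate_def)
qed

lemma tensor_op_mult_embed:
  assumes "pair_ok n p"
  shows "tensor_op n k p H * embed_gate n p G = tensor_op n k p (H ** G)"
proof -
  obtain a b where p: "p = (a, b)" by (cases p)
  note ok = assms[unfolded p]
  show ?thesis unfolding p
  proof (intro eq_matI)
    fix x y assume "x < dim_row (tensor_op n k (a, b) (H ** G))" "y < dim_col (tensor_op n k (a, b) (H ** G))"
    then have xy: "x < 2^n" "y < 2^n" by (auto simp: tensor_op_def)
    have pr: "(\<Prod>i\<in>{1..n} - {a, b}. k i (bit x (i - 1)) (bit z (i - 1))) = (\<Prod>i\<in>{1..n} - {a, b}. k i (bit x (i - 1)) (bit y (i - 1)))"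
      if "agree_off n a b z y" for z
      using that unfolding agree_off_def by (intro prod.cong) auto
    have "(tensor_op n k (a, b) H * embed_gate n (a, b) G) $$ (x, y) = (\<Sum>z<2^n. if agree_off n a b z y then
       ((\<Prod>i\<in>{1..n} - {a, b}. k i (bit x (i - 1)) (bit z (i - 1))) * H $ idx4 a b x $ idx4 a b z) * G $ idx4 a b z $ idx4 a b y else 0)"
      by (subst mat_mult_entry[where N="2^n" and M="2^n"]) (use xy in \<open>auto simp: embed_gate_entry tensor_op_entry intro!: sum.cong\<close>)
    also have "\<dots> = tensor_op n k (a, b) (H ** G) $$ (x, y)"
      unfolding sum_agree_off[OF ok xy(2)] idx4_put2[OF ok] pr[OF agree_off_put2[OF ok]] tensor_op_entry[OF xy]
      by (simp add: matrix_matrix_mult_def sum_distrib_left sum_distrib_right mult_ac)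
    finally show "(tensor_op n k (a, b) H * embed_gate n (a, b) G) $$ (x, y) = tensor_op n k (a, b) (H ** G) $$ (x, y)" .
  qed (auto simp: tensor_op_def embed_gate_def)
qed

lemma embed_gate_one: "embed_gate n p (Finite_Cartesian_Product.mat 1) = 1\<^sub>m (2^n)"
proof -
  obtain a b where p: "p = (a, b)" by (cases p)
  have "agree_off n a b x x" for x by (simp add: agree_off_def)
  then show ?thesis unfolding p
    by (intro eq_matI) (use agree_off_eqI[of _ n _ a b] in \<open>auto simp: embed_gate_entry Finite_Cartesian_Product.mat_def\<close>, auto simp: embed_gate_def)
qed

lemma local_op_tensor_op:
  assumes "pair_ok n (a, b)"
  shows "local_op n k = tensor_op n k (a, b) (kron2 (k a) (k b))"
proof (intro eq_matI)
  fix x y assume "x < dim_row (tensor_op n k (a, b) (kron2 (k a) (k b)))" "y < dim_col (tensor_op n k (a, b) (kron2 (k a) (k b)))"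
  then have xy: "x < 2^n" "y < 2^n" by (auto simp: tensor_op_def)
  have "(\<Prod>i\<in>{1..n}. f i) = f a * (f b * (\<Prod>i\<in>{1..n} - {a, b}. f i))" for f :: "nat \<Rightarrow> complex"
  proof -
    have "{1..n} - {a} - {b} = {1..n} - {a, b}" by auto
    moreover have "prod f {1..n} = f a * prod f ({1..n} - {a})"
      using assms by (intro prod.remove) (auto simp: pair_ok_def)
    moreover have "prod f ({1..n} - {a}) = f b * prod f ({1..n} - {a} - {b})"
      using assms by (intro prod.remove) (auto simp: pair_ok_def)
    ultimately show ?thesis by simp
  qed
  then show "local_op n k $$ (x, y) = tensor_op n k (a, b) (kron2 (k a) (k b)) $$ (x, y)"
    using xy by (simp add: local_op_def tensor_op_entry kron2_def mult_ac)
qed (auto simp: local_op_def tensor_op_def)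

lemma embed_gate_local_op:
  assumes p: "pair_ok n p" and G: "G \<in> SU4" and k: "\<And>i. k i \<in> SU2"
  shows "\<exists>k' t. (\<forall>i. k' i \<in> SU2) \<and> embed_gate n p G * local_op n k = local_op n k' * embed_gate n p (coset_angles t)"
proof -
  obtain a b where ab: "p = (a, b)" by (cases p)
  note ok = p[unfolded ab]
  have "G ** kron2 (k a) (k b) \<in> SU4" by (intro SU4_mult G kron2_SU4 k)
  then obtain u v t where uv: "u \<in> SU2" "v \<in> SU2" "G ** kron2 (k a) (k b) = kron2 u v ** coset_angles t"
    using SU4_decomposition by metis
  let ?k = "k(a := u, b := v)"
  have ne: "a \<noteq> b" using ok by (auto simp: pair_ok_def)
  have "embed_gate n p G * local_op n k = tensor_op n k p (kron2 u v ** coset_angles t)"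
    unfolding ab local_op_tensor_op[OF ok] embed_mult_tensor_op[OF ok] uv(3) ..
  also have "\<dots> = tensor_op n ?k p (kron2 (?k a) (?k b) ** coset_angles t)"
    using ne unfolding ab tensor_op_def by (auto simp: intro!: cong_mat prod.cong)
  also have "\<dots> = local_op n ?k * embed_gate n p (coset_angles t)"
    unfolding ab local_op_tensor_op[OF ok] tensor_op_mult_embed[OF ok] ..
  finally show ?thesis using k uv by (intro exI[of _ ?k] exI[of _ t]) auto
qed

lemma circuit_unitary_Nil: "circuit_unitary n [] gs = 1\<^sub>m (2^n)"
  by (simp add: circuit_unitary_def)

lemma circuit_unitary_snoc: "circuit_unitary n (arch @ [p]) gs = embed_gate n p (gs (length arch)) * circuit_unitary n arch gs"
proof -
  have "fold (\<lambda>i M. embed_gate n ((arch @ [p]) ! i) (gs i) * M) [0..<length arch] X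
      = fold (\<lambda>i M. embed_gate n (arch ! i) (gs i) * M) [0..<length arch] X" for X
    by (intro fold_cong) (auto simp: nth_append)
  then show ?thesis by (simp add: circuit_unitary_def)
qed

lemma circuit_unitary_carrier [simp]: "circuit_unitary n arch gs \<in> carrier_mat (2^n) (2^n)"
proof (induction arch rule: rev_induct)
  case (snoc p arch)
  then show ?case unfolding circuit_unitary_snoc by (intro mult_carrier_mat[of _ _ "2^n"]) auto
qed (simp add: circuit_unitary_Nil)

lemma circuit_unitary_cong: "(\<And>i. i < length arch \<Longrightarrow> gs i = gs' i) \<Longrightarrow> circuit_unitary n arch gs = circuit_unitary n arch gs'"
  unfolding circuit_unitary_def by (intro fold_cong) auto

lemma circuit_unitary_append:
  "circuit_unitary n (xs @ ys) gs = circuit_unitary n ys (\<lambda>i. gs (length xs + i)) * circuit_unitary n xs gs"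
proof (induction ys rule: rev_induct)
  case Nil
  then show ?case by (simp add: circuit_unitary_Nil left_mult_one_mat[OF circuit_unitary_carrier])
next
  case (snoc p ys)
  show ?case unfolding append_assoc[symmetric] circuit_unitary_snoc snoc length_append
    by (rule assoc_mult_mat[symmetric, of _ "2^n" "2^n" _ "2^n" _ "2^n"]) auto
qed

lemma circuit_unitary_one: "circuit_unitary n arch (\<lambda>_. Finite_Cartesian_Product.mat 1) = 1\<^sub>m (2^n)"
  by (induction arch rule: rev_induct) (simp_all add: circuit_unitary_Nil circuit_unitary_snoc embed_gate_one)

lemma local_op_one: "local_op n (\<lambda>_. idB) = 1\<^sub>m (2^n)"
proof (intro eq_matI)
  fix x y assume "x < dim_row (1\<^sub>m (2^n) :: complex Matrix.mat)" "y < dim_col (1\<^sub>m (2^n) :: complex Matrix.mat)"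
  then have xy: "x < 2^n" "y < 2^n" by auto
  have eq: "x = y" if "\<And>i. i \<in> {1..n} \<Longrightarrow> bit x (i - 1) = bit y (i - 1)"
  proof (rule bit_eqI)
    fix j
    show "bit x j = bit y j"
    proof (cases "j < n")
      case True
      then show ?thesis using that[of "Suc j"] by simp
    next
      case False
      then show ?thesis using xy less_two_power_bit by (meson not_le)
    qed
  qed
  show "local_op n (\<lambda>_. idB) $$ (x, y) = 1\<^sub>m (2^n) $$ (x, y)"
  proof (cases "x = y")
    case False
    then obtain i where "i \<in> {1..n}" "bit x (i - 1) \<noteq> bit y (i - 1)" using eq by blast
    then have "(\<Prod>i\<in>{1..n}. idB (bit x (i - 1)) (bit y (i - 1))) = 0"
      by (intro prod_zero) (auto simp: idB_def)
    then show ?thesis using False xy by (simp add: local_op_def)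
  qed (use xy in \<open>simp add: local_op_def idB_def\<close>)
qed (auto simp: local_op_def)

text \<open>Pushing one-qubit gates to the end of the circuit leaves nine angles per two-qubit gate and
  three per qubit.\<close>

lemma circuit_gauge_fix:
  assumes "wf_arch n arch" "\<And>i. i < length arch \<Longrightarrow> gs i \<in> SU4"
  shows "\<exists>k t. (\<forall>i. k i \<in> SU2) \<and> circuit_unitary n arch gs = local_op n k * circuit_unitary n arch (\<lambda>i. coset_angles (t i))"
  using assms
proof (induction arch rule: rev_induct)
  case Nil
  then show ?case using idB_SU2 by (intro exI[of _ "\<lambda>_. idB"]) (simp add: circuit_unitary_Nil local_op_one)
next
  case (snoc p arch)
  then obtain k t where kt: "\<And>i. k i \<in> SU2" "circuit_unitary n arch gs = local_op n k * circuit_unitary n arch (\<lambda>i. coset_angles (t i))"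
    unfolding wf_arch_alt by fastforce
  have "pair_ok n p" "gs (length arch) \<in> SU4" using snoc.prems by (auto simp: wf_arch_alt)
  then obtain k' s where
    k': "\<And>i. k' i \<in> SU2" "embed_gate n p (gs (length arch)) * local_op n k = local_op n k' * embed_gate n p (coset_angles s)"
    using embed_gate_local_op[of n p "gs (length arch)" k] kt(1) by blast
  let ?t = "t(length arch := s)" and ?C = "circuit_unitary n arch (\<lambda>i. coset_angles (t i))"
  have C: "circuit_unitary n arch (\<lambda>i. coset_angles (?t i)) = ?C" by (rule circuit_unitary_cong) simp
  have "circuit_unitary n (arch @ [p]) gs = (embed_gate n p (gs (length arch)) * local_op n k) * ?C"
    unfolding circuit_unitary_snoc kt(2) by (rule assoc_mult_mat[symmetric, of _ "2^n" "2^n" _ "2^n" _ "2^n"]) auto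
  also have "\<dots> = local_op n k' * (embed_gate n p (coset_angles s) * ?C)"
    unfolding k'(2) by (rule assoc_mult_mat[of _ "2^n" "2^n" _ "2^n" _ "2^n"]) auto
  also have "embed_gate n p (coset_angles s) * ?C = circuit_unitary n (arch @ [p]) (\<lambda>i. coset_angles (?t i))"
    unfolding circuit_unitary_snoc C by simp
  finally show ?case using k'(1) by blast
qed

lemma trig_poly_embed_gate:
  assumes "\<And>a b. trig_poly m d (\<lambda>\<theta>. G \<theta> $ a $ b)" "x < 2^n" "y < 2^n"
  shows "trig_poly m d (\<lambda>\<theta>. embed_gate n p (G \<theta>) $$ (x, y))"
proof -
  obtain a b where p: "p = (a, b)" by (cases p)
  show ?thesis unfolding p embed_gate_entry[OF assms(2,3)]
    by (intro trig_poly_if assms(1) trig_poly_const)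
qed

lemma trig_poly_mat_mult:
  assumes "\<And>\<theta>. A \<theta> \<in> carrier_mat N N" "\<And>\<theta>. B \<theta> \<in> carrier_mat N N"
    and "\<And>x y. x < N \<Longrightarrow> y < N \<Longrightarrow> trig_poly m d (\<lambda>\<theta>. A \<theta> $$ (x, y))"
    and "\<And>x y. x < N \<Longrightarrow> y < N \<Longrightarrow> trig_poly m d' (\<lambda>\<theta>. B \<theta> $$ (x, y))"
    and "x < N" "y < N"
  shows "trig_poly m (d + d') (\<lambda>\<theta>. (A \<theta> * B \<theta>) $$ (x, y))"
  unfolding mat_mult_entry[OF assms(1,2,5,6)]
  by (intro trig_poly_sum trig_poly_mult assms) (use assms(5,6) in auto)

lemma trig_poly_circuit:
  assumes "\<And>i a b. i < length arch \<Longrightarrow> trig_poly m d (\<lambda>\<theta>. G \<theta> i $ a $ b)" "x < 2^n" "y < 2^n"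
  shows "trig_poly m (length arch * d) (\<lambda>\<theta>. circuit_unitary n arch (G \<theta>) $$ (x, y))"
  using assms
proof (induction arch arbitrary: x y rule: rev_induct)
  case Nil
  then show ?case by (simp add: circuit_unitary_Nil trig_poly_const)
next
  case (snoc p arch)
  have "trig_poly m (d + length arch * d) (\<lambda>\<theta>. (embed_gate n p (G \<theta> (length arch)) * circuit_unitary n arch (G \<theta>)) $$ (x, y))"
    by (rule trig_poly_mat_mult[where N="2^n"]) (use snoc in \<open>auto intro!: trig_poly_embed_gate\<close>)
  then show ?case by (simp add: circuit_unitary_snoc)
qed

lemma gate_poly_circuit:
  "x < 2^n \<Longrightarrow> y < 2^n \<Longrightarrow> gate_poly (length arch) (\<lambda>gs. circuit_unitary n arch gs $$ (x, y))"
proof (induction arch arbitrary: x y rule: rev_induct)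
  case Nil
  then show ?case by (simp add: circuit_unitary_Nil gate_poly.const)
next
  case (snoc p arch)
  obtain a b where p: "p = (a, b)" by (cases p)
  have e: "gate_poly (Suc (length arch)) (\<lambda>gs. embed_gate n p (gs (length arch)) $$ (x, z))" if "z < 2^n" for z
    unfolding p embed_gate_entry[OF snoc.prems(1) that] by (cases "agree_off n a b x z") (auto intro: gate_poly.intros)
  have "gate_poly (Suc (length arch)) (\<lambda>gs. \<Sum>z<2^n. embed_gate n p (gs (length arch)) $$ (x, z) * circuit_unitary n arch gs $$ (z, y))"
    using snoc by (intro gate_poly_sum gate_poly.mult e gate_poly_mono[OF snoc.IH]) auto
  then show ?case unfolding circuit_unitary_snoc
    by (subst mat_mult_entry[where N="2^n" and M="2^n"]) (use snoc.prems in auto)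
qed

lemma coset_angles_cong: "(\<And>j. j < 9 \<Longrightarrow> t j = t' j) \<Longrightarrow> coset_angles t = coset_angles t'"
  and su2_angles_cong: "(\<And>j. j < 3 \<Longrightarrow> t j = t' j) \<Longrightarrow> su2_angles t = su2_angles t'"
  by (simp_all add: coset_angles_def su2_angles_def)

definition circuit_param :: "nat \<Rightarrow> (nat \<times> nat) list \<Rightarrow> (nat \<Rightarrow> real) \<Rightarrow> complex Matrix.mat" where
  "circuit_param n arch \<theta> = local_op n (\<lambda>i. su2_angles (\<lambda>j. \<theta> (9 * length arch + (3 * (i - 1) + j)))) *
     circuit_unitary n arch (\<lambda>i. coset_angles (\<lambda>j. \<theta> (9 * i + j)))"

lemma trig_poly_circuit_param:
  assumes "x < 2^n" "y < 2^n"
  shows "trig_poly (9 * length arch + 3 * n) (n * 2 + length arch * 8) (\<lambda>\<theta>. circuit_param n arch \<theta> $$ (x, y))"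
  unfolding circuit_param_def
proof (rule trig_poly_mat_mult[where N="2^n"])
  let ?m = "9 * length arch + 3 * n"
  fix x y :: nat assume xy: "x < 2^n" "y < 2^n"
  have "trig_poly ?m (card {1..n} * 2) (\<lambda>\<theta>. \<Prod>i\<in>{1..n}.
      su2_angles (\<lambda>j. \<theta> (9 * length arch + (3 * (i - 1) + j))) (bit x (i - 1)) (bit y (i - 1)))"
    by (intro trig_poly_prod trig_poly_su2_angles) auto
  then show "trig_poly ?m (n * 2) (\<lambda>\<theta>. local_op n (\<lambda>i. su2_angles (\<lambda>j. \<theta> (9 * length arch + (3 * (i - 1) + j)))) $$ (x, y))"
    using xy by (simp add: local_op_def)
  show "trig_poly ?m (length arch * 8) (\<lambda>\<theta>. circuit_unitary n arch (\<lambda>i. coset_angles (\<lambda>j. \<theta> (9 * i + j))) $$ (x, y))"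
    by (intro trig_poly_circuit trig_poly_coset_angles xy) auto
qed (use assms in auto)

lemma circuit_in_param:
  assumes "wf_arch n arch" "\<And>i. i < length arch \<Longrightarrow> gs i \<in> SU4"
  shows "\<exists>\<theta>. circuit_unitary n arch gs = circuit_param n arch \<theta>"
proof -
  obtain k t where kt: "\<And>i. k i \<in> SU2" "circuit_unitary n arch gs = local_op n k * circuit_unitary n arch (\<lambda>i. coset_angles (t i))"
    using circuit_gauge_fix[of n arch gs, OF assms(1)] assms(2) by blast
  have "\<forall>i. \<exists>u. k i = su2_angles u" using SU2_angles kt(1) by metis
  then obtain u where u: "\<And>i. k i = su2_angles (u i)" by metis
  let ?r = "length arch"
  define \<theta> where "\<theta> i = (if i < 9 * ?r then t (i div 9) (i mod 9) else u (Suc ((i - 9 * ?r) div 3)) ((i - 9 * ?r) mod 3))" for i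
  have "coset_angles (\<lambda>j. \<theta> (9 * i + j)) = coset_angles (t i)" if "i < ?r" for i
  proof -
    have "\<theta> (9 * i + j) = t i j" if "j < 9" for j
    proof -
      have "9 * i + j < 9 * ?r" using \<open>i < ?r\<close> that by linarith
      then show ?thesis using that by (simp add: \<theta>_def)
    qed
    then show ?thesis by (rule coset_angles_cong)
  qed
  then have c: "circuit_unitary n arch (\<lambda>i. coset_angles (\<lambda>j. \<theta> (9 * i + j))) = circuit_unitary n arch (\<lambda>i. coset_angles (t i))"
    by (intro circuit_unitary_cong)
  have "su2_angles (\<lambda>j. \<theta> (9 * ?r + (3 * (i - 1) + j))) = k i" if "i \<in> {1..n}" for i
  proof -
    have "\<theta> (9 * ?r + (3 * (i - 1) + j)) = u i j" if "j < 3" for j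
      using that \<open>i \<in> {1..n}\<close> by (simp add: \<theta>_def)
    then show ?thesis unfolding u by (rule su2_angles_cong)
  qed
  then have "local_op n (\<lambda>i. su2_angles (\<lambda>j. \<theta> (9 * ?r + (3 * (i - 1) + j)))) = local_op n k"
    unfolding local_op_def by (intro cong_mat) auto
  then have "circuit_unitary n arch gs = circuit_param n arch \<theta>" unfolding kt(2) circuit_param_def c by simp
  then show ?thesis by (intro exI[of _ \<theta>])
qed

section \<open>Polynomials in the matrix entries\<close>

inductive mat_poly :: "nat \<Rightarrow> nat \<Rightarrow> (complex Matrix.mat \<Rightarrow> complex) \<Rightarrow> bool" for N c where
  const: "mat_poly N c (\<lambda>_. z)"
| entry: "i < N \<Longrightarrow> j < c \<Longrightarrow> mat_poly N c (\<lambda>M. M $$ (i, j))"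
| cnj_entry: "i < N \<Longrightarrow> j < c \<Longrightarrow> mat_poly N c (\<lambda>M. cnj (M $$ (i, j)))"
| add: "mat_poly N c f \<Longrightarrow> mat_poly N c g \<Longrightarrow> mat_poly N c (\<lambda>M. f M + g M)"
| mult: "mat_poly N c f \<Longrightarrow> mat_poly N c g \<Longrightarrow> mat_poly N c (\<lambda>M. f M * g M)"

lemma mat_poly_sum: "finite I \<Longrightarrow> (\<And>i. i \<in> I \<Longrightarrow> mat_poly N c (f i)) \<Longrightarrow> mat_poly N c (\<lambda>M. \<Sum>i\<in>I. f i M)"
  by (induction I rule: finite_induct) (auto intro: mat_poly.intros)

lemma mat_poly_prod: "finite I \<Longrightarrow> (\<And>i. i \<in> I \<Longrightarrow> mat_poly N c (f i)) \<Longrightarrow> mat_poly N c (\<lambda>M. \<Prod>i\<in>I. f i M)"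
  by (induction I rule: finite_induct) (auto intro: mat_poly.intros)

lemma mat_poly_power: "mat_poly N c f \<Longrightarrow> mat_poly N c (\<lambda>M. f M ^ k)"
  by (induction k) (auto intro: mat_poly.intros)

lemma mat_poly_cong_columns:
  assumes "mat_poly N c f" "\<And>i j. i < N \<Longrightarrow> j < c \<Longrightarrow> A $$ (i, j) = B $$ (i, j)"
  shows "f A = f B"
  using assms by (induction rule: mat_poly.induct) auto

lemma mat_poly_left_mult:
  assumes "mat_poly N c f" "c \<le> N" "S \<in> carrier_mat N N"
  shows "\<exists>g. mat_poly N c g \<and> (\<forall>M\<in>carrier_mat N N. g M = f (S * M))"
  using assms(1)
proof (induction rule: mat_poly.induct)
  case (const z)
  then show ?case by (intro exI[of _ "\<lambda>_. z"]) (auto intro: mat_poly.const)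
next
  case (entry i j)
  then show ?case using assms(2,3)
    by (intro exI[of _ "\<lambda>M. \<Sum>z<N. S $$ (i, z) * M $$ (z, j)"])
       (auto simp: mat_mult_entry simp del: index_mult_mat intro!: mat_poly_sum mat_poly.mult mat_poly.const mat_poly.entry)
next
  case (cnj_entry i j)
  then show ?case using assms(2,3)
    by (intro exI[of _ "\<lambda>M. \<Sum>z<N. cnj (S $$ (i, z)) * cnj (M $$ (z, j))"])
       (auto simp: mat_mult_entry simp del: index_mult_mat intro!: mat_poly_sum mat_poly.mult mat_poly.const mat_poly.cnj_entry)
next
  case (add f1 f2)
  then obtain g1 g2 where "mat_poly N c g1" "mat_poly N c g2" "\<forall>M\<in>carrier_mat N N. g1 M = f1 (S * M)" "\<forall>M\<in>carrier_mat N N. g2 M = f2 (S * M)"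
    by blast
  then show ?case by (intro exI[of _ "\<lambda>M. g1 M + g2 M"]) (auto intro: mat_poly.add)
next
  case (mult f1 f2)
  then obtain g1 g2 where "mat_poly N c g1" "mat_poly N c g2" "\<forall>M\<in>carrier_mat N N. g1 M = f1 (S * M)" "\<forall>M\<in>carrier_mat N N. g2 M = f2 (S * M)"
    by blast
  then show ?case by (intro exI[of _ "\<lambda>M. g1 M * g2 M"]) (auto intro: mat_poly.mult)
qed

lemma mat_poly_trig_poly:
  assumes "mat_poly N c f" "\<And>x y. x < N \<Longrightarrow> y < c \<Longrightarrow> trig_poly m d (\<lambda>\<theta>. p \<theta> $$ (x, y))"
  shows "\<exists>e. trig_poly m e (\<lambda>\<theta>. f (p \<theta>))"
  using assms(1)
proof (induction rule: mat_poly.induct)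
  case (add f g)
  then obtain d d' where d: "trig_poly m d (\<lambda>\<theta>. f (p \<theta>))" "trig_poly m d' (\<lambda>\<theta>. g (p \<theta>))" by blast
  show ?case using trig_poly.add[OF trig_poly_mono[OF d(1) max.cobounded1] trig_poly_mono[OF d(2) max.cobounded2]] by blast
next
  case (mult f g)
  then show ?case using trig_poly_mult by blast
next
  case (cnj_entry i j)
  then show ?case using trig_poly_cnj[OF assms(2)] by blast
qed (auto intro: trig_poly_const assms(2))

lemma mat_poly_gate_poly:
  assumes "mat_poly N c f" "\<And>x y. x < N \<Longrightarrow> y < c \<Longrightarrow> gate_poly R (\<lambda>gs. F gs $$ (x, y))"
  shows "gate_poly R (\<lambda>gs. f (F gs))"
  using assms by (induction rule: mat_poly.induct) (auto intro: gate_poly.intros gate_poly_cnj)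

section \<open>Algebraic independence on a set\<close>

definition exponents :: "nat \<Rightarrow> nat \<Rightarrow> (nat \<Rightarrow> nat) set" where
  "exponents j d = PiE {..<j} (\<lambda>_. {..d})"

lemma finite_exponents [simp]: "finite (exponents j d)" and card_exponents: "card (exponents j d) = (d + 1) ^ j"
  by (auto simp: exponents_def card_PiE intro!: finite_PiE)

definition alg_indep :: "'a set \<Rightarrow> (nat \<Rightarrow> 'a \<Rightarrow> complex) \<Rightarrow> nat \<Rightarrow> bool" where
  "alg_indep X P j \<longleftrightarrow> (\<forall>d c. (\<forall>x\<in>X. (\<Sum>k\<in>exponents j d. c k * (\<Prod>l<j. P l x ^ k l)) = 0) \<longrightarrow> (\<forall>k\<in>exponents j d. c k = 0))"

lemma alg_indepD:
  "alg_indep X P j \<Longrightarrow> (\<And>x. x \<in> X \<Longrightarrow> (\<Sum>k\<in>exponents j d. c k * (\<Prod>l<j. P l x ^ k l)) = 0) \<Longrightarrow> k \<in> exponents j d \<Longrightarrow> c k = 0"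
  unfolding alg_indep_def by blast

lemma alg_indep_0: "X \<noteq> {} \<Longrightarrow> alg_indep X P 0"
  by (auto simp: alg_indep_def exponents_def)

lemma sum_exponents_Suc:
  "(\<Sum>k\<in>exponents (Suc j) d. c k * (\<Prod>l<Suc j. P l x ^ k l)) =
   (\<Sum>q\<le>d. P j x ^ q * (\<Sum>k\<in>exponents j d. c (k(j := q)) * (\<Prod>l<j. P l x ^ k l)))" for P :: "nat \<Rightarrow> 'a \<Rightarrow> complex"
proof -
  have "exponents (Suc j) d = (\<lambda>(q, k). k(j := q)) ` ({..d} \<times> exponents j d)"
    unfolding exponents_def lessThan_Suc by (rule PiE_insert_eq)
  moreover have "inj_on (\<lambda>(q, k). k(j := q)) ({..d} \<times> exponents j d)"
    unfolding exponents_def by (rule inj_combinator) auto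
  ultimately have "(\<Sum>k\<in>exponents (Suc j) d. c k * (\<Prod>l<Suc j. P l x ^ k l)) =
     (\<Sum>(q, k)\<in>{..d} \<times> exponents j d. c (k(j := q)) * (\<Prod>l<Suc j. P l x ^ (k(j := q)) l))"
    by (simp add: sum.reindex case_prod_unfold)
  also have "\<dots> = (\<Sum>(q, k)\<in>{..d} \<times> exponents j d. P j x ^ q * (c (k(j := q)) * (\<Prod>l<j. P l x ^ k l)))"
    by (intro sum.cong) (auto simp: mult_ac)
  finally show ?thesis by (simp add: sum.cartesian_product[symmetric] sum_distrib_left)
qed

text \<open>On Y only the part of a relation without P j survives, so that part is trivial; then a factor P j cancels.\<close>

lemma alg_indep_extend:
  assumes ind: "alg_indep Y P j" and YX: "Y \<subseteq> X" and van: "\<And>x. x \<in> Y \<Longrightarrow> P j x = 0"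
    and cancel: "\<And>d e c. (\<And>x. x \<in> X \<Longrightarrow> P j x * (\<Sum>q\<le>e. P j x ^ q * (\<Sum>k\<in>exponents j d. c q k * (\<Prod>l<j. P l x ^ k l))) = 0)
       \<Longrightarrow> (\<And>x. x \<in> X \<Longrightarrow> (\<Sum>q\<le>e. P j x ^ q * (\<Sum>k\<in>exponents j d. c q k * (\<Prod>l<j. P l x ^ k l))) = 0)"
  shows "alg_indep X P (Suc j)"
proof -
  have claim: "\<forall>q\<le>e. \<forall>k\<in>exponents j d. c q k = 0"
    if "\<And>x. x \<in> X \<Longrightarrow> (\<Sum>q\<le>e. P j x ^ q * (\<Sum>k\<in>exponents j d. c q k * (\<Prod>l<j. P l x ^ k l))) = 0" for d e c
    using that
  proof (induction e arbitrary: c)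
    case 0
    then have "(\<Sum>k\<in>exponents j d. c 0 k * (\<Prod>l<j. P l x ^ k l)) = 0" if "x \<in> Y" for x
      using that YX by fastforce
    then show ?case using alg_indepD[OF ind] by auto
  next
    case (Suc e)
    have sp: "(\<Sum>q\<le>Suc e. P j x ^ q * (\<Sum>k\<in>exponents j d. c q k * (\<Prod>l<j. P l x ^ k l))) =
       (\<Sum>k\<in>exponents j d. c 0 k * (\<Prod>l<j. P l x ^ k l)) + P j x * (\<Sum>q\<le>e. P j x ^ q * (\<Sum>k\<in>exponents j d. c (Suc q) k * (\<Prod>l<j. P l x ^ k l)))" for x
      by (subst sum.atMost_Suc_shift) (simp add: sum_distrib_left mult.assoc)
    have "(\<Sum>k\<in>exponents j d. c 0 k * (\<Prod>l<j. P l x ^ k l)) = 0" if "x \<in> Y" for x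
      using Suc.prems[of x] that YX van[OF that] unfolding sp by auto
    then have c0: "\<forall>k\<in>exponents j d. c 0 k = 0" using alg_indepD[OF ind] by blast
    then have "P j x * (\<Sum>q\<le>e. P j x ^ q * (\<Sum>k\<in>exponents j d. c (Suc q) k * (\<Prod>l<j. P l x ^ k l))) = 0" if "x \<in> X" for x
      using Suc.prems[OF that] unfolding sp by simp
    from cancel[OF this] have "\<forall>q\<le>e. \<forall>k\<in>exponents j d. c (Suc q) k = 0" by (rule Suc.IH)
    then show ?case using c0 by (metis Suc_le_mono not0_implies_Suc)
  qed
  show ?thesis unfolding alg_indep_def
  proof (intro allI impI ballI)
    fix d c k assume *: "\<forall>x\<in>X. (\<Sum>k\<in>exponents (Suc j) d. c k * (\<Prod>l<Suc j. P l x ^ k l)) = 0" and k: "k \<in> exponents (Suc j) d"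
    have "\<forall>q\<le>d. \<forall>k\<in>exponents j d. c (k(j := q)) = 0"
      using * unfolding sum_exponents_Suc by (intro claim) auto
    moreover have "k \<in> (\<lambda>(q, k). k(j := q)) ` ({..d} \<times> exponents j d)"
      using k unfolding exponents_def lessThan_Suc PiE_insert_eq .
    ultimately show "c k = 0" by auto
  qed
qed

lemma alg_indep_coordinates: "alg_indep UNIV (\<lambda>l \<tau>. complex_of_real (\<tau> l)) j"
proof (induction j)
  case 0
  then show ?case by (rule alg_indep_0) simp
next
  case (Suc j)
  show ?case
  proof (rule alg_indep_extend[where Y="{\<tau>. \<tau> j = 0}"])
    show "alg_indep {\<tau>. \<tau> j = 0} (\<lambda>l \<tau>. complex_of_real (\<tau> l)) j"
      unfolding alg_indep_def
    proof (intro allI impI ballI)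
      fix d c k assume *: "\<forall>\<tau>\<in>{\<tau>. \<tau> j = 0}. (\<Sum>k\<in>exponents j d. c k * (\<Prod>l<j. complex_of_real (\<tau> l) ^ k l)) = 0" and k: "k \<in> exponents j d"
      show "c k = 0"
      proof (rule alg_indepD[OF Suc _ k])
        fix \<tau> :: "nat \<Rightarrow> real"
        have "(\<Sum>k\<in>exponents j d. c k * (\<Prod>l<j. complex_of_real ((\<tau>(j := 0)) l) ^ k l)) = 0"
          using bspec[OF *, of "\<tau>(j := 0)"] by simp
        then show "(\<Sum>k\<in>exponents j d. c k * (\<Prod>l<j. complex_of_real (\<tau> l) ^ k l)) = 0" by simp
      qed
    qed
    fix d e c and \<tau> :: "nat \<Rightarrow> real"
    let ?h = "\<lambda>\<tau>. (\<Sum>q\<le>e. complex_of_real (\<tau> j) ^ q * (\<Sum>k\<in>exponents j d. c q k * (\<Prod>l<j. complex_of_real (\<tau> l) ^ k l)))"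
    assume z: "\<And>\<tau>. \<tau> \<in> UNIV \<Longrightarrow> complex_of_real (\<tau> j) * ?h \<tau> = 0"
    let ?g = "\<lambda>s. ?h (\<tau>(j := s))"
    have g: "?g = (\<lambda>s. \<Sum>q\<le>e. complex_of_real s ^ q * (\<Sum>k\<in>exponents j d. c q k * (\<Prod>l<j. complex_of_real (\<tau> l) ^ k l)))"
      by (intro ext sum.cong arg_cong2[where f="(*)"] prod.cong) auto
    have c: "isCont ?g (\<tau> j)" unfolding g by (intro continuous_intros)
    have g0: "?g s = 0" if "s \<noteq> 0" for s using z[of "\<tau>(j := s)"] that by simp
    show "?h \<tau> = 0"
    proof (cases "\<tau> j = 0")
      case False
      then show ?thesis using z[of \<tau>] by simp
    next
      case True
      have "(?g \<longlongrightarrow> ?g (\<tau> j)) (at (\<tau> j))" using c by (simp only: isCont_def)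
      moreover have "eventually (\<lambda>s. ?g s = 0) (at (\<tau> j))"
        using True by (intro eventually_mono[OF eventually_neq_at_within[of "\<tau> j" "\<tau> j" UNIV]] g0) simp
      then have "(?g \<longlongrightarrow> 0) (at (\<tau> j))" by (rule tendsto_eventually)
      ultimately have "?g (\<tau> j) = 0" by (rule tendsto_unique[OF trivial_limit_at])
      then show ?thesis by simp
    qed
  qed auto
qed

text \<open>The lowest homogeneous part of a relation would be a relation between the coordinates themselves.\<close>

lemma alg_indep_first_order:
  fixes Z :: "(nat \<Rightarrow> real) \<Rightarrow> 'a"
  assumes lim: "\<And>\<tau> l. l < j \<Longrightarrow> ((\<lambda>\<epsilon>. y l (Z (\<lambda>i. \<epsilon> * \<tau> i)) / complex_of_real \<epsilon>) \<longlongrightarrow> complex_of_real (\<tau> l)) (at 0)"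
  shows "alg_indep (range Z) y j"
  unfolding alg_indep_def
proof (intro allI impI, rule ccontr)
  fix d c assume rel: "\<forall>x\<in>range Z. (\<Sum>k\<in>exponents j d. c k * (\<Prod>l<j. y l x ^ k l)) = 0" and "\<not> (\<forall>k\<in>exponents j d. c k = 0)"
  define deg where "deg k = (\<Sum>l<j. k l)" for k :: "nat \<Rightarrow> nat"
  let ?S = "{k \<in> exponents j d. c k \<noteq> 0}"
  have "?S \<noteq> {}" using \<open>\<not> (\<forall>k\<in>exponents j d. c k = 0)\<close> by auto
  then obtain k0 where k0: "k0 \<in> ?S" "\<And>k. k \<in> ?S \<Longrightarrow> deg k0 \<le> deg k"
  proof -
    have fin: "finite (deg ` ?S)" by simp
    then have "Min (deg ` ?S) \<in> deg ` ?S" using \<open>?S \<noteq> {}\<close> by (intro Min_in) auto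
    then obtain k where "k \<in> ?S" "deg k = Min (deg ` ?S)" by auto
    then show thesis using that[of k] Min_le[OF fin] by simp
  qed
  let ?\<kappa> = "deg k0"
  define c' where "c' k = (if deg k = ?\<kappa> then c k else 0)" for k
  have "(\<Sum>k\<in>exponents j d. c' k * (\<Prod>l<j. complex_of_real (\<tau> l) ^ k l)) = 0" for \<tau>
  proof -
    let ?f = "\<lambda>k \<epsilon>. c k * (complex_of_real \<epsilon> ^ (deg k - ?\<kappa>) * (\<Prod>l<j. (y l (Z (\<lambda>i. \<epsilon> * \<tau> i)) / complex_of_real \<epsilon>) ^ k l))"
    have t: "(?f k \<longlongrightarrow> c' k * (\<Prod>l<j. complex_of_real (\<tau> l) ^ k l)) (at 0)" if "k \<in> exponents j d" for k
    proof (cases "c k = 0")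
      case False
      then have "?\<kappa> \<le> deg k" using k0(2) that by auto
      have l1: "((\<lambda>\<epsilon>. complex_of_real \<epsilon> ^ (deg k - ?\<kappa>)) \<longlongrightarrow> complex_of_real 0 ^ (deg k - ?\<kappa>)) (at 0)"
        by (intro tendsto_intros)
      have "complex_of_real 0 ^ (deg k - ?\<kappa>) = (if deg k = ?\<kappa> then 1 else 0)" using \<open>?\<kappa> \<le> deg k\<close> by auto
      moreover have "(?f k \<longlongrightarrow> c k * (complex_of_real 0 ^ (deg k - ?\<kappa>) * (\<Prod>l<j. complex_of_real (\<tau> l) ^ k l))) (at 0)"
        by (intro tendsto_mult tendsto_const l1 tendsto_prod tendsto_power lim) auto
      ultimately show ?thesis by (simp add: c'_def split: if_splits)
    qed (simp add: c'_def)
    have "((\<lambda>\<epsilon>. \<Sum>k\<in>exponents j d. ?f k \<epsilon>) \<longlongrightarrow> (\<Sum>k\<in>exponents j d. c' k * (\<Prod>l<j. complex_of_real (\<tau> l) ^ k l))) (at 0)"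
      by (intro tendsto_sum t)
    moreover have "(\<Sum>k\<in>exponents j d. ?f k \<epsilon>) = 0" if "\<epsilon> \<noteq> 0" for \<epsilon> :: real
    proof -
      let ?e = "complex_of_real \<epsilon>" and ?x = "Z (\<lambda>i. \<epsilon> * \<tau> i)"
      have e: "?e \<noteq> 0" using that by simp
      have "?e ^ ?\<kappa> * ?f k \<epsilon> = c k * (\<Prod>l<j. y l ?x ^ k l)" if "k \<in> exponents j d" for k
      proof (cases "c k = 0")
        case False
        then have "?\<kappa> \<le> deg k" using k0(2) that by auto
        then have p: "?e ^ ?\<kappa> * ?e ^ (deg k - ?\<kappa>) = ?e ^ deg k" by (simp add: power_add[symmetric])
        have "(\<Prod>l<j. (y l ?x / ?e) ^ k l) = (\<Prod>l<j. y l ?x ^ k l) / ?e ^ deg k"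
          by (simp add: power_divide prod_dividef deg_def power_sum)
        then have "?e ^ ?\<kappa> * ?f k \<epsilon> = c k * ((?e ^ ?\<kappa> * ?e ^ (deg k - ?\<kappa>)) * ((\<Prod>l<j. y l ?x ^ k l) / ?e ^ deg k))" by (simp only: mult_ac)
        then show ?thesis unfolding p using e by simp
      qed simp
      then have "?e ^ ?\<kappa> * (\<Sum>k\<in>exponents j d. ?f k \<epsilon>) = (\<Sum>k\<in>exponents j d. c k * (\<Prod>l<j. y l ?x ^ k l))"
        unfolding sum_distrib_left by (intro sum.cong) auto
      also have "\<dots> = 0" using rel by blast
      finally show ?thesis using e by simp
    qed
    then have "((\<lambda>\<epsilon>. \<Sum>k\<in>exponents j d. ?f k \<epsilon>) \<longlongrightarrow> 0) (at 0)"
      by (intro tendsto_eventually) (auto simp: eventually_at intro!: exI[of _ 1])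
    ultimately show ?thesis by (rule tendsto_unique[OF trivial_limit_at])
  qed
  then have "c' k0 = 0" using alg_indepD[OF alg_indep_coordinates] k0(1) by blast
  then show False using k0(1) by (simp add: c'_def)
qed

text \<open>Dimension count: (d+1)^j monomials against (2Ed+1)^m frequencies.\<close>

lemma alg_indep_trig_relation:
  assumes ind: "alg_indep X P j" and tp: "\<And>l. l < j \<Longrightarrow> \<exists>e. trig_poly m e (\<lambda>\<theta>. P l (p \<theta>))" and "m < j"
  obtains c d x where "\<And>\<theta>. (\<Sum>k\<in>exponents j d. c k * (\<Prod>l<j. P l (p \<theta>) ^ k l)) = 0"
    "x \<in> X" "(\<Sum>k\<in>exponents j d. c k * (\<Prod>l<j. P l x ^ k l)) \<noteq> 0"
proof -
  obtain e where e: "\<And>l. l < j \<Longrightarrow> trig_poly m (e l) (\<lambda>\<theta>. P l (p \<theta>))" using tp by metis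
  define E where "E = (\<Sum>l<j. e l)"
  define d where "d = (2 * E + 1) ^ m"
  have pw: "trig_poly m (d * e l) (\<lambda>\<theta>. P l (p \<theta>) ^ q)" if "l < j" "q \<le> d" for l q
  proof -
    have "trig_poly m (card {..<q} * e l) (\<lambda>\<theta>. \<Prod>i<q. P l (p \<theta>))" by (intro trig_poly_prod e that) auto
    then have "trig_poly m (q * e l) (\<lambda>\<theta>. P l (p \<theta>) ^ q)" by simp
    then show ?thesis by (rule trig_poly_mono) (use that in simp)
  qed
  have pr: "trig_poly m (d * (\<Sum>l<i. e l)) (\<lambda>\<theta>. \<Prod>l<i. P l (p \<theta>) ^ k l)" if "k \<in> exponents j d" "i \<le> j" for k i
    using that(2)
  proof (induction i)
    case (Suc i)
    have "k i \<le> d" using that(1) Suc.prems by (auto simp: exponents_def PiE_iff)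
    then show ?case using trig_poly_mult[OF Suc.IH pw[of i "k i"]] Suc.prems by (simp add: distrib_left)
  qed (simp add: trig_poly_const)
  have "\<forall>k\<in>exponents j d. \<exists>a. \<forall>\<theta>. (\<Prod>l<j. P l (p \<theta>) ^ k l) = (\<Sum>f\<in>freqs m (d * E). a f * cis (\<Sum>i<m. of_int (f i) * \<theta> i))"
    using trig_poly_expansion[OF pr[of _ j]] unfolding E_def by blast
  from bchoice[OF this] obtain a where a: "\<forall>k\<in>exponents j d. \<forall>\<theta>. (\<Prod>l<j. P l (p \<theta>) ^ k l) = (\<Sum>f\<in>freqs m (d * E). a k f * cis (\<Sum>i<m. of_int (f i) * \<theta> i))" ..
  have "(2 * (d * E) + 1) ^ m \<le> ((2 * E + 1) * (d + 1)) ^ m" by (intro power_mono) auto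
  also have "\<dots> = d * (d + 1) ^ m" by (simp only: power_mult_distrib d_def)
  also have "\<dots> < (d + 1) ^ Suc m" by simp
  also have "\<dots> \<le> (d + 1) ^ j" using \<open>m < j\<close> by (intro power_increasing) auto
  finally have "card (freqs m (d * E)) < card (exponents j d)" by (simp add: card_freqs card_exponents)
  from linear_system_nontrivial[OF finite_freqs finite_exponents this, of a] obtain c where
    c: "\<exists>k\<in>exponents j d. c k \<noteq> 0" "\<And>f. f \<in> freqs m (d * E) \<Longrightarrow> (\<Sum>k\<in>exponents j d. c k * a k f) = 0" by blast
  have "(\<Sum>k\<in>exponents j d. c k * (\<Prod>l<j. P l (p \<theta>) ^ k l)) = 0" for \<theta>
  proof -
    have "(\<Sum>k\<in>exponents j d. c k * (\<Prod>l<j. P l (p \<theta>) ^ k l)) =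
        (\<Sum>k\<in>exponents j d. \<Sum>f\<in>freqs m (d * E). c k * a k f * cis (\<Sum>i<m. of_int (f i) * \<theta> i))"
      by (intro sum.cong) (auto simp: a sum_distrib_left mult.assoc)
    also have "\<dots> = (\<Sum>f\<in>freqs m (d * E). (\<Sum>k\<in>exponents j d. c k * a k f) * cis (\<Sum>i<m. of_int (f i) * \<theta> i))"
      by (subst sum.swap) (simp add: sum_distrib_right)
    also have "\<dots> = 0" by (simp add: c(2))
    finally show ?thesis .
  qed
  moreover have "\<exists>x\<in>X. (\<Sum>k\<in>exponents j d. c k * (\<Prod>l<j. P l x ^ k l)) \<noteq> 0"
    using c(1) alg_indepD[OF ind, where d=d and c=c] by blast
  ultimately show ?thesis using that by blast
qed

section \<open>Pauli strings and causal slices\<close>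

definition pauli_sign :: "nat \<Rightarrow> nat \<Rightarrow> nat \<Rightarrow> complex" where
  "pauli_sign n v y = (\<Prod>k<n. if bit v k \<and> bit y k then - 1 else 1)"

definition pauli :: "nat \<Rightarrow> nat \<Rightarrow> nat \<Rightarrow> complex Matrix.mat" where
  "pauli n u v = Matrix.mat (2^n) (2^n) (\<lambda>(x, y). if x = xor y u then pauli_sign n v y else 0)"

lemma pauli_carrier [simp]: "pauli n u v \<in> carrier_mat (2^n) (2^n)"
  by (simp add: pauli_def)

lemma pauli_sign_xor_left: "pauli_sign n (xor v v') y = pauli_sign n v y * pauli_sign n v' y"
  unfolding pauli_sign_def prod.distrib[symmetric] by (intro prod.cong) (auto simp: bit_xor_iff)

lemma pauli_sign_commute: "pauli_sign n v y = pauli_sign n y v"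
  unfolding pauli_sign_def by (intro prod.cong) auto

lemma pauli_sign_xor_right: "pauli_sign n v (xor y y') = pauli_sign n v y * pauli_sign n v y'"
  by (metis pauli_sign_commute pauli_sign_xor_left)

lemma pauli_sign_cases: "pauli_sign n v y = 1 \<or> pauli_sign n v y = - 1"
proof -
  have "(\<Prod>k\<in>I. if bit v k \<and> bit y k then - 1 else 1) \<in> {1, - 1 :: complex}" if "finite I" for I
    using that by (induction I rule: finite_induct) auto
  from this[of "{..<n}"] show ?thesis by (simp add: pauli_sign_def)
qed

lemma pauli_sign_square: "pauli_sign n v y * pauli_sign n v y = 1"
  using pauli_sign_cases[of n v y] by auto

lemma pauli_sign_0 [simp]: "pauli_sign n 0 y = 1" "pauli_sign n v 0 = 1"
  by (simp_all add: pauli_sign_def)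

lemma xor_less: "x < 2^n \<Longrightarrow> y < 2^n \<Longrightarrow> xor x y < (2::nat)^n"
  unfolding less_two_power_bit bit_xor_iff by blast

lemma xor_cancel [simp]: "xor (xor x y) y = (x::nat)" "xor y (xor x y) = x"
  by (auto intro!: bit_eqI simp: bit_xor_iff)

lemma pauli_entry: "x < 2^n \<Longrightarrow> y < 2^n \<Longrightarrow> pauli n u v $$ (x, y) = (if x = xor y u then pauli_sign n v y else 0)"
  by (simp add: pauli_def)

lemma pauli_0: "pauli n 0 0 = 1\<^sub>m (2^n)"
  by (intro eq_matI) (auto simp: pauli_def)

lemma pauli_mult:
  assumes "u < 2^n" "u' < 2^n"
  shows "pauli n u v * pauli n u' v' = pauli_sign n v u' \<cdot>\<^sub>m pauli n (xor u u') (xor v v')"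
proof (intro eq_matI)
  fix x y assume "x < dim_row (pauli_sign n v u' \<cdot>\<^sub>m pauli n (xor u u') (xor v v'))" "y < dim_col (pauli_sign n v u' \<cdot>\<^sub>m pauli n (xor u u') (xor v v'))"
  then have xy: "x < 2^n" "y < 2^n" by (auto simp: pauli_def)
  have l: "xor y u' < 2^n" using xy assms xor_less by blast
  have "(pauli n u v * pauli n u' v') $$ (x, y) = (\<Sum>z<2^n. pauli n u v $$ (x, z) * pauli n u' v' $$ (z, y))"
    by (rule mat_mult_entry[where N="2^n" and M="2^n"]) (use xy in auto)
  also have "\<dots> = (\<Sum>z<2^n. if z = xor y u' then pauli n u v $$ (x, xor y u') * pauli_sign n v' y else 0)"
    using xy by (intro sum.cong) (auto simp: pauli_entry)
  also have "\<dots> = pauli n u v $$ (x, xor y u') * pauli_sign n v' y" using l by simp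
  also have "\<dots> = (pauli_sign n v u' \<cdot>\<^sub>m pauli n (xor u u') (xor v v')) $$ (x, y)"
  proof -
    have "xor (xor y u') u = xor y (xor u u')" by (metis xor.assoc xor.commute)
    then show ?thesis using xy l
      by (auto simp: pauli_entry pauli_sign_xor_left pauli_sign_xor_right, auto simp: pauli_def pauli_sign_xor_left)
  qed
  finally show "(pauli n u v * pauli n u' v') $$ (x, y) = (pauli_sign n v u' \<cdot>\<^sub>m pauli n (xor u u') (xor v v')) $$ (x, y)" .
qed (auto simp: pauli_def)

text \<open>The phase making a Pauli string square to -1.\<close>

definition pauli_phase :: "nat \<Rightarrow> nat \<Rightarrow> nat \<Rightarrow> complex" where
  "pauli_phase n u v = (if pauli_sign n v u = 1 then \<i> else 1)"

lemma pauli_phase_square: "pauli_phase n u v * pauli_phase n u v * pauli_sign n v u = - 1"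
  using pauli_sign_cases[of n v u] by (auto simp: pauli_phase_def)

definition mat_rot :: "nat \<Rightarrow> complex Matrix.mat \<Rightarrow> real \<Rightarrow> complex Matrix.mat" where
  "mat_rot N Q t = complex_of_real (cos t) \<cdot>\<^sub>m 1\<^sub>m N + complex_of_real (sin t) \<cdot>\<^sub>m Q"

lemma mat_rot_carrier [simp]: "Q \<in> carrier_mat N N \<Longrightarrow> mat_rot N Q t \<in> carrier_mat N N"
  by (simp add: mat_rot_def)

lemma mat_rot_entry: "Q \<in> carrier_mat N N \<Longrightarrow> x < N \<Longrightarrow> y < N \<Longrightarrow>
  mat_rot N Q t $$ (x, y) = complex_of_real (cos t) * (if x = y then 1 else 0) + complex_of_real (sin t) * Q $$ (x, y)"
  by (auto simp: mat_rot_def)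

lemma smult_smult_mat: "a \<cdot>\<^sub>m (b \<cdot>\<^sub>m A) = (a * b) \<cdot>\<^sub>m (A :: complex Matrix.mat)"
  and smult_one_mat: "1 \<cdot>\<^sub>m A = (A :: complex Matrix.mat)"
  by (auto intro!: eq_matI simp: mult.assoc)

lemma lin_comb_mult:
  fixes A B C D :: "complex Matrix.mat"
  assumes "A \<in> carrier_mat N N" "B \<in> carrier_mat N N" "C \<in> carrier_mat N N" "D \<in> carrier_mat N N"
  shows "(a \<cdot>\<^sub>m A + b \<cdot>\<^sub>m B) * (c \<cdot>\<^sub>m C + d \<cdot>\<^sub>m D) =
    (a * c) \<cdot>\<^sub>m (A * C) + (b * c) \<cdot>\<^sub>m (B * C) + ((a * d) \<cdot>\<^sub>m (A * D) + (b * d) \<cdot>\<^sub>m (B * D))"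
proof -
  have "(x \<cdot>\<^sub>m X) * (y \<cdot>\<^sub>m Y) = (x * y) \<cdot>\<^sub>m (X * Y)" if "X \<in> carrier_mat N N" "Y \<in> carrier_mat N N" for x y and X Y :: "complex Matrix.mat"
    using that by (simp add: mult_smult_assoc_mat[of _ N N _ N] mult_smult_distrib[of _ N N _ N] smult_smult_mat smult_one_mat mult.commute)
  then show ?thesis using assms
    by (simp add: add_mult_distrib_mat[of _ N N _ _ N] mult_add_distrib_mat[of _ N N _ N])
qed

lemma mat_rot_conj:
  fixes Q R :: "complex Matrix.mat"
  assumes Q: "Q \<in> carrier_mat N N" and R: "R \<in> carrier_mat N N"
    and QQ: "Q * Q = (-1) \<cdot>\<^sub>m 1\<^sub>m N" and anti: "R * Q = (-1) \<cdot>\<^sub>m (Q * R)"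
  shows "mat_rot N Q (pi/4) * mat_rot N R t * mat_rot N Q (- (pi/4)) = mat_rot N (Q * R) t"
proof -
  let ?s = "complex_of_real (sqrt 2 / 2)" and ?c = "complex_of_real (cos t)" and ?d = "complex_of_real (sin t)"
  have ss: "?s * ?s = 1/2" by (simp add: field_simps flip: of_real_mult)
  have QR: "Q * R \<in> carrier_mat N N" using Q R by simp
  have QRQ: "(Q * R) * Q = R"
  proof -
    have "(Q * R) * Q = Q * (R * Q)" by (rule assoc_mult_mat[OF Q R Q])
    also have "\<dots> = (-1) \<cdot>\<^sub>m (Q * (Q * R))" unfolding anti by (rule mult_smult_distrib[OF Q QR])
    also have "Q * (Q * R) = (Q * Q) * R" by (rule assoc_mult_mat[OF Q Q R, symmetric])
    also have "\<dots> = (-1) \<cdot>\<^sub>m R" unfolding QQ using R by (simp add: mult_smult_assoc_mat[of _ N N _ N])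
    finally show ?thesis by (simp add: smult_smult_mat smult_one_mat)
  qed
  have m1: "mat_rot N Q (pi/4) * mat_rot N R t =
     ((?s * ?c) \<cdot>\<^sub>m 1\<^sub>m N + (?s * ?c) \<cdot>\<^sub>m Q) + ((?s * ?d) \<cdot>\<^sub>m R + (?s * ?d) \<cdot>\<^sub>m (Q * R))"
    unfolding mat_rot_def cos_45 sin_45 using Q R by (subst lin_comb_mult[of _ N]) auto
  let ?A = "(?s * ?c) \<cdot>\<^sub>m 1\<^sub>m N + (?s * ?c) \<cdot>\<^sub>m Q" and ?B = "(?s * ?d) \<cdot>\<^sub>m R + (?s * ?d) \<cdot>\<^sub>m (Q * R)"
  have m2: "mat_rot N Q (- (pi/4)) = ?s \<cdot>\<^sub>m 1\<^sub>m N + (- ?s) \<cdot>\<^sub>m Q"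
    unfolding mat_rot_def cos_minus sin_minus cos_45 sin_45 by simp
  have A: "?A * mat_rot N Q (- (pi/4)) = (?s*?c*?s) \<cdot>\<^sub>m 1\<^sub>m N + (?s*?c*?s) \<cdot>\<^sub>m Q + ((- (?s*?c*?s)) \<cdot>\<^sub>m Q + (- (?s*?c*?s)) \<cdot>\<^sub>m (Q * Q))"
    unfolding m2 using Q R by (subst lin_comb_mult[of _ N]) auto
  have B: "?B * mat_rot N Q (- (pi/4)) = (?s*?d*?s) \<cdot>\<^sub>m R + (?s*?d*?s) \<cdot>\<^sub>m (Q * R) + ((- (?s*?d*?s)) \<cdot>\<^sub>m (R * Q) + (- (?s*?d*?s)) \<cdot>\<^sub>m (Q * R * Q))"
    unfolding m2 using Q R QR by (subst lin_comb_mult[of _ N]) auto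
  have k: "?s*?c*?s = ?c/2" "?s*?d*?s = ?d/2" using ss by (simp_all add: mult.commute mult.left_commute)
  have "mat_rot N Q (pi/4) * mat_rot N R t * mat_rot N Q (- (pi/4)) = ?A * mat_rot N Q (- (pi/4)) + ?B * mat_rot N Q (- (pi/4))"
    unfolding m1 by (rule add_mult_distrib_mat[of _ N N _ _ N]) (use Q R QR in auto)
  also have "\<dots> = mat_rot N (Q * R) t"
    unfolding A B unfolding k QQ anti QRQ mat_rot_def
    by (rule eq_matI) (use Q R QR in \<open>auto simp del: index_mult_mat(1)\<close>)
  finally show ?thesis .
qed

definition preserving :: "nat \<Rightarrow> nat \<Rightarrow> complex Matrix.mat set \<Rightarrow> complex Matrix.mat set" where
  "preserving N c X = {S \<in> carrier_mat N N. \<forall>f. mat_poly N c f \<longrightarrow> (\<forall>x\<in>X. f x = 0) \<longrightarrow> (\<forall>x\<in>X. f (S * x) = 0)}"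

lemma preserving_one: "X \<subseteq> carrier_mat N N \<Longrightarrow> 1\<^sub>m N \<in> preserving N c X"
  by (auto simp: preserving_def subset_iff)

lemma preserving_mult:
  assumes "X \<subseteq> carrier_mat N N" "c \<le> N" and S: "S \<in> preserving N c X" and S': "S' \<in> preserving N c X"
  shows "S * S' \<in> preserving N c X"
proof -
  have c: "S \<in> carrier_mat N N" "S' \<in> carrier_mat N N" using S S' by (auto simp: preserving_def)
  have "f (S * S' * x) = 0" if f: "mat_poly N c f" "\<forall>x\<in>X. f x = 0" and x: "x \<in> X" for f x
  proof -
    obtain g where g: "mat_poly N c g" "\<And>M. M \<in> carrier_mat N N \<Longrightarrow> g M = f (S * M)"
      using mat_poly_left_mult[OF f(1) assms(2) c(1)] by blast
    have xc: "x \<in> carrier_mat N N" using x assms(1) by auto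
    have "\<forall>x\<in>X. g x = 0" using S f g(2) assms(1) by (auto simp: preserving_def subset_iff)
    then have "g (S' * x) = 0" using S' g(1) x by (auto simp: preserving_def)
    moreover have "S' * x \<in> carrier_mat N N" using c xc by simp
    ultimately show ?thesis using g(2)[of "S' * x"] assoc_mult_mat[OF c xc] by simp
  qed
  then show ?thesis using c by (auto simp: preserving_def)
qed

definition pauli_rot :: "nat \<Rightarrow> nat \<Rightarrow> nat \<Rightarrow> real \<Rightarrow> complex Matrix.mat" where
  "pauli_rot n u v t = mat_rot (2^n) (pauli_phase n u v \<cdot>\<^sub>m pauli n u v) t"

lemma pauli_rot_carrier [simp]: "pauli_rot n u v t \<in> carrier_mat (2^n) (2^n)"
  by (simp add: pauli_rot_def)

definition rot_in :: "nat \<Rightarrow> complex Matrix.mat set \<Rightarrow> nat \<Rightarrow> nat \<Rightarrow> bool" where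
  "rot_in n G u v \<longleftrightarrow> u < 2^n \<and> v < 2^n \<and> (\<forall>t. pauli_rot n u v t \<in> G)"

lemma rot_in_xor:
  assumes G: "\<forall>A\<in>G. \<forall>B\<in>G. A * B \<in> G"
    and uv: "rot_in n G u v" and uv': "rot_in n G u' v'"
    and anti: "pauli_sign n v u' * pauli_sign n v' u = - 1"
  shows "rot_in n G (xor u u') (xor v v')"
proof -
  have l: "u < 2^n" "v < 2^n" "u' < 2^n" "v' < 2^n" using uv uv' by (auto simp: rot_in_def)
  let ?w = "pauli_phase n u v" and ?w' = "pauli_phase n u' v'" and ?w'' = "pauli_phase n (xor u u') (xor v v')"
  let ?P = "pauli n (xor u u') (xor v v')"
  let ?Q = "?w \<cdot>\<^sub>m pauli n u v" and ?R = "?w' \<cdot>\<^sub>m pauli n u' v'"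
  have sm: "(a \<cdot>\<^sub>m pauli n r s) * (b \<cdot>\<^sub>m pauli n r' s') = (a * b * pauli_sign n s r') \<cdot>\<^sub>m pauli n (xor r r') (xor s s')"
    if "r < 2^n" "r' < 2^n" for a b r s r' s'
    by (simp add: mult_smult_assoc_mat[of _ "2^n" "2^n" _ "2^n"] mult_smult_distrib[of _ "2^n" "2^n" _ "2^n"]
        smult_smult_mat smult_one_mat pauli_mult[OF that] mult_ac)
  have QQ: "?Q * ?Q = (-1) \<cdot>\<^sub>m 1\<^sub>m (2^n)"
    unfolding sm[OF l(1) l(1)] pauli_phase_square by (simp add: pauli_0)
  have s: "pauli_sign n v' u = - pauli_sign n v u'"
    using anti pauli_sign_cases[of n v u'] by auto
  have "?w' * ?w * pauli_sign n v' u = - (?w * ?w' * pauli_sign n v u')" unfolding s by simp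
  then have an: "?R * ?Q = (-1) \<cdot>\<^sub>m (?Q * ?R)"
    unfolding sm[OF l(1) l(3)] sm[OF l(3) l(1)] by (simp add: smult_smult_mat smult_one_mat xor.commute)
  define z where "z = ?w * ?w' * pauli_sign n v u'"
  have QR: "?Q * ?R = z \<cdot>\<^sub>m ?P" unfolding sm[OF l(1) l(3)] z_def ..
  have "mat_rot (2^n) (z \<cdot>\<^sub>m ?P) t \<in> G" for t
  proof -
    have "mat_rot (2^n) ?Q (pi/4) * mat_rot (2^n) ?R t * mat_rot (2^n) ?Q (- (pi/4)) \<in> G"
      using uv uv' G by (auto simp: rot_in_def pauli_rot_def)
    then show ?thesis by (subst (asm) mat_rot_conj[OF _ _ QQ an]) (auto simp: QR)
  qed
  note zG = this
  have "z * z * pauli_sign n (xor v v') (xor u u') =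
     (?w * ?w * pauli_sign n v u) * (?w' * ?w' * pauli_sign n v' u') * (pauli_sign n v u' * pauli_sign n v u') * (pauli_sign n v u' * pauli_sign n v' u)"
    unfolding z_def pauli_sign_xor_left pauli_sign_xor_right by (simp add: mult_ac)
  also have "\<dots> = - 1" unfolding pauli_phase_square pauli_sign_square anti by simp
  also have "\<dots> = ?w'' * ?w'' * pauli_sign n (xor v v') (xor u u')" by (rule pauli_phase_square[symmetric])
  finally have "z * z = ?w'' * ?w''" using pauli_sign_cases[of n "xor v v'" "xor u u'"] by auto
  then have "z = ?w'' \<or> z = - ?w''" by (metis square_eq_iff)
  then have "pauli_rot n (xor u u') (xor v v') t \<in> G" for t
  proof
    assume "z = - ?w''"
    have "mat_rot (2^n) (z \<cdot>\<^sub>m ?P) (- t) = pauli_rot n (xor u u') (xor v v') t"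
      unfolding pauli_rot_def \<open>z = - ?w''\<close> by (intro eq_matI) (auto simp: mat_rot_def)
    then show ?thesis using zG[of "- t"] by simp
  qed (use zG in \<open>simp add: pauli_rot_def\<close>)
  then show ?thesis using l xor_less by (auto simp: rot_in_def)
qed

definition sigma :: "bool \<Rightarrow> bool \<Rightarrow> bool \<Rightarrow> bool \<Rightarrow> complex" where
  "sigma p r i j = (if i = (j \<noteq> p) then (if r \<and> j then - 1 else 1) else 0)"

definition sigma_rot :: "bool \<Rightarrow> bool \<Rightarrow> bool \<Rightarrow> bool \<Rightarrow> real \<Rightarrow> complex^4^4" where
  "sigma_rot p r p' r' t = (\<chi> i j. complex_of_real (cos t) * (if i = j then 1 else 0) +
     complex_of_real (sin t) * (if (p \<and> r) = (p' \<and> r') then \<i> else 1) * kron2 (sigma p r) (sigma p' r') $ i $ j)"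

lemma sigma_rot_SU4:
  assumes "p \<or> r \<or> p' \<or> r'"
  shows "sigma_rot p r p' r' t \<in> SU4"
proof -
  define c s where "c = complex_of_real (cos t)" and "s = complex_of_real (sin t)"
  have cs: "c * c + s * s = 1" unfolding c_def s_def by (metis of_real_1 of_real_add of_real_mult sin_cos_squared_add3)
  have rc: "cnj c = c" "cnj s = s" by (simp_all add: c_def s_def)
  note R = sigma_rot_def[of p r p' r' t, folded c_def s_def]
  have U: "\<forall>i j. (cadj4 (sigma_rot p r p' r' t) ** sigma_rot p r p' r' t) $ i $ j = (if i = j then c * c + s * s else 0)"
    unfolding R all4 mat_mult_4 using assms
    by (cases p; cases r; cases p'; cases r')
      (simp_all add: kron2_def sigma_def cadj4_def rc, simp_all add: algebra_simps)
  have D: "Determinants.det (sigma_rot p r p' r' t) = (c * c + s * s) * (c * c + s * s)"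
    unfolding R det_4 using assms
    by (cases p; cases r; cases p'; cases r')
      (simp_all add: kron2_def sigma_def, simp_all add: algebra_simps)
  show ?thesis using U D unfolding cs
    by (simp add: SU4_def Finite_Cartesian_Product.vec_eq_iff Finite_Cartesian_Product.mat_def)
qed


lemma embed_sigma_rot:
  assumes ok: "pair_ok n (a, b)" and l: "u < 2^n" "v < 2^n"
    and supp: "\<And>k. bit u k \<or> bit v k \<Longrightarrow> k = a - 1 \<or> k = b - 1"
  shows "embed_gate n (a, b) (sigma_rot (bit u (a - 1)) (bit v (a - 1)) (bit u (b - 1)) (bit v (b - 1)) t) = pauli_rot n u v t"
proof (intro eq_matI)
  fix x y assume "x < dim_row (pauli_rot n u v t)" "y < dim_col (pauli_rot n u v t)"
  then have xy: "x < 2^n" "y < 2^n" using pauli_rot_carrier by (metis carrier_matD)+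
  have ab: "a - 1 < n" "b - 1 < n" "a - 1 \<noteq> b - 1" "a \<ge> 1" "b \<ge> 1" using ok by (auto simp: pair_ok_def)
  have sg: "pauli_sign n v z = (if bit v (a - 1) \<and> bit z (a - 1) then - 1 else 1) * (if bit v (b - 1) \<and> bit z (b - 1) then - 1 else 1)" for z
  proof -
    have "pauli_sign n v z = (\<Prod>k\<in>{a - 1, b - 1}. if bit v k \<and> bit z k then - 1 else 1)"
      unfolding pauli_sign_def by (rule prod.mono_neutral_right) (use ab supp in auto)
    then show ?thesis using ab(3) by simp
  qed
  have ph: "pauli_phase n u v = (if (bit u (a - 1) \<and> bit v (a - 1)) = (bit u (b - 1) \<and> bit v (b - 1)) then \<i> else 1)"
    unfolding pauli_phase_def sg by auto
  have xo: "x = xor y u \<longleftrightarrow> agree_off n a b x y \<and> bit x (a - 1) = (bit y (a - 1) \<noteq> bit u (a - 1)) \<and> bit x (b - 1) = (bit y (b - 1) \<noteq> bit u (b - 1))"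
  proof
    assume x: "x = xor y u"
    have "agree_off n a b x y" unfolding agree_off_def
    proof
      fix k assume k: "k \<in> {1..n} - {a, b}"
      then have "k - 1 \<noteq> a - 1" "k - 1 \<noteq> b - 1" using ab(4,5) by auto
      then show "bit x (k - 1) = bit y (k - 1)" using supp[of "k - 1"] unfolding x bit_xor_iff by blast
    qed
    then show "agree_off n a b x y \<and> bit x (a - 1) = (bit y (a - 1) \<noteq> bit u (a - 1)) \<and> bit x (b - 1) = (bit y (b - 1) \<noteq> bit u (b - 1))"
      unfolding x bit_xor_iff by simp
  next
    assume h: "agree_off n a b x y \<and> bit x (a - 1) = (bit y (a - 1) \<noteq> bit u (a - 1)) \<and> bit x (b - 1) = (bit y (b - 1) \<noteq> bit u (b - 1))"
    show "x = xor y u"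
    proof (rule bit_eqI)
      fix j
      show "bit x j = bit (xor y u) j"
      proof (cases "j = a - 1 \<or> j = b - 1")
        case True
        then show ?thesis using h unfolding bit_xor_iff by auto
      next
        case False
        then have u0: "\<not> bit u j" using supp by blast
        show ?thesis
        proof (cases "j < n")
          case True
          then have "Suc j \<in> {1..n} - {a, b}" using False by auto
          then have "bit x (Suc j - 1) = bit y (Suc j - 1)" using h unfolding agree_off_def by blast
          then show ?thesis using u0 unfolding bit_xor_iff by simp
        next
          case False
          then show ?thesis using xy u0 unfolding less_two_power_bit bit_xor_iff by (meson not_le)
        qed
      qed
    qed
  qed
  have pe: "pauli n u v $$ (x, y) = (if agree_off n a b x y then
      sigma (bit u (a - 1)) (bit v (a - 1)) (bit x (a - 1)) (bit y (a - 1)) * sigma (bit u (b - 1)) (bit v (b - 1)) (bit x (b - 1)) (bit y (b - 1)) else 0)"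
    unfolding pauli_entry[OF xy] xo sg by (auto simp: sigma_def)
  have ie: "idx4 a b x = idx4 a b y \<longleftrightarrow> x = y" if "agree_off n a b x y"
    using agree_off_eqI[OF xy that] by auto
  have af: "x = y \<Longrightarrow> agree_off n a b x y" by (simp add: agree_off_def)
  have re: "pauli_rot n u v t $$ (x, y) = complex_of_real (cos t) * (if x = y then 1 else 0) + complex_of_real (sin t) * (pauli_phase n u v * pauli n u v $$ (x, y))"
    unfolding pauli_rot_def using xy by (subst mat_rot_entry) (auto simp: pauli_def)
  show "embed_gate n (a, b) (sigma_rot (bit u (a - 1)) (bit v (a - 1)) (bit u (b - 1)) (bit v (b - 1)) t) $$ (x, y) = pauli_rot n u v t $$ (x, y)"
  proof (cases "agree_off n a b x y")
    case True
    then show ?thesis unfolding embed_gate_entry[OF xy] re pe ph by (simp add: sigma_rot_def kron2_def ie mult.assoc)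
  next
    case False
    then show ?thesis unfolding embed_gate_entry[OF xy] re pe using af by auto
  qed
qed (auto simp: pauli_rot_def mat_rot_def embed_gate_def pauli_def)

definition all_rots_on :: "nat \<Rightarrow> complex Matrix.mat set \<Rightarrow> nat set \<Rightarrow> bool" where
  "all_rots_on n G S \<longleftrightarrow> (\<forall>u v. u < 2^n \<longrightarrow> v < 2^n \<longrightarrow> u \<noteq> 0 \<or> v \<noteq> 0 \<longrightarrow>
     (\<forall>k. bit u k \<or> bit v k \<longrightarrow> Suc k \<in> S) \<longrightarrow> rot_in n G u v)"

lemma all_rots_onD: "all_rots_on n G S \<Longrightarrow> u < 2^n \<Longrightarrow> v < 2^n \<Longrightarrow> u \<noteq> 0 \<or> v \<noteq> 0 \<Longrightarrow>
     (\<And>k. bit u k \<or> bit v k \<Longrightarrow> Suc k \<in> S) \<Longrightarrow> rot_in n G u v"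
  unfolding all_rots_on_def by blast

lemma all_rots_on_mono: "all_rots_on n G S \<Longrightarrow> S' \<subseteq> S \<Longrightarrow> all_rots_on n G S'"
  unfolding all_rots_on_def by (meson subsetD)

lemma all_rots_on_edge:
  assumes ok: "pair_ok n (a, b)" and G: "\<And>g. g \<in> SU4 \<Longrightarrow> embed_gate n (a, b) g \<in> G"
  shows "all_rots_on n G {a, b}"
  unfolding all_rots_on_def
proof (intro allI impI)
  fix u v :: nat assume l: "u < 2^n" "v < 2^n" and nz: "u \<noteq> 0 \<or> v \<noteq> 0" and s: "\<forall>k. bit u k \<or> bit v k \<longrightarrow> Suc k \<in> {a, b}"
  have supp: "k = a - 1 \<or> k = b - 1" if "bit u k \<or> bit v k" for k using s that by force
  have "w = 0" if "\<And>k. \<not> bit w k" for w :: nat using that by (intro bit_eqI) simp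
  then have "\<exists>k. bit u k \<or> bit v k" using nz by blast
  then have "bit u (a - 1) \<or> bit v (a - 1) \<or> bit u (b - 1) \<or> bit v (b - 1)" using supp by metis
  then have "embed_gate n (a, b) (sigma_rot (bit u (a - 1)) (bit v (a - 1)) (bit u (b - 1)) (bit v (b - 1)) t) \<in> G" for t
    by (intro G sigma_rot_SU4)
  moreover have "embed_gate n (a, b) (sigma_rot (bit u (a - 1)) (bit v (a - 1)) (bit u (b - 1)) (bit v (b - 1)) t) = pauli_rot n u v t" for t
    by (rule embed_sigma_rot[OF ok l]) (use supp in auto)
  ultimately have "pauli_rot n u v t \<in> G" for t by simp
  then show "rot_in n G u v" using l by (simp add: rot_in_def)
qed

lemma pauli_sign_two:
  assumes "b < n" "c < n" "b \<noteq> c" "\<And>k. bit u k \<or> bit v k \<Longrightarrow> k = b \<or> k = c"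
  shows "pauli_sign n v u' * pauli_sign n v' u =
    (if bit v b \<and> bit u' b then - 1 else 1) * (if bit v' b \<and> bit u b then - 1 else 1) *
    ((if bit v c \<and> bit u' c then - 1 else 1) * (if bit v' c \<and> bit u c then - 1 else 1))"
proof -
  have "pauli_sign n v u' = (\<Prod>k\<in>{b, c}. if bit v k \<and> bit u' k then - 1 else 1)"
    unfolding pauli_sign_def by (rule prod.mono_neutral_right) (use assms in auto)
  moreover have "pauli_sign n v' u = (\<Prod>k\<in>{b, c}. if bit v' k \<and> bit u k then - 1 else 1)"
    unfolding pauli_sign_def by (rule prod.mono_neutral_right) (use assms in auto)
  ultimately show ?thesis using assms(3) by simp
qed

lemma setb_less: "y < 2^n \<Longrightarrow> k < n \<Longrightarrow> setb c k y < 2^n"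
  unfolding less_two_power_bit bit_setb by auto

text \<open>Every string on insert c S is a product of two anticommuting strings, one on the edge {b, c}
  and one on S (or one already treated).\<close>

lemma all_rots_on_insert:
  assumes G: "\<forall>A\<in>G. \<forall>B\<in>G. A * B \<in> G"
    and S: "all_rots_on n G S" and E: "all_rots_on n G {Suc b, Suc c}"
    and b: "Suc b \<in> S" "b < n" and c: "Suc c \<notin> S" "c < n"
  shows "all_rots_on n G (insert (Suc c) S)"
proof -
  have bc: "b \<noteq> c" using b c by auto
  define A where "A x y = setb x b (setb y c 0)" for x y
  have bA: "bit (A x y) k = (if k = b then x else if k = c then y else False)" for x y k
    by (simp add: A_def bit_setb)
  have lA: "A x y < 2^n" for x y unfolding A_def using b c by (intro setb_less) auto
  have nz: "w \<noteq> 0" if "bit w k" for w k :: nat using that by (cases "w = 0") auto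
  have case1: "rot_in n G u v" if l: "u < 2^n" "v < 2^n" and supp: "\<And>k. bit u k \<or> bit v k \<Longrightarrow> Suc k \<in> insert (Suc c) S"
    and bb: "bit u b \<or> bit v b" for u v
  proof -
    define p r where "p = (\<not> bit u b)" and "r = bit u b"
    let ?Au = "A p (bit u c)" and ?Av = "A r (bit v c)"
    let ?Bu = "xor u ?Au" and ?Bv = "xor v ?Av"
    have "rot_in n G ?Au ?Av"
    proof (rule all_rots_onD[OF E lA lA])
      show "?Au \<noteq> 0 \<or> ?Av \<noteq> 0" proof -
        have "bit ?Au b \<or> bit ?Av b" unfolding bA p_def r_def by simp
        then show ?thesis using nz by blast
      qed
      show "Suc k \<in> {Suc b, Suc c}" if "bit ?Au k \<or> bit ?Av k" for k using that by (auto simp: bA split: if_splits)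
    qed
    moreover have "rot_in n G ?Bu ?Bv"
    proof (rule all_rots_onD[OF S])
      show "?Bu < 2^n" "?Bv < 2^n" using l lA xor_less by blast+
      show "?Bu \<noteq> 0 \<or> ?Bv \<noteq> 0" proof -
        have "bit ?Bu b \<or> bit ?Bv b" unfolding bit_xor_iff bA p_def r_def using bb by simp
        then show ?thesis using nz by blast
      qed
      show "Suc k \<in> S" if k: "bit ?Bu k \<or> bit ?Bv k" for k
      proof -
        have "k \<noteq> c" using k bc by (auto simp: bit_xor_iff bA)
        then show ?thesis using k supp[of k] b(1) by (auto simp: bit_xor_iff bA split: if_splits)
      qed
    qed
    moreover have "pauli_sign n ?Av ?Bu * pauli_sign n ?Bv ?Au = - 1"
      by (subst pauli_sign_two[of b n c]) (use b c bc bb in \<open>auto simp: bit_xor_iff bA p_def r_def split: if_splits\<close>)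
    ultimately have "rot_in n G (xor ?Au ?Bu) (xor ?Av ?Bv)" by (rule rot_in_xor[OF G])
    then show ?thesis by simp
  qed
  show ?thesis unfolding all_rots_on_def
  proof (intro allI impI)
    fix u v :: nat assume l: "u < 2^n" "v < 2^n" and uv: "u \<noteq> 0 \<or> v \<noteq> 0"
      and supp: "\<forall>k. bit u k \<or> bit v k \<longrightarrow> Suc k \<in> insert (Suc c) S"
    consider "bit u b \<or> bit v b" | "\<not> bit u c" "\<not> bit v c" | "\<not> bit u b" "\<not> bit v b" "bit u c \<or> bit v c" by blast
    then show "rot_in n G u v"
    proof cases
      case 1
      then show ?thesis using case1[OF l] supp by blast
    next
      case 2
      have "Suc k \<in> S" if "bit u k \<or> bit v k" for k
        using supp that 2 by (metis insert_iff nat.inject)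
      then show ?thesis using all_rots_onD[OF S l uv] by blast
    next
      case 3
      let ?Au = "A True (\<not> bit u c)" and ?Av = "A False (bit u c)"
      let ?Bu = "xor u ?Au" and ?Bv = "xor v ?Av"
      have "rot_in n G ?Au ?Av"
      proof (rule all_rots_onD[OF E lA lA])
        show "?Au \<noteq> 0 \<or> ?Av \<noteq> 0" using nz[of ?Au b] by (auto simp: bA)
        show "Suc k \<in> {Suc b, Suc c}" if "bit ?Au k \<or> bit ?Av k" for k using that by (auto simp: bA split: if_splits)
      qed
      moreover have "rot_in n G ?Bu ?Bv"
      proof (rule case1)
        show "?Bu < 2^n" "?Bv < 2^n" using l lA xor_less by blast+
        show "bit ?Bu b \<or> bit ?Bv b" using 3 by (auto simp: bit_xor_iff bA)
        show "Suc k \<in> insert (Suc c) S" if "bit ?Bu k \<or> bit ?Bv k" for k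
          using that supp b(1) by (auto simp: bit_xor_iff bA split: if_splits)
      qed
      moreover have "pauli_sign n ?Av ?Bu * pauli_sign n ?Bv ?Au = - 1"
        by (subst pauli_sign_two[of b n c]) (use b c bc 3 in \<open>auto simp: bit_xor_iff bA split: if_splits\<close>)
      ultimately have "rot_in n G (xor ?Au ?Bu) (xor ?Av ?Bv)" by (rule rot_in_xor[OF G])
      then show ?thesis by simp
    qed
  qed
qed

lemma foldl_spread_avoids:
  assumes "\<And>a b. (a, b) \<in> set sl \<Longrightarrow> a \<in> S \<longleftrightarrow> b \<in> S" "R \<inter> S = {}"
  shows "foldl spread R sl \<inter> S = {}"
  using assms
proof (induction sl arbitrary: R)
  case (Cons p sl)
  obtain a b where p: "p = (a, b)" by (cases p)
  have "spread R p \<inter> S = {}" using Cons.prems by (auto simp: p spread_def)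
  then show ?case using Cons by simp
qed simp

lemma causal_slice_crossing:
  assumes "causal_slice n sl"
  obtains t where "t \<in> {1..n}" "\<And>S. t \<in> S \<Longrightarrow> \<not> {1..n} \<subseteq> S \<Longrightarrow> \<exists>(a, b)\<in>set sl. (a \<in> S) \<noteq> (b \<in> S)"
proof -
  obtain t where t: "t \<in> {1..n}" "\<And>t'. t' \<in> {1..n} \<Longrightarrow> t' \<noteq> t \<Longrightarrow> t \<in> foldl spread {t'} sl"
    using assms by (auto simp: causal_slice_def connected_in_def)
  have "\<exists>(a, b)\<in>set sl. (a \<in> S) \<noteq> (b \<in> S)" if S: "t \<in> S" "\<not> {1..n} \<subseteq> S" for S
  proof (rule ccontr)
    assume n: "\<not> (\<exists>(a, b)\<in>set sl. (a \<in> S) \<noteq> (b \<in> S))"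
    obtain t' where t': "t' \<in> {1..n}" "t' \<notin> S" using S(2) by blast
    have "foldl spread {t'} sl \<inter> S = {}" by (rule foldl_spread_avoids) (use n t'(2) in auto)
    then show False using t(2)[OF t'(1)] t' S(1) by auto
  qed
  then show ?thesis using that t(1) by blast
qed

lemma causal_slice_all_rots:
  assumes n: "n \<ge> 2" and ok: "wf_arch n sl" and causal: "causal_slice n sl"
    and G: "\<forall>A\<in>G. \<forall>B\<in>G. A * B \<in> G"
    and gates: "\<And>p g. p \<in> set sl \<Longrightarrow> g \<in> SU4 \<Longrightarrow> embed_gate n p g \<in> G"
  shows "all_rots_on n G {1..n}"
proof -
  obtain t where t: "t \<in> {1..n}" and cross: "\<And>S. t \<in> S \<Longrightarrow> \<not> {1..n} \<subseteq> S \<Longrightarrow> \<exists>(a, b)\<in>set sl. (a \<in> S) \<noteq> (b \<in> S)"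
    using causal_slice_crossing[OF causal] by blast
  have crossing: "\<exists>b\<in>S \<inter> {1..n}. \<exists>c\<in>{1..n} - S. all_rots_on n G {b, c}" if S: "t \<in> S" "\<not> {1..n} \<subseteq> S" for S
  proof -
    obtain a b where ab: "(a, b) \<in> set sl" "(a \<in> S) \<noteq> (b \<in> S)" using cross[OF S] by blast
    have p: "pair_ok n (a, b)" using ok ab(1) by (auto simp: wf_arch_alt)
    have e: "all_rots_on n G {a, b}" by (rule all_rots_on_edge[OF p gates[OF ab(1)]])
    then have e': "all_rots_on n G {b, a}" by (simp add: insert_commute)
    show ?thesis
    proof (cases "a \<in> S")
      case True
      then show ?thesis using p ab(2) e unfolding pair_ok_def by blast
    next
      case False
      then show ?thesis using p ab(2) e' unfolding pair_ok_def by blast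
    qed
  qed
  have "\<exists>S. t \<in> S \<and> S \<subseteq> {1..n} \<and> card S = Suc m \<and> all_rots_on n G S" if "Suc m \<le> n" for m
    using that
  proof (induction m)
    case 0
    have "\<not> {1..n} \<subseteq> {t}"
    proof
      assume "{1..n} \<subseteq> {t}"
      then have "card {1..n} \<le> card {t}" by (intro card_mono) auto
      then show False using n by simp
    qed
    then obtain c where "all_rots_on n G {t, c}" using crossing[of "{t}"] by auto
    then have "all_rots_on n G {t}" by (rule all_rots_on_mono) auto
    then show ?case using t by (intro exI[of _ "{t}"]) auto
  next
    case (Suc m)
    then obtain S where S: "t \<in> S" "S \<subseteq> {1..n}" "card S = Suc m" "all_rots_on n G S" by auto
    have fS: "finite S" using S(2) finite_subset by blast
    have "\<not> {1..n} \<subseteq> S"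
    proof
      assume "{1..n} \<subseteq> S"
      then have "card {1..n} \<le> card S" using fS by (rule card_mono[rotated])
      then show False using S(3) Suc.prems by simp
    qed
    then obtain b c where bc: "b \<in> S" "b \<in> {1..n}" "c \<in> {1..n}" "c \<notin> S" "all_rots_on n G {b, c}" using crossing[OF S(1)] by blast
    obtain b' c' where s: "b = Suc b'" "c = Suc c'" using bc(2,3) by (cases b; cases c) auto
    have "all_rots_on n G (insert c S)"
      using bc unfolding s by (intro all_rots_on_insert[OF G S(4), where b=b' and c=c']) auto
    then show ?case using S bc fS by (intro exI[of _ "insert c S"]) auto
  qed
  from this[of "n - 1"] n obtain S where S: "S \<subseteq> {1..n}" "card S = n" "all_rots_on n G S" by auto
  have "S = {1..n}" using S by (intro card_subset_eq) auto
  then show ?thesis using S by simp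
qed

section \<open>First-order coordinates at the identity\<close>

primrec rot_prod :: "nat \<Rightarrow> (nat \<Rightarrow> nat) \<Rightarrow> (nat \<Rightarrow> nat) \<Rightarrow> nat \<Rightarrow> (nat \<Rightarrow> real) \<Rightarrow> complex Matrix.mat" where
  "rot_prod n u v 0 \<tau> = 1\<^sub>m (2^n)"
| "rot_prod n u v (Suc j) \<tau> = rot_prod n u v j \<tau> * pauli_rot n (u j) (v j) (\<tau> j)"

lemma rot_prod_carrier [simp]: "rot_prod n u v j \<tau> \<in> carrier_mat (2^n) (2^n)"
  by (induction j) (auto intro: mult_carrier_mat[of _ _ "2^n"])

lemma pauli_rot_0: "pauli_rot n u v 0 = 1\<^sub>m (2^n)"
  by (intro eq_matI) (auto simp: pauli_rot_def mat_rot_def pauli_def)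

lemma rot_prod_0: "(\<And>i. i < j \<Longrightarrow> \<tau> i = 0) \<Longrightarrow> rot_prod n u v j \<tau> = 1\<^sub>m (2^n)"
  by (induction j) (auto simp: pauli_rot_0)

definition pauli_gen :: "nat \<Rightarrow> nat \<Rightarrow> nat \<Rightarrow> complex Matrix.mat" where
  "pauli_gen n u v = pauli_phase n u v \<cdot>\<^sub>m pauli n u v"

lemma pauli_rot_entry: "x < 2^n \<Longrightarrow> y < 2^n \<Longrightarrow> pauli_rot n u v t $$ (x, y) =
    complex_of_real (cos t) * (if x = y then 1 else 0) + complex_of_real (sin t) * pauli_gen n u v $$ (x, y)"
  unfolding pauli_rot_def pauli_gen_def by (rule mat_rot_entry) auto

lemma pauli_rot_has_vector_derivative:
  assumes "x < 2^n" "y < 2^n"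
  shows "((\<lambda>\<epsilon>. pauli_rot n u v (\<epsilon> * t) $$ (x, y)) has_vector_derivative complex_of_real t * pauli_gen n u v $$ (x, y)) (at 0)"
  unfolding pauli_rot_entry[OF assms]
  unfolding has_vector_derivative_complex_iff by (auto intro!: derivative_eq_intros)

lemma rot_prod_has_vector_derivative:
  assumes "x < 2^n" "y < 2^n"
  shows "((\<lambda>\<epsilon>. rot_prod n u v j (\<lambda>i. \<epsilon> * \<tau> i) $$ (x, y)) has_vector_derivative
     (\<Sum>l<j. complex_of_real (\<tau> l) * pauli_gen n (u l) (v l) $$ (x, y))) (at 0)"
  using assms
proof (induction j arbitrary: x y)
  case (Suc j)
  let ?N = "2^n :: nat" and ?R = "\<lambda>\<epsilon>. rot_prod n u v j (\<lambda>i. \<epsilon> * \<tau> i)" and ?P = "\<lambda>\<epsilon>. pauli_rot n (u j) (v j) (\<epsilon> * \<tau> j)"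
  let ?D = "\<lambda>x z. \<Sum>l<j. complex_of_real (\<tau> l) * pauli_gen n (u l) (v l) $$ (x, z)"
  have e: "rot_prod n u v (Suc j) (\<lambda>i. \<epsilon> * \<tau> i) $$ (x, y) = (\<Sum>z<?N. ?R \<epsilon> $$ (x, z) * ?P \<epsilon> $$ (z, y))" for \<epsilon>
    using mat_mult_entry[OF rot_prod_carrier pauli_rot_carrier Suc.prems, of u v j _ "u j" "v j"] by simp
  have R0: "?R 0 = 1\<^sub>m ?N" by (rule rot_prod_0) simp
  have "((\<lambda>\<epsilon>. \<Sum>z<?N. ?R \<epsilon> $$ (x, z) * ?P \<epsilon> $$ (z, y)) has_vector_derivative
      (\<Sum>z<?N. ?R 0 $$ (x, z) * (complex_of_real (\<tau> j) * pauli_gen n (u j) (v j) $$ (z, y)) + ?D x z * ?P 0 $$ (z, y))) (at 0)"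
    using Suc.prems
    by (intro has_vector_derivative_sum has_vector_derivative_mult Suc.IH pauli_rot_has_vector_derivative) auto
  moreover have "(\<Sum>z<?N. ?R 0 $$ (x, z) * (complex_of_real (\<tau> j) * pauli_gen n (u j) (v j) $$ (z, y)) + ?D x z * ?P 0 $$ (z, y))
    = (\<Sum>z<?N. (if x = z then complex_of_real (\<tau> j) * pauli_gen n (u j) (v j) $$ (z, y) else 0) + (if z = y then ?D x z else 0))"
    unfolding R0 using Suc.prems by (intro sum.cong) (auto simp: pauli_rot_0)
  moreover have "\<dots> = (\<Sum>l<Suc j. complex_of_real (\<tau> l) * pauli_gen n (u l) (v l) $$ (x, y))"
    using Suc.prems by (simp add: sum.distrib)
  ultimately show ?case unfolding e by simp
qed simp

definition lin_form :: "nat \<Rightarrow> nat \<Rightarrow> (nat \<Rightarrow> nat \<Rightarrow> complex) \<Rightarrow> (nat \<Rightarrow> nat \<Rightarrow> complex) \<Rightarrow> complex Matrix.mat \<Rightarrow> complex" where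
  "lin_form N c a b M = (\<Sum>i<N. \<Sum>k<c. a i k * M $$ (i, k) + b i k * cnj (M $$ (i, k)))"

lemma mat_poly_lin_form: "mat_poly N c (lin_form N c a b)"
  unfolding lin_form_def[abs_def] by (intro mat_poly_sum mat_poly.intros) auto

definition first_order_coords :: "nat \<Rightarrow> nat \<Rightarrow> nat \<Rightarrow> (nat \<Rightarrow> nat) \<Rightarrow> (nat \<Rightarrow> nat) \<Rightarrow>
    (nat \<Rightarrow> nat \<Rightarrow> nat \<Rightarrow> complex) \<Rightarrow> (nat \<Rightarrow> nat \<Rightarrow> nat \<Rightarrow> complex) \<Rightarrow> bool" where
  "first_order_coords n c D u v a b \<longleftrightarrow> (\<forall>l<D. u l < 2^n \<and> v l < 2^n \<and> (u l \<noteq> 0 \<or> v l \<noteq> 0) \<and>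
     lin_form (2^n) c (a l) (b l) (1\<^sub>m (2^n)) = 0 \<and>
     (\<forall>m<D. lin_form (2^n) c (a l) (b l) (pauli_gen n (u m) (v m)) = (if l = m then 1 else 0)))"

lemma vector_derivative_quotient:
  fixes f :: "real \<Rightarrow> complex"
  assumes "(f has_vector_derivative D) (at 0)" "f 0 = 0"
  shows "((\<lambda>\<epsilon>. f \<epsilon> / complex_of_real \<epsilon>) \<longlongrightarrow> D) (at 0)"
proof -
  have "((\<lambda>h. Re (f h) / h) \<longlongrightarrow> Re D) (at 0)" "((\<lambda>h. Im (f h) / h) \<longlongrightarrow> Im D) (at 0)"
    using assms unfolding has_vector_derivative_complex_iff by (auto simp: DERIV_def)
  then show ?thesis by (simp add: tendsto_complex_iff)
qed

lemma alg_indep_rot_prod: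
  assumes co: "first_order_coords n c D u v a b" and "c \<le> 2^n" "j \<le> D"
  shows "alg_indep (range (rot_prod n u v j)) (\<lambda>l. lin_form (2^n) c (a l) (b l)) j"
proof (rule alg_indep_first_order)
  fix \<tau> :: "nat \<Rightarrow> real" and l assume l: "l < j"
  let ?N = "2^n :: nat" and ?R = "\<lambda>\<epsilon>. rot_prod n u v j (\<lambda>i. \<epsilon> * \<tau> i)"
  let ?D = "\<lambda>x z. \<Sum>m<j. complex_of_real (\<tau> m) * pauli_gen n (u m) (v m) $$ (x, z)"
  have "((\<lambda>\<epsilon>. lin_form ?N c (a l) (b l) (?R \<epsilon>)) has_vector_derivative
      (\<Sum>i<?N. \<Sum>k<c. a l i k * ?D i k + b l i k * cnj (?D i k))) (at 0)"
    unfolding lin_form_def using \<open>c \<le> 2^n\<close>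
    by (intro has_vector_derivative_sum has_vector_derivative_add has_vector_derivative_mult_right has_vector_derivative_cnj
        rot_prod_has_vector_derivative) auto
  moreover have "(\<Sum>i<?N. \<Sum>k<c. a l i k * ?D i k + b l i k * cnj (?D i k)) =
      (\<Sum>m<j. complex_of_real (\<tau> m) * lin_form ?N c (a l) (b l) (pauli_gen n (u m) (v m)))"
  proof -
    have "(\<Sum>i<?N. \<Sum>k<c. a l i k * ?D i k + b l i k * cnj (?D i k)) =
      (\<Sum>i<?N. \<Sum>k<c. \<Sum>m<j. complex_of_real (\<tau> m) * (a l i k * pauli_gen n (u m) (v m) $$ (i, k) + b l i k * cnj (pauli_gen n (u m) (v m) $$ (i, k))))"
      by (intro sum.cong) (simp_all add: sum_distrib_left sum.distrib algebra_simps)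
    also have "\<dots> = (\<Sum>i<?N. \<Sum>m<j. \<Sum>k<c. complex_of_real (\<tau> m) * (a l i k * pauli_gen n (u m) (v m) $$ (i, k) + b l i k * cnj (pauli_gen n (u m) (v m) $$ (i, k))))"
      by (intro sum.cong sum.swap refl)
    also have "\<dots> = (\<Sum>m<j. \<Sum>i<?N. \<Sum>k<c. complex_of_real (\<tau> m) * (a l i k * pauli_gen n (u m) (v m) $$ (i, k) + b l i k * cnj (pauli_gen n (u m) (v m) $$ (i, k))))"
      by (rule sum.swap)
    finally show ?thesis by (simp add: lin_form_def sum_distrib_left)
  qed
  moreover have "\<dots> = (\<Sum>m<j. if l = m then complex_of_real (\<tau> m) else 0)"
    using co l \<open>j \<le> D\<close> by (intro sum.cong) (auto simp: first_order_coords_def)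
  ultimately have "((\<lambda>\<epsilon>. lin_form ?N c (a l) (b l) (?R \<epsilon>)) has_vector_derivative complex_of_real (\<tau> l)) (at 0)"
    using l by simp
  moreover have "lin_form ?N c (a l) (b l) (?R 0) = 0"
    using co l \<open>j \<le> D\<close> rot_prod_0[of j "\<lambda>i. 0 * \<tau> i" n u v] by (auto simp: first_order_coords_def)
  ultimately show "((\<lambda>\<epsilon>. lin_form ?N c (a l) (b l) (?R \<epsilon>) / complex_of_real \<epsilon>) \<longlongrightarrow> complex_of_real (\<tau> l)) (at 0)"
    by (rule vector_derivative_quotient)
qed

lemma pauli_phase_unit: "cnj (pauli_phase n u v) * pauli_phase n u v = 1"
  by (auto simp: pauli_phase_def)

lemma pauli_sign_single:
  assumes "b < n"
  shows "pauli_sign n w (2^b) = (if bit w b then - 1 else 1)"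
proof -
  have "pauli_sign n w (2^b) = (\<Prod>k\<in>{b}. if bit w k \<and> bit ((2::nat)^b) k then - 1 else 1)"
    unfolding pauli_sign_def by (rule prod.mono_neutral_right) (use assms in \<open>auto simp: bit_exp_iff\<close>)
  then show ?thesis by (simp add: bit_exp_iff)
qed

lemma nonzero_has_bit: assumes "w < 2^n" "(w::nat) \<noteq> 0" obtains b where "b < n" "bit w b"
proof -
  have "\<exists>b. bit w b"
  proof (rule ccontr)
    assume "\<nexists>b. bit w b"
    then have "w = 0" by (intro bit_eqI) simp
    then show False using assms by simp
  qed
  then show ?thesis using that assms(1) unfolding less_two_power_bit by (meson not_le)
qed

lemma sum_pauli_sign:
  assumes "w < 2^n"
  shows "(\<Sum>k<2^n. pauli_sign n w k) = (if w = 0 then 2^n else 0)"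
proof (cases "w = 0")
  case False
  then obtain b where b: "b < n" "bit w b" using nonzero_has_bit assms by blast
  have l: "(2::nat)^b < 2^n" using b by simp
  have "(\<Sum>k<2^n. pauli_sign n w k) = (\<Sum>k<2^n. pauli_sign n w (xor k (2^b)))"
    by (rule sum.reindex_bij_witness[where i="\<lambda>k. xor k (2^b)" and j="\<lambda>k. xor k (2^b)"]) (use l xor_less in auto)
  also have "\<dots> = - (\<Sum>k<2^n. pauli_sign n w k)"
    unfolding pauli_sign_xor_right pauli_sign_single[OF b(1)] using b(2) by (simp add: sum_negf)
  finally show ?thesis using False by simp
qed simp

lemma unitary_coords: "\<exists>u v a b. first_order_coords n (2^n) (4^n - 1) u v a b"
proof -
  let ?N = "2^n :: nat"
  let ?I = "{..<?N} \<times> {..<?N} - {(0, 0)}"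
  have "card ?I = ?N * ?N - 1" by (subst card_Diff_singleton) auto
  also have "?N * ?N = 4^n" by (simp flip: power_mult_distrib)
  finally obtain h where h: "bij_betw h {..<4^n - 1 :: nat} ?I"
    using ex_bij_betw_nat_finite[of ?I] by (auto simp: atLeast0LessThan)
  define u v where "u l = fst (h l)" and "v l = snd (h l)" for l
  have uv: "u l < ?N" "v l < ?N" "u l \<noteq> 0 \<or> v l \<noteq> 0" if "l < 4^n - 1" for l :: nat
  proof -
    have "h l \<in> ?I" using bij_betwE[OF h] that by blast
    then show "u l < ?N" "v l < ?N" "u l \<noteq> 0 \<or> v l \<noteq> 0" unfolding u_def v_def by (cases "h l"; auto)+
  qed
  define a where "a l i k = (if i = xor k (u l) then cnj (pauli_phase n (u l) (v l)) * pauli_sign n (v l) k / 2^n else 0)" for l i k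
  have lf: "lin_form ?N ?N (a l) (\<lambda>_ _. 0) (z \<cdot>\<^sub>m pauli n u' v') = (if u' = u l \<and> v' = v l then cnj (pauli_phase n (u l) (v l)) * z else 0)"
    if l: "l < 4^n - 1" and u': "u' < ?N" "v' < ?N" for l :: nat and u' v' z
  proof -
    let ?w = "cnj (pauli_phase n (u l) (v l)) * z / 2^n"
    have "lin_form ?N ?N (a l) (\<lambda>_ _. 0) (z \<cdot>\<^sub>m pauli n u' v') = (\<Sum>k<?N. \<Sum>i<?N. a l i k * (z * pauli n u' v' $$ (i, k)))"
      unfolding lin_form_def by (subst sum.swap) (intro sum.cong; auto simp: pauli_def)
    also have "\<dots> = (\<Sum>k<?N. \<Sum>i<?N. if i = xor k (u l) then a l i k * (z * pauli n u' v' $$ (i, k)) else 0)"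
      by (intro sum.cong) (auto simp: a_def)
    also have "\<dots> = (\<Sum>k<?N. a l (xor k (u l)) k * (z * pauli n u' v' $$ (xor k (u l), k)))"
      using uv(1)[OF l] by (intro sum.cong) (auto simp: xor_less)
    also have "\<dots> = (\<Sum>k<?N. if u l = u' then ?w * pauli_sign n (xor (v l) v') k else 0)"
    proof (intro sum.cong refl)
      fix k assume "k \<in> {..<?N}"
      then have k: "k < ?N" "xor k (u l) < ?N" using uv(1)[OF l] xor_less by auto
      have "xor k (u l) = xor k u' \<longleftrightarrow> u l = u'" by (metis xor_cancel(1) xor.commute)
      then show "a l (xor k (u l)) k * (z * pauli n u' v' $$ (xor k (u l), k)) = (if u l = u' then ?w * pauli_sign n (xor (v l) v') k else 0)"
        using k by (simp add: a_def pauli_entry pauli_sign_xor_left)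
    qed
    also have "\<dots> = (if u l = u' then ?w * (\<Sum>k<?N. pauli_sign n (xor (v l) v') k) else 0)"
      by (simp add: sum_distrib_left)
    also have "\<dots> = (if u' = u l \<and> v' = v l then cnj (pauli_phase n (u l) (v l)) * z else 0)"
    proof -
      have "xor (v l) v' = 0 \<longleftrightarrow> v' = v l" by (metis xor_cancel(1) xor_self_eq xor.left_neutral)
      then show ?thesis using sum_pauli_sign[OF xor_less[OF uv(2)[OF l] u'(2)]] by auto
    qed
    finally show ?thesis .
  qed
  have "first_order_coords n ?N (4^n - 1) u v a (\<lambda>_ _ _. 0)"
    unfolding first_order_coords_def
  proof (intro allI impI conjI)
    fix l :: nat assume l: "l < 4^n - 1"
    show "u l < ?N" "v l < ?N" "u l \<noteq> 0 \<or> v l \<noteq> 0" using uv[OF l] by auto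
    show "lin_form ?N ?N (a l) (\<lambda>_ _. 0) (1\<^sub>m ?N) = 0"
      using lf[OF l, of 0 0 1] uv(3)[OF l] by (auto simp: pauli_0 smult_one_mat)
    fix m :: nat assume m: "m < 4^n - 1"
    have "u m = u l \<and> v m = v l \<longleftrightarrow> l = m"
      using bij_betw_imp_inj_on[OF h] l m unfolding u_def v_def inj_on_def by (auto simp: prod_eq_iff)
    then show "lin_form ?N ?N (a l) (\<lambda>_ _. 0) (pauli_gen n (u m) (v m)) = (if l = m then 1 else 0)"
      unfolding pauli_gen_def lf[OF l uv(1,2)[OF m]] using pauli_phase_unit by auto
  qed
  then show ?thesis by blast
qed

text \<open>The generators applied to the first basis vector: one imaginary multiple of each basis vector and
  one real multiple of each except the first.\<close>

lemma state_coords: assumes "n > 0" shows "\<exists>u v a b. first_order_coords n 1 (2^(n+1) - 1) u v a b"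
proof -
  let ?N = "2^n :: nat"
  let ?I = "{..<?N} \<times> (UNIV::bool set) - {(0, True)}"
  have "card ?I = ?N * 2 - 1" by (subst card_Diff_singleton) (auto simp: card_cartesian_product)
  then obtain h where h: "bij_betw h {..<2^(n+1) - 1 :: nat} ?I"
    using ex_bij_betw_nat_finite[of ?I] by (auto simp: atLeast0LessThan mult.commute)
  have "\<exists>w<?N. pauli_sign n w x = - 1" if "x < ?N" "x \<noteq> 0" for x
  proof -
    obtain b where b: "b < n" "bit x b" using nonzero_has_bit \<open>x < ?N\<close> \<open>x \<noteq> 0\<close> by blast
    have "pauli_sign n (2^b) x = - 1" using pauli_sign_single[OF b(1), of x] b(2) pauli_sign_commute[of n x "2^b"] by simp
    then show ?thesis using b by (intro exI[of _ "2^b"]) auto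
  qed
  then obtain w where w: "\<And>x. x < ?N \<Longrightarrow> x \<noteq> 0 \<Longrightarrow> w x < ?N \<and> pauli_sign n (w x) x = - 1" by metis
  define u v where "u l = fst (h l)" and "v l = (if snd (h l) then w (fst (h l)) else if fst (h l) = 0 then 1 else 0)" for l
  let ?D = "2^(n+1) - 1 :: nat"
  have hl: "fst (h l) < ?N" "snd (h l) \<Longrightarrow> fst (h l) \<noteq> 0" if "l < ?D" for l
  proof -
    have "h l \<in> ?I" using bij_betwE[OF h] that by blast
    then show "fst (h l) < ?N" "snd (h l) \<Longrightarrow> fst (h l) \<noteq> 0" by (cases "h l"; auto)+
  qed
  have uv: "u l < ?N" "v l < ?N" "u l \<noteq> 0 \<or> v l \<noteq> 0" if "l < ?D" for l
    using hl[OF that] w[of "fst (h l)"] one_less_power[of "2::nat" n] assms by (auto simp: u_def v_def)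
  have ph: "pauli_phase n (u l) (v l) = (if snd (h l) then 1 else \<i>)" if "l < ?D" for l
    using hl[OF that] w[of "fst (h l)"] by (auto simp: pauli_phase_def u_def v_def)
  define a where "a l i k = (if i = u l then cnj (pauli_phase n (u l) (v l)) / 2 else 0)" for l i and k :: nat
  define b where "b l i k = (if i = u l then pauli_phase n (u l) (v l) / 2 else 0)" for l i and k :: nat
  have lf: "lin_form ?N 1 (a l) (b l) M = complex_of_real (Re (cnj (pauli_phase n (u l) (v l)) * M $$ (u l, 0)))" if "l < ?D" for l M
  proof -
    have "lin_form ?N 1 (a l) (b l) M = (\<Sum>i<?N. if i = u l then cnj (pauli_phase n (u l) (v l)) / 2 * M $$ (u l, 0) + pauli_phase n (u l) (v l) / 2 * cnj (M $$ (u l, 0)) else 0)"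
      unfolding lin_form_def by (intro sum.cong) (auto simp: a_def b_def)
    also have "\<dots> = cnj (pauli_phase n (u l) (v l)) / 2 * M $$ (u l, 0) + pauli_phase n (u l) (v l) / 2 * cnj (M $$ (u l, 0))"
      using uv(1)[OF that] by simp
    also have "\<dots> = complex_of_real (Re (cnj (pauli_phase n (u l) (v l)) * M $$ (u l, 0)))"
      by (simp add: complex_eq_iff diff_divide_distrib)
    finally show ?thesis .
  qed
  have "first_order_coords n 1 ?D u v a b"
    unfolding first_order_coords_def
  proof (intro allI impI conjI)
    fix l assume l: "l < ?D"
    show "u l < ?N" "v l < ?N" "u l \<noteq> 0 \<or> v l \<noteq> 0" using uv[OF l] by auto
    have "1\<^sub>m ?N $$ (u l, 0) = (if u l = 0 then 1 else 0 :: complex)" using uv(1)[OF l] by simp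
    moreover have "u l = 0 \<Longrightarrow> \<not> snd (h l)" using hl[OF l] by (auto simp: u_def)
    ultimately show "lin_form ?N 1 (a l) (b l) (1\<^sub>m ?N) = 0"
      unfolding lf[OF l] ph[OF l] by auto
    fix m assume m: "m < ?D"
    have e: "l = m \<longleftrightarrow> u l = u m \<and> snd (h l) = snd (h m)"
      using bij_betw_imp_inj_on[OF h] l m unfolding u_def inj_on_def by (auto simp: prod_eq_iff)
    have "pauli_gen n (u m) (v m) $$ (u l, 0) = (if u l = u m then pauli_phase n (u m) (v m) else 0)"
      using uv(1)[OF l] by (auto simp: pauli_gen_def pauli_def)
    then show "lin_form ?N 1 (a l) (b l) (pauli_gen n (u m) (v m)) = (if l = m then 1 else 0)"
      unfolding lf[OF l] e ph[OF l] ph[OF m] by auto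
  qed
  then show ?thesis by blast
qed

section \<open>Growth of the dimension\<close>

definition circuit_set :: "nat \<Rightarrow> (nat \<times> nat) list \<Rightarrow> complex Matrix.mat set" where
  "circuit_set n arch = {circuit_unitary n arch gs | gs. \<forall>i. gs i \<in> SU4}"

lemma circuit_set_carrier: "circuit_set n arch \<subseteq> carrier_mat (2^n) (2^n)"
  by (auto simp: circuit_set_def)

lemma one_in_circuit_set: "1\<^sub>m (2^n) \<in> circuit_set n arch"
  unfolding circuit_set_def using circuit_unitary_one[of n arch, symmetric] SU4_one by (intro CollectI exI[of _ "\<lambda>_. Finite_Cartesian_Product.mat 1"]) simp

lemma circuit_set_append:
  assumes "S \<in> circuit_set n ys" "x \<in> circuit_set n xs"
  shows "S * x \<in> circuit_set n (xs @ ys)"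
proof -
  obtain gs hs where g: "x = circuit_unitary n xs gs" "\<And>i. gs i \<in> SU4" and h: "S = circuit_unitary n ys hs" "\<And>i. hs i \<in> SU4"
    using assms by (auto simp: circuit_set_def)
  let ?g = "\<lambda>i. if i < length xs then gs i else hs (i - length xs)"
  have "circuit_unitary n xs ?g = x" unfolding g by (intro circuit_unitary_cong) simp
  then have "circuit_unitary n (xs @ ys) ?g = S * x" unfolding circuit_unitary_append h by simp
  moreover have "\<forall>i. ?g i \<in> SU4" using g h by simp
  ultimately show ?thesis unfolding circuit_set_def by (intro CollectI exI[of _ ?g]) simp
qed

lemma circuit_set_append_mono: "circuit_set n xs \<subseteq> circuit_set n (xs @ ys)"
proof
  fix x assume x: "x \<in> circuit_set n xs"
  then have "1\<^sub>m (2^n) * x = x" using circuit_set_carrier[of n xs] by (intro left_mult_one_mat) auto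
  then show "x \<in> circuit_set n (xs @ ys)" using circuit_set_append[OF one_in_circuit_set x] by simp
qed

lemma embed_gate_in_circuit_set:
  assumes "p \<in> set arch" "g \<in> SU4"
  shows "embed_gate n p g \<in> circuit_set n arch"
  using assms(1)
proof (induction arch rule: rev_induct)
  case (snoc q arch)
  show ?case
  proof (cases "p \<in> set arch")
    case True
    then show ?thesis using snoc.IH circuit_set_append_mono by blast
  next
    case False
    then have q: "q = p" using snoc.prems by simp
    have "circuit_unitary n [p] (\<lambda>_. g) = embed_gate n p g"
      using circuit_unitary_snoc[of n "[]" p "\<lambda>_. g"] by (simp add: circuit_unitary_Nil right_mult_one_mat[OF embed_gate_carrier])
    then have "embed_gate n p g \<in> circuit_set n [p]" unfolding circuit_set_def using assms(2) by (intro CollectI exI[of _ "\<lambda>_. g"]) simp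
    from circuit_set_append[OF this one_in_circuit_set[of n arch]]
    show ?thesis unfolding q by (simp add: right_mult_one_mat[OF embed_gate_carrier])
  qed
qed simp

lemma mat_poly_circuit:
  assumes "mat_poly (2^n) c f" "c \<le> 2^n"
  shows "gate_poly (length arch) (\<lambda>gs. f (circuit_unitary n arch gs))"
  using assms by (intro mat_poly_gate_poly[OF assms(1)] gate_poly_circuit) auto

lemma circuit_set_irreducible:
  assumes f: "mat_poly (2^n) c f" and g: "mat_poly (2^n) c g" and c: "c \<le> 2^n"
    and z: "\<And>x. x \<in> circuit_set n arch \<Longrightarrow> f x * g x = 0"
    and nz: "x0 \<in> circuit_set n arch" "f x0 \<noteq> 0" and x: "x \<in> circuit_set n arch"
  shows "g x = 0"
proof -
  obtain gs0 gs where g0: "x0 = circuit_unitary n arch gs0" "\<And>i. gs0 i \<in> SU4" and gx: "x = circuit_unitary n arch gs" "\<And>i. gs i \<in> SU4"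
    using nz(1) x by (auto simp: circuit_set_def)
  show ?thesis unfolding gx(1)
  proof (rule gate_poly_mult_zero[OF mat_poly_circuit[OF f c] mat_poly_circuit[OF g c], where ?gs0.0=gs0])
    fix hs :: "nat \<Rightarrow> complex^4^4" assume hs: "\<And>i. i < length arch \<Longrightarrow> hs i \<in> SU4"
    let ?h = "\<lambda>i. if i < length arch then hs i else Finite_Cartesian_Product.mat 1"
    have "circuit_unitary n arch hs = circuit_unitary n arch ?h" by (intro circuit_unitary_cong) simp
    also have "\<dots> \<in> circuit_set n arch" unfolding circuit_set_def using hs SU4_one by auto
    finally show "f (circuit_unitary n arch hs) * g (circuit_unitary n arch hs) = 0" by (rule z)
  qed (use g0 gx nz in auto)
qed

lemma alg_indep_cong: "(\<And>l. l < j \<Longrightarrow> P l = P' l) \<Longrightarrow> alg_indep X P j \<longleftrightarrow> alg_indep X P' j"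
proof -
  assume "\<And>l. l < j \<Longrightarrow> P l = P' l"
  then have "(\<Prod>l<j. P l x ^ k l) = (\<Prod>l<j. P' l x ^ k l)" for x k by (intro prod.cong) auto
  then show ?thesis unfolding alg_indep_def by simp
qed

lemma mat_poly_monomials:
  assumes "\<And>l. l < j \<Longrightarrow> mat_poly N c (P l)"
  shows "mat_poly N c (\<lambda>x. \<Sum>k\<in>exponents j d. a k * (\<Prod>l<j. P l x ^ k l))"
  by (intro mat_poly_sum mat_poly_prod mat_poly.mult mat_poly.const mat_poly_power assms) auto

lemma preservingD:
  assumes "S \<in> preserving N c X" "mat_poly N c f" "\<forall>x\<in>X. f x = 0" "x \<in> X"
  shows "f (S * x) = 0"
  using assms unfolding preserving_def by blast

lemma rot_prod_in:
  assumes "1\<^sub>m (2^n) \<in> G" "\<forall>A\<in>G. \<forall>B\<in>G. A * B \<in> G" "\<And>l. l < j \<Longrightarrow> rot_in n G (u l) (v l)"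
  shows "rot_prod n u v j \<tau> \<in> G"
  using assms(3) by (induction j) (use assms(1,2) in \<open>auto simp: rot_in_def\<close>)

text \<open>Adding a causal slice either enlarges the Zariski closure, raising the transcendence degree, or the
  closure is already invariant under all Pauli rotations and hence of full dimension.\<close>

lemma dimension_step:
  assumes n: "n \<ge> 2" and c: "c \<le> 2^n" and ok: "wf_arch n ys" and causal: "causal_slice n ys"
    and co: "first_order_coords n c D u v a b" and j: "j < D"
    and P: "\<And>l. l < j \<Longrightarrow> mat_poly (2^n) c (P l)" and ind: "alg_indep (circuit_set n xs) P j"
  shows "\<exists>P'. (\<forall>l<Suc j. mat_poly (2^n) c (P' l)) \<and> alg_indep (circuit_set n (xs @ ys)) P' (Suc j)"
proof (cases "\<exists>Q. mat_poly (2^n) c Q \<and> (\<forall>x\<in>circuit_set n xs. Q x = 0) \<and> (\<exists>x\<in>circuit_set n (xs @ ys). Q x \<noteq> 0)")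
  case True
  then obtain Q x0 where Q: "mat_poly (2^n) c Q" "\<And>x. x \<in> circuit_set n xs \<Longrightarrow> Q x = 0"
    and x0: "x0 \<in> circuit_set n (xs @ ys)" "Q x0 \<noteq> 0" by blast
  define P' where "P' = P(j := Q)"
  have P'l: "P' l = P l" if "l < j" for l using that by (simp add: P'_def)
  have P'j: "P' j = Q" by (simp add: P'_def)
  have mp: "mat_poly (2^n) c (P' l)" if "l < Suc j" for l using that P Q(1) by (cases "l = j") (auto simp: P'_def)
  have "alg_indep (circuit_set n (xs @ ys)) P' (Suc j)"
  proof (rule alg_indep_extend)
    show "alg_indep (circuit_set n xs) P' j" using ind alg_indep_cong[of j P' P] P'l by simp
    show "circuit_set n xs \<subseteq> circuit_set n (xs @ ys)" by (rule circuit_set_append_mono)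
    show "P' j x = 0" if "x \<in> circuit_set n xs" for x using Q(2) that by (simp add: P'j)
  next
    fix d e c' x
    let ?h = "\<lambda>x. \<Sum>q\<le>e. P' j x ^ q * (\<Sum>k\<in>exponents j d. c' q k * (\<Prod>l<j. P' l x ^ k l))"
    assume z: "\<And>x. x \<in> circuit_set n (xs @ ys) \<Longrightarrow> P' j x * ?h x = 0" and x: "x \<in> circuit_set n (xs @ ys)"
    have hm: "mat_poly (2^n) c ?h" by (intro mat_poly_sum mat_poly.mult mat_poly_power mat_poly_monomials mp) auto
    show "?h x = 0"
    proof (rule circuit_set_irreducible[OF _ hm c _ x0(1) _ x])
      show "mat_poly (2^n) c (P' j)" by (simp add: mp)
      show "P' j x0 \<noteq> 0" using x0(2) by (simp add: P'j)
    qed (rule z)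
  qed
  then show ?thesis using mp by blast
next
  case False
  let ?G = "preserving (2^n) c (circuit_set n xs)"
  have cl: "\<forall>A\<in>?G. \<forall>B\<in>?G. A * B \<in> ?G" using preserving_mult[OF circuit_set_carrier c] by blast
  have "embed_gate n p g \<in> ?G" if "p \<in> set ys" "g \<in> SU4" for p g
    unfolding preserving_def
    using False circuit_set_append[OF embed_gate_in_circuit_set[OF that, of n]] by auto
  then have rots: "all_rots_on n ?G {1..n}" by (intro causal_slice_all_rots[OF n ok causal cl])
  have rot: "rot_in n ?G (u l) (v l)" if "l < Suc j" for l
  proof (rule all_rots_onD[OF rots])
    have "l < D" using that j by simp
    then show uv: "u l < 2^n" "v l < 2^n" "u l \<noteq> 0 \<or> v l \<noteq> 0" using co by (auto simp: first_order_coords_def)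
    show "Suc k \<in> {1..n}" if k: "bit (u l) k \<or> bit (v l) k" for k
    proof -
      have "\<forall>i\<ge>n. \<not> bit (u l) i" "\<forall>i\<ge>n. \<not> bit (v l) i" using uv(1,2) by (simp_all only: less_two_power_bit)
      then have "k < n" using k by (meson leI)
      then show ?thesis by simp
    qed
  qed
  let ?y = "\<lambda>l. lin_form (2^n) c (a l) (b l)"
  have "alg_indep (circuit_set n (xs @ ys)) ?y (Suc j)"
    unfolding alg_indep_def
  proof (intro allI impI ballI)
    fix d c' k assume z: "\<forall>x\<in>circuit_set n (xs @ ys). (\<Sum>k\<in>exponents (Suc j) d. c' k * (\<Prod>l<Suc j. ?y l x ^ k l)) = 0"
      and k: "k \<in> exponents (Suc j) d"
    let ?f = "\<lambda>x. \<Sum>k\<in>exponents (Suc j) d. c' k * (\<Prod>l<Suc j. ?y l x ^ k l)"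
    have f: "mat_poly (2^n) c ?f" by (intro mat_poly_monomials mat_poly_lin_form)
    have f0: "\<forall>x\<in>circuit_set n xs. ?f x = 0" using z circuit_set_append_mono by blast
    have fz: "?f (rot_prod n u v (Suc j) \<tau>) = 0" for \<tau>
    proof -
      have "rot_prod n u v (Suc j) \<tau> \<in> ?G"
        by (rule rot_prod_in[OF preserving_one[OF circuit_set_carrier] cl rot])
      from preservingD[OF this f f0 one_in_circuit_set]
      have "?f (rot_prod n u v (Suc j) \<tau> * 1\<^sub>m (2^n)) = 0" .
      then show ?thesis by (simp only: right_mult_one_mat[OF rot_prod_carrier])
    qed
    have "alg_indep (range (rot_prod n u v (Suc j))) ?y (Suc j)"
      by (rule alg_indep_rot_prod[OF co c Suc_leI[OF j]])
    then show "c' k = 0"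
    proof (rule alg_indepD[OF _ _ k])
      fix x assume "x \<in> range (rot_prod n u v (Suc j))"
      then obtain \<tau> where "x = rot_prod n u v (Suc j) \<tau>" by (elim imageE)
      then show "?f x = 0" using fz by (simp only:)
    qed
  qed
  then show ?thesis by (intro exI[of _ ?y]) (simp add: mat_poly_lin_form)
qed

lemma dimension_growth:
  assumes n: "n \<ge> 2" and c: "c \<le> 2^n" and ok: "wf_arch n arch" and slices: "causal_slices n T L arch"
    and co: "first_order_coords n c D u v a b" and "j \<le> T" "j \<le> D"
  shows "\<exists>P. (\<forall>l<j. mat_poly (2^n) c (P l)) \<and> alg_indep (circuit_set n (take (j * L) arch)) P j"
  using assms(6,7)
proof (induction j)
  case 0
  have "circuit_set n (take (0 * L) arch) \<noteq> {}" using one_in_circuit_set by blast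
  from alg_indep_0[OF this] show ?case by simp
next
  case (Suc j)
  let ?ys = "take L (drop (j * L) arch)"
  have "Suc j * L = j * L + L" by simp
  then have t: "take (Suc j * L) arch = take (j * L) arch @ ?ys" by (simp only: take_add)
  have "set ?ys \<subseteq> set arch" by (meson order_trans set_drop_subset set_take_subset)
  then have oky: "wf_arch n ?ys" using ok unfolding wf_arch_alt by blast
  have "causal_slice n ?ys" using slices Suc.prems by (auto simp: causal_slices_def)
  moreover obtain P where "\<forall>l<j. mat_poly (2^n) c (P l)" "alg_indep (circuit_set n (take (j * L) arch)) P j"
    using Suc by auto
  moreover have "j < D" using Suc.prems by simp
  ultimately show ?case unfolding t by (intro dimension_step[OF n c oky _ co]) auto
qed

lemma circuit_avoids:
  assumes n: "n \<ge> 2" and c: "c \<le> 2^n" and ok: "wf_arch n arch" and slices: "causal_slices n T L arch"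
    and co: "first_order_coords n c D u v a b" and "T \<le> D"
    and ok': "wf_arch n arch'" and short: "9 * length arch' + 3 * n < T"
  shows "AE gs in PiM {..<length arch} (\<lambda>_. haar_SU4). \<forall>gs'. (\<forall>i<length arch'. gs' i \<in> SU4) \<longrightarrow>
     (\<exists>x<2^n. \<exists>y<c. circuit_unitary n arch gs $$ (x, y) \<noteq> circuit_unitary n arch' gs' $$ (x, y))"
proof -
  have "length arch = T * L" using slices by (simp add: causal_slices_def)
  then obtain P where P: "\<And>l. l < T \<Longrightarrow> mat_poly (2^n) c (P l)" and ind: "alg_indep (circuit_set n arch) P T"
    using dimension_growth[OF n c ok slices co order_refl \<open>T \<le> D\<close>] by auto
  have tp: "\<exists>e. trig_poly (9 * length arch' + 3 * n) e (\<lambda>\<theta>. P l (circuit_param n arch' \<theta>))" if "l < T" for l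
    by (rule mat_poly_trig_poly[OF P[OF that]], rule trig_poly_circuit_param) (use c in auto)
  obtain a' d x0 where rel: "\<And>\<theta>. (\<Sum>k\<in>exponents T d. a' k * (\<Prod>l<T. P l (circuit_param n arch' \<theta>) ^ k l)) = 0"
    and x0: "x0 \<in> circuit_set n arch" "(\<Sum>k\<in>exponents T d. a' k * (\<Prod>l<T. P l x0 ^ k l)) \<noteq> 0"
    by (rule alg_indep_trig_relation[where p="circuit_param n arch'", OF ind tp short]) (assumption | rule that)+
  define f where "f x = (\<Sum>k\<in>exponents T d. a' k * (\<Prod>l<T. P l x ^ k l))" for x
  have f: "mat_poly (2^n) c f" unfolding f_def[abs_def] by (intro mat_poly_monomials P)
  obtain gs0 where gs0: "x0 = circuit_unitary n arch gs0" "\<And>i. gs0 i \<in> SU4" using x0(1) by (auto simp: circuit_set_def)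
  have "AE gs in PiM {..<length arch} (\<lambda>_. haar_SU4). f (circuit_unitary n arch gs) \<noteq> 0"
    by (rule gate_poly_AE_nonzero[OF mat_poly_circuit[OF f c], of _ gs0]) (use gs0 x0 in \<open>auto simp: f_def\<close>)
  then show ?thesis
  proof eventually_elim
    case (elim gs)
    show ?case
    proof (intro allI impI, rule ccontr)
      fix gs' assume gs': "\<forall>i<length arch'. gs' i \<in> SU4"
        and "\<not> (\<exists>x<2^n. \<exists>y<c. circuit_unitary n arch gs $$ (x, y) \<noteq> circuit_unitary n arch' gs' $$ (x, y))"
      then have "f (circuit_unitary n arch gs) = f (circuit_unitary n arch' gs')"
        by (intro mat_poly_cong_columns[OF f]) blast
      moreover obtain \<theta> where "circuit_unitary n arch' gs' = circuit_param n arch' \<theta>"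
        using circuit_in_param[OF ok'] gs' by blast
      ultimately have "f (circuit_unitary n arch gs) = 0" using rel by (simp add: f_def)
      then show False using elim by simp
    qed
  qed
qed

lemma circuit_avoids_all:
  assumes "n \<ge> 2" "c \<le> 2^n" "wf_arch n arch" "causal_slices n T L arch" "first_order_coords n c D u v a b" "T \<le> D"
  shows "AE gs in PiM {..<length arch} (\<lambda>_. haar_SU4). (\<forall>i<length arch. gs i \<in> SU4) \<and>
     (\<forall>arch' gs'. wf_arch n arch' \<longrightarrow> 9 * length arch' + 3 * n < T \<longrightarrow> (\<forall>i<length arch'. gs' i \<in> SU4) \<longrightarrow>
     (\<exists>x<2^n. \<exists>y<c. circuit_unitary n arch gs $$ (x, y) \<noteq> circuit_unitary n arch' gs' $$ (x, y)))"
proof -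
  let ?M = "PiM {..<length arch} (\<lambda>_. haar_SU4)"
  have "AE gs in ?M. \<forall>i\<in>{..<length arch}. gs i \<in> SU4"
  proof (intro AE_finite_allI)
    fix i assume "i \<in> {..<length arch}"
    then show "AE gs in ?M. gs i \<in> SU4"
      using AE_haar_SU4 by (intro AE_PiM_component) (auto intro: prob_haar_SU4)
  qed auto
  moreover have "AE gs in ?M. \<forall>arch'. wf_arch n arch' \<longrightarrow> 9 * length arch' + 3 * n < T \<longrightarrow> (\<forall>gs'. (\<forall>i<length arch'. gs' i \<in> SU4) \<longrightarrow>
     (\<exists>x<2^n. \<exists>y<c. circuit_unitary n arch gs $$ (x, y) \<noteq> circuit_unitary n arch' gs' $$ (x, y)))"
    unfolding AE_all_countable
  proof
    fix arch' :: "(nat \<times> nat) list"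
    show "AE gs in ?M. wf_arch n arch' \<longrightarrow> 9 * length arch' + 3 * n < T \<longrightarrow> (\<forall>gs'. (\<forall>i<length arch'. gs' i \<in> SU4) \<longrightarrow>
     (\<exists>x<2^n. \<exists>y<c. circuit_unitary n arch gs $$ (x, y) \<noteq> circuit_unitary n arch' gs' $$ (x, y)))"
    proof (cases "wf_arch n arch' \<and> 9 * length arch' + 3 * n < T")
      case True
      then have "AE gs in ?M. \<forall>gs'. (\<forall>i<length arch'. gs' i \<in> SU4) \<longrightarrow>
        (\<exists>x<2^n. \<exists>y<c. circuit_unitary n arch gs $$ (x, y) \<noteq> circuit_unitary n arch' gs' $$ (x, y))"
        using circuit_avoids[OF assms] by blast
      then show ?thesis by eventually_elim blast
    qed auto
  qed
  ultimately show ?thesis by eventually_elim blast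
qed

lemma rate_le_of_not_short:
  assumes "L > 0" "\<not> 9 * r + 3 * n < T"
  shows "real r \<ge> real (T * L) / (9 * real L) - real n / 3"
proof -
  have "T \<le> 9 * r + 3 * n" using assms(2) by simp
  then have "real T \<le> real (9 * r + 3 * n)" by (simp only: of_nat_le_iff)
  moreover have "real (T * L) / (9 * real L) = real T / 9" using assms(1) by simp
  ultimately show ?thesis by simp
qed

theorem theorem1:
  fixes n T L :: nat and arch :: "(nat \<times> nat) list"
  assumes "n > 0" and "even n" and "L > 0"
    and "wf_arch n arch"
    and "causal_slices n T L arch"
  shows "(T < 4^n - 1 \<longrightarrow>
           (AE gs in PiM {..<length arch} (\<lambda>_. haar_SU4).
              real (circuit_complexity n (circuit_unitary n arch gs))
                \<ge> real (length arch) / (9 * real L) - real n / 3))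
       \<and> (T < 2^(n+1) - 1 \<longrightarrow>
           (AE gs in PiM {..<length arch} (\<lambda>_. haar_SU4).
              real (state_complexity n (circuit_unitary n arch gs *\<^sub>v zero_state n))
                \<ge> real (length arch) / (9 * real L) - real n / 3))"
proof (intro conjI impI)
  have n: "n \<ge> 2" using assms(1,2) by (metis One_nat_def Suc_leI le_neq_implies_less numeral_2_eq_2 odd_one)
  have len: "length arch = T * L" using assms(5) by (simp add: causal_slices_def)
  {
    assume T: "T < 4^n - 1"
    obtain u v a b where co: "first_order_coords n (2^n) (4^n - 1) u v a b" using unitary_coords by blast
    show "AE gs in PiM {..<length arch} (\<lambda>_. haar_SU4). real (circuit_complexity n (circuit_unitary n arch gs))
                \<ge> real (length arch) / (9 * real L) - real n / 3"
      using circuit_avoids_all[OF n order_refl assms(4,5) co less_imp_le[OF T]]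
    proof eventually_elim
      case (elim gs)
      define Q where "Q r \<longleftrightarrow> (\<exists>arch' gs'. length arch' = r \<and> wf_arch n arch' \<and> (\<forall>i<r. gs' i \<in> SU4) \<and>
        circuit_unitary n arch' gs' = circuit_unitary n arch gs)" for r
      have "Q (length arch)" unfolding Q_def using elim assms(4) by blast
      then have "Q (LEAST r. Q r)" by (rule LeastI)
      then have "Q (circuit_complexity n (circuit_unitary n arch gs))" by (simp add: circuit_complexity_def Q_def[abs_def])
      then obtain arch' gs' where c: "length arch' = circuit_complexity n (circuit_unitary n arch gs)" "wf_arch n arch'"
        "\<forall>i<length arch'. gs' i \<in> SU4" "circuit_unitary n arch' gs' = circuit_unitary n arch gs" unfolding Q_def by auto
      have "\<not> 9 * length arch' + 3 * n < T" using elim c(2-4) by metis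
      then show ?case unfolding len c(1) by (rule rate_le_of_not_short[OF assms(3)])
    qed
  }
  {
    assume T: "T < 2^(n+1) - 1"
    obtain u v a b where co: "first_order_coords n 1 (2^(n+1) - 1) u v a b" using state_coords[OF assms(1)] by blast
    have one: "1 \<le> (2::nat)^n" by simp
    have col: "(M *\<^sub>v zero_state n) = Matrix.col M 0" if "M \<in> carrier_mat (2^n) (2^n)" for M :: "complex Matrix.mat"
      unfolding zero_state_def using that by (intro eq_vecI) auto
    show "AE gs in PiM {..<length arch} (\<lambda>_. haar_SU4). real (state_complexity n (circuit_unitary n arch gs *\<^sub>v zero_state n))
                \<ge> real (length arch) / (9 * real L) - real n / 3"
      using circuit_avoids_all[OF n one assms(4,5) co less_imp_le[OF T]]
    proof eventually_elim
      case (elim gs)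
      define Q where "Q r \<longleftrightarrow> (\<exists>arch' gs'. length arch' = r \<and> wf_arch n arch' \<and> (\<forall>i<r. gs' i \<in> SU4) \<and>
        circuit_unitary n arch' gs' *\<^sub>v zero_state n = circuit_unitary n arch gs *\<^sub>v zero_state n)" for r
      have "Q (length arch)" unfolding Q_def using elim assms(4) by blast
      then have "Q (LEAST r. Q r)" by (rule LeastI)
      then have "Q (state_complexity n (circuit_unitary n arch gs *\<^sub>v zero_state n))" by (simp add: state_complexity_def Q_def[abs_def])
      then obtain arch' gs' where c: "length arch' = state_complexity n (circuit_unitary n arch gs *\<^sub>v zero_state n)" "wf_arch n arch'"
        "\<forall>i<length arch'. gs' i \<in> SU4"
        "circuit_unitary n arch' gs' *\<^sub>v zero_state n = circuit_unitary n arch gs *\<^sub>v zero_state n" unfolding Q_def by auto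
      have "Matrix.col (circuit_unitary n arch' gs') 0 = Matrix.col (circuit_unitary n arch gs) 0"
        using c(4) by (simp add: col)
      then have e: "circuit_unitary n arch gs $$ (x, y) = circuit_unitary n arch' gs' $$ (x, y)" if "x < 2^n" "y < 1" for x y
        using that carrier_matD[OF circuit_unitary_carrier] by (metis index_col less_one one less_le_trans)
      have "\<not> 9 * length arch' + 3 * n < T" using elim c(2,3) e by blast
      then show ?case unfolding len c(1) by (rule rate_le_of_not_short[OF assms(3)])
    qed
  }
qed

end
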